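(* Let $X$ be a cocompact Kobayashi hyperbolic complex manifold, and let $F=(f_1,\dots,f_k)$, $k\ge1$, be a $k$-tuple of commuting holomorphic self-maps of $X$. Let $(Z,\ell,T=(\tau_1,\dots,\tau_k))$ be a canonical Kobayashi hyperbolic semi-model (CSM) for $F$. Then for all $1\le j\le k$, $$c(\tau_j)=c(f_j).$$
   Context: Complex manifolds are connected. $X$ is Kobayashi hyperbolic if its Kobayashi pseudodistance $k_X$ is a distance, and cocompact if $X/\mathrm{aut}(X)$ is compact. For a holomorphic self-map $f$ of a complex manifold $X$, the divergence rate is $c(f):=\lim_{m\to\infty}\frac{k_X(f^m(x),x)}{m}\in[0,+\infty)$, where $x\in X$; the limit exists and does not depend on $x$. For $N=(n_1,\dots,n_k)\in\mathbb{N}^k$ ($0\in\mathbb{N}$), $F^N=f_1^{n_1}\circ\dots\circ f_k^{n_k}$; for commuting automorphisms $\Phi^{-N}=(\Phi^N)^{-1}$. A semi-model for $F$ is a triple $(\Lambda,h,\Phi)$ with $\Lambda$ a complex manifold, $h\colon X\to\Lambda$ holomorphic, $\Phi=(\varphi_1,\dots,\varphi_k)$ a $k$-tuple of commuting automorphisms of $\Lambda$ with $h\circ f_j=\varphi_j\circ h$ for all $j$ and $\bigcup_{N\in\mathbb{N}^k}\Phi^{-N}(h(X))=\Lambda$. A CSM for $F$ is a semi-model $(Z,\ell,T)$ with $Z$ Kobayashi hyperbolic such that for every semi-model $(\Lambda,h,\Phi)$ with $\Lambda$ Kobayashi hyperbolic there is a holomorphic map $\eta\colon Z\to\Lambda$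 with $\eta\circ\ell=h$ and $\eta\circ\tau_j=\varphi_j\circ\eta$ for all $j$. *)

theory Defs
  imports "HOL-Analysis.Analysis"
begin

section \<open>Holomorphic functions of several variables\<close>

text \<open>
  The dimension of a manifold must be a value and not a type, because the universal property below
  ranges over manifolds of all dimensions.  As with \<^const>\<open>Euclidean_space\<close>, the space of
  \<open>n\<close>-tuples of complex numbers is the set of functions on the naturals that vanish from \<open>n\<close> on;
  the product topology induces the usual topology on it.
\<close>

definition complex_space :: "nat \<Rightarrow> (nat \<Rightarrow> complex) topology" where
  "complex_space n = top_of_set {z. \<forall>i\<ge>n. z i = 0}"

text \<open>Complex Frechet differentiability at every point of an open set \<open>S\<close> of \<^term>\<open>complex_space n\<close>.\<close>

definition holo_fun_on :: "nat \<Rightarrow> (nat \<Rightarrow> complex) set \<Rightarrow> ((nat \<Rightarrow> complex) \<Rightarrow> complex) \<Rightarrow> bool" where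
  "holo_fun_on n S f \<longleftrightarrow>
     (\<forall>p\<in>S. \<exists>a :: nat \<Rightarrow> complex.
        ((\<lambda>z. cmod (f z - f p - (\<Sum>i<n. a i * (z i - p i))) /
               L2_set (\<lambda>i. cmod (z i - p i)) {..<n}) \<longlongrightarrow> 0) (at p within S))"

section \<open>Complex manifolds\<close>

text \<open>
  The underlying set is the carrier of \<^term>\<open>mfd_top M\<close>; a chart is given by its domain and its
  coordinate map, whose values outside the domain are irrelevant.  The atlas need not be maximal.
\<close>

record 'a cmfd =
  mfd_dim :: nat
  mfd_top :: "'a topology"
  mfd_atlas :: "('a set \<times> ('a \<Rightarrow> nat \<Rightarrow> complex)) set"

abbreviation carrier_of :: "'a cmfd \<Rightarrow> 'a set" where
  "carrier_of M \<equiv> topspace (mfd_top M)"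

definition complex_manifold :: "'a cmfd \<Rightarrow> bool" where
  "complex_manifold M \<longleftrightarrow>
     Hausdorff_space (mfd_top M) \<and>
     (\<exists>\<B>. countable \<B> \<and> (\<forall>B\<in>\<B>. openin (mfd_top M) B) \<and>
        (\<forall>U x. openin (mfd_top M) U \<and> x \<in> U \<longrightarrow> (\<exists>B\<in>\<B>. x \<in> B \<and> B \<subseteq> U))) \<and>
     connected_space (mfd_top M) \<and> carrier_of M \<noteq> {} \<and>
     (\<Union>(U, \<phi>)\<in>mfd_atlas M. U) = carrier_of M \<and>
     (\<forall>(U, \<phi>)\<in>mfd_atlas M.
        openin (mfd_top M) U \<and> openin (complex_space (mfd_dim M)) (\<phi> ` U) \<and>
        homeomorphic_map (subtopology (mfd_top M) U)
          (subtopology (complex_space (mfd_dim M)) (\<phi> ` U)) \<phi>) \<and>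
     (\<forall>(U, \<phi>)\<in>mfd_atlas M. \<forall>(V, \<psi>)\<in>mfd_atlas M. \<forall>j<mfd_dim M.
        holo_fun_on (mfd_dim M) (\<phi> ` (U \<inter> V)) (\<lambda>z. \<psi> (inv_into U \<phi> z) j))"

definition holo_map :: "'a cmfd \<Rightarrow> 'b cmfd \<Rightarrow> ('a \<Rightarrow> 'b) \<Rightarrow> bool" where
  "holo_map M N f \<longleftrightarrow>
     continuous_map (mfd_top M) (mfd_top N) f \<and>
     (\<forall>(U, \<phi>)\<in>mfd_atlas M. \<forall>(V, \<psi>)\<in>mfd_atlas N. \<forall>j<mfd_dim N.
        holo_fun_on (mfd_dim M) (\<phi> ` (U \<inter> f -` V)) (\<lambda>z. \<psi> (f (inv_into U \<phi> z)) j))"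

definition automorphism :: "'a cmfd \<Rightarrow> ('a \<Rightarrow> 'a) \<Rightarrow> bool" where
  "automorphism M g \<longleftrightarrow>
     holo_map M M g \<and> (\<exists>g'. holo_map M M g' \<and> (\<forall>x\<in>carrier_of M. g' (g x) = x \<and> g (g' x) = x))"

section \<open>The Kobayashi pseudodistance\<close>

definition unit_disc :: "complex cmfd" where
  "unit_disc = \<lparr>mfd_dim = 1, mfd_top = top_of_set (ball 0 1),
                mfd_atlas = {(ball 0 1, \<lambda>z i. if i = 0 then z else 0)}\<rparr>"

text \<open>The Poincare distance, normalised to constant curvature \<open>-4\<close>.\<close>

definition poincare_dist :: "complex \<Rightarrow> complex \<Rightarrow> real" where
  "poincare_dist a b = artanh (cmod ((a - b) / (1 - cnj a * b)))"

text \<open>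
  The infimum runs over the lengths of the chains of holomorphic discs from \<open>x\<close> to \<open>y\<close>, with
  successive junction points \<open>p 0, \<dots>, p m\<close>; such chains exist since manifolds are connected.
  The value is fixed to be 0 off the carrier only so that \<^const>\<open>Metric_space\<close> applies.
\<close>

definition kobayashi :: "'a cmfd \<Rightarrow> 'a \<Rightarrow> 'a \<Rightarrow> real" where
  "kobayashi M x y =
     (if x \<in> carrier_of M \<and> y \<in> carrier_of M then
        Inf {(\<Sum>i<m. poincare_dist (a i) (b i)) | m a b g p.
               0 < m \<and> p 0 = x \<and> p m = y \<and>
               (\<forall>i<m. holo_map unit_disc M (g i) \<and> a i \<in> ball 0 1 \<and> b i \<in> ball 0 1 \<and>
                       g i (a i) = p i \<and> g i (b i) = p (Suc i))}
      else 0)"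

definition kobayashi_hyperbolic :: "'a cmfd \<Rightarrow> bool" where
  "kobayashi_hyperbolic M \<longleftrightarrow> Metric_space (carrier_of M) (kobayashi M)"

definition divergence_rate :: "'a cmfd \<Rightarrow> ('a \<Rightarrow> 'a) \<Rightarrow> real" where
  "divergence_rate M f =
     (THE c. \<forall>x\<in>carrier_of M. (\<lambda>m. kobayashi M ((f ^^ m) x) x / real m) \<longlonglongrightarrow> c)"

section \<open>Cocompactness\<close>

definition aut_orbit :: "'a cmfd \<Rightarrow> 'a \<Rightarrow> 'a set" where
  "aut_orbit M x = {g x | g. automorphism M g}"

definition orbit_space :: "'a cmfd \<Rightarrow> 'a set topology" where
  "orbit_space M =
     topology (\<lambda>\<V>. \<V> \<subseteq> aut_orbit M ` carrier_of M \<and>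
                    openin (mfd_top M) {x \<in> carrier_of M. aut_orbit M x \<in> \<V>})"

lemma openin_orbit_space:
  "openin (orbit_space M) \<V> \<longleftrightarrow>
     \<V> \<subseteq> aut_orbit M ` carrier_of M \<and> openin (mfd_top M) {x \<in> carrier_of M. aut_orbit M x \<in> \<V>}"
proof -
  let ?q = "aut_orbit M"
  have "istopology (\<lambda>\<V>. \<V> \<subseteq> ?q ` carrier_of M \<and> openin (mfd_top M) {x \<in> carrier_of M. ?q x \<in> \<V>})"
    unfolding istopology_def
  proof (rule conjI; clarify)
    fix S T
    assume "openin (mfd_top M) {x \<in> carrier_of M. ?q x \<in> S}"
      "openin (mfd_top M) {x \<in> carrier_of M. ?q x \<in> T}" "S \<subseteq> ?q ` carrier_of M"
    moreover have "{x \<in> carrier_of M. ?q x \<in> S \<inter> T} =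
        {x \<in> carrier_of M. ?q x \<in> S} \<inter> {x \<in> carrier_of M. ?q x \<in> T}"
      by auto
    ultimately show "S \<inter> T \<subseteq> ?q ` carrier_of M \<and> openin (mfd_top M) {x \<in> carrier_of M. ?q x \<in> S \<inter> T}"
      by auto
  next
    fix \<K>
    assume *: "\<forall>K\<in>\<K>. K \<subseteq> ?q ` carrier_of M \<and> openin (mfd_top M) {x \<in> carrier_of M. ?q x \<in> K}"
    have "{x \<in> carrier_of M. ?q x \<in> \<Union>\<K>} = (\<Union>K\<in>\<K>. {x \<in> carrier_of M. ?q x \<in> K})"
      by auto
    with * show "\<Union>\<K> \<subseteq> ?q ` carrier_of M \<and> openin (mfd_top M) {x \<in> carrier_of M. ?q x \<in> \<Union>\<K>}"
      by (auto intro!: openin_Union)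
  qed
  then show ?thesis
    unfolding orbit_space_def by simp
qed

lemma quotient_map_orbit_space: "quotient_map (mfd_top M) (orbit_space M) (aut_orbit M)"
proof -
  have "{x \<in> carrier_of M. aut_orbit M x \<in> aut_orbit M ` carrier_of M} = carrier_of M"
    by blast
  then have "openin (orbit_space M) (aut_orbit M ` carrier_of M)"
    by (simp add: openin_orbit_space)
  then have "topspace (orbit_space M) = aut_orbit M ` carrier_of M"
    by (metis openin_orbit_space openin_subset openin_topspace subset_antisym)
  then show ?thesis
    by (simp add: quotient_map_def openin_orbit_space)
qed

definition cocompact :: "'a cmfd \<Rightarrow> bool" where
  "cocompact M \<longleftrightarrow> compact_space (orbit_space M)"

section \<open>Semi-models of commuting tuples\<close>

text \<open>
  A \<open>k\<close>-tuple of maps is a function on the naturals of which only the values at \<open>1, \<dots>, k\<close>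
  matter, and likewise for multi-indices.
\<close>

definition commuting_on :: "'a set \<Rightarrow> nat \<Rightarrow> (nat \<Rightarrow> 'a \<Rightarrow> 'a) \<Rightarrow> bool" where
  "commuting_on S k F \<longleftrightarrow> (\<forall>i\<in>{1..k}. \<forall>j\<in>{1..k}. \<forall>x\<in>S. F i (F j x) = F j (F i x))"

fun multi_iter :: "nat \<Rightarrow> (nat \<Rightarrow> 'a \<Rightarrow> 'a) \<Rightarrow> (nat \<Rightarrow> nat) \<Rightarrow> 'a \<Rightarrow> 'a" where
  "multi_iter 0 F N = id"
| "multi_iter (Suc k) F N = multi_iter k F N \<circ> (F (Suc k) ^^ N (Suc k))"

definition semi_model ::
  "nat \<Rightarrow> 'a cmfd \<Rightarrow> (nat \<Rightarrow> 'a \<Rightarrow> 'a) \<Rightarrow> 'b cmfd \<Rightarrow> ('a \<Rightarrow> 'b) \<Rightarrow> (nat \<Rightarrow> 'b \<Rightarrow> 'b) \<Rightarrow> bool" where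
  "semi_model k X F L h \<Phi> \<longleftrightarrow>
     complex_manifold L \<and> holo_map X L h \<and>
     (\<forall>j\<in>{1..k}. automorphism L (\<Phi> j)) \<and> commuting_on (carrier_of L) k \<Phi> \<and>
     (\<forall>j\<in>{1..k}. \<forall>x\<in>carrier_of X. h (F j x) = \<Phi> j (h x)) \<and>
     (\<Union>N. inv_into (carrier_of L) (multi_iter k \<Phi> N) ` h ` carrier_of X) = carrier_of L"

text \<open>
  HOL cannot quantify over the type carrying \<open>L\<close>.  The type of real numbers loses no generality:
  by the following lemma the carrier of every complex manifold injects into it, and the structure
  can be transported along the injection.
\<close>

lemma complex_manifold_inj_real:
  assumes "complex_manifold M"
  shows "\<exists>e :: 'a \<Rightarrow> real. inj_on e (carrier_of (M :: 'a cmfd))"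
proof -
  obtain \<B> where "countable \<B>" and
    \<B>: "\<And>U x. \<lbrakk>openin (mfd_top M) U; x \<in> U\<rbrakk> \<Longrightarrow> \<exists>B\<in>\<B>. x \<in> B \<and> B \<subseteq> U"
    using assms unfolding complex_manifold_def by meson
  obtain r :: "nat set \<Rightarrow> real" where r: "inj r"
    using nat_sets_eqpoll_reals unfolding eqpoll_def bij_betw_def by blast
  define e where "e x = to_nat_on \<B> ` {B \<in> \<B>. x \<in> B}" for x
  have "inj_on e (carrier_of M)"
  proof (rule inj_onI, rule ccontr)
    fix x y assume xy: "x \<in> carrier_of M" "y \<in> carrier_of M" "e x = e y" "x \<noteq> y"
    then have eq: "{B \<in> \<B>. x \<in> B} = {B \<in> \<B>. y \<in> B}"
      using inj_on_image_eq_iff[OF inj_on_to_nat_on[OF \<open>countable \<B>\<close>]]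
      by (metis (no_types, lifting) e_def mem_Collect_eq subsetI)
    obtain U V where UV: "openin (mfd_top M) U" "x \<in> U" "y \<in> V" "disjnt U V"
      using xy assms unfolding complex_manifold_def Hausdorff_space_def by metis
    then obtain B where "B \<in> \<B>" "x \<in> B" "B \<subseteq> U"
      using \<B> by blast
    with eq UV show False
      by (auto simp: disjnt_iff)
  qed
  then have "inj_on (r \<circ> e) (carrier_of M)"
    using r by (auto intro!: comp_inj_on simp: inj_on_def)
  then show ?thesis by blast
qed

definition canonical_semi_model ::
  "nat \<Rightarrow> 'a cmfd \<Rightarrow> (nat \<Rightarrow> 'a \<Rightarrow> 'a) \<Rightarrow> 'b cmfd \<Rightarrow> ('a \<Rightarrow> 'b) \<Rightarrow> (nat \<Rightarrow> 'b \<Rightarrow> 'b) \<Rightarrow> bool" where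
  "canonical_semi_model k X F Z l T \<longleftrightarrow>
     semi_model k X F Z l T \<and> kobayashi_hyperbolic Z \<and>
     (\<forall>(L :: real cmfd) h \<Phi>. semi_model k X F L h \<Phi> \<and> kobayashi_hyperbolic L \<longrightarrow>
        (\<exists>\<eta>. holo_map Z L \<eta> \<and>
              (\<forall>x\<in>carrier_of X. \<eta> (l x) = h x) \<and>
              (\<forall>j\<in>{1..k}. \<forall>z\<in>carrier_of Z. \<eta> (T j z) = \<Phi> j (\<eta> z))))"

end

(* Let f be the composition of all F_j. Since X is cocompact, there are automorphisms h_m such that
   h_m f^m x stays in a compact set, so along an ultrafilter U the maps h_m f^(m-n) converge to maps
   \<alpha>_n with \<alpha>_(n+1) f = \<alpha>_n. The limit of \<alpha>_m h_m^(-1) along U is a holomorphic retraction of X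
   whose fixed point set is the union of the images of the \<alpha>_n. This retract L, with \<alpha>_0 and the
   maps induced by the F_j, is a hyperbolic semi-model, and k_L(\<alpha>_0 x, \<alpha>_0 y) is the limit of
   k_X(f^m x, f^m y). The canonical semi-model maps to L, hence
   k_Z(T_j^q l x, l x) >= lim k_X(F_j^q f^m x, f^m x) >= q c(F_j), that is, c(T_j) >= c(F_j).
   The converse holds because l does not increase distances. *)
theory Submission
  imports Defs "HOL-Complex_Analysis.Complex_Analysis" "HOL-Library.Function_Algebras"
begin

section \<open>Complex n-space, its topology, and complex derivatives at a point\<close>

section \<open>Holomorphic functions of several variables\<close>

text \<open>Two obstacles shape the proof. First, the model must be a manifold, and a union of
  images of holomorphic maps is one only after it is recognised as the fixed point set of a
  retraction. A limit of maps could have fixed points outside that union. They are excluded because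
  near a fixed point p the approximating maps, whose values the retraction fixes, act on the
  coordinates of the retract as small perturbations of the identity, and so attain p exactly.
  Second, the induced maps must be invertible on L. This is why f is the product of all F_j: the
  inverse of the map induced by F_j is induced by the product of the other F_i together with the
  shift from alpha_n to alpha_(n+1). An ultrafilter instead of subsequences makes one choice serve
  all n and all maps commuting with f. Distances on L come out as limits because the h_m are
  isometries and a holomorphic retract carries the restricted Kobayashi distance. In the last
  estimate m is free: c(F_j) is the infimum over q of k_X(F_j^q y, y) / q for every base point y, in
  particular for y = f^m x.\<close>

definition cvec :: "nat \<Rightarrow> (nat \<Rightarrow> complex) set" where
  "cvec n = {z. \<forall>i\<ge>n. z i = 0}"

text \<open>The l^1 norm, so that vector estimates are sums of estimates for the coordinates.
  \<open>holo_fun_on_iff\<close> settles once that the Euclidean norm of \<open>holo_fun_on\<close>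
  leads to the same derivatives.\<close>

definition vnorm :: "nat \<Rightarrow> (nat \<Rightarrow> complex) \<Rightarrow> real" where
  "vnorm n z = (\<Sum>i<n. cmod (z i))"

definition vscale :: "complex \<Rightarrow> (nat \<Rightarrow> complex) \<Rightarrow> nat \<Rightarrow> complex" where
  "vscale c v = (\<lambda>i. c * v i)"

text \<open>Bilinear, without conjugation: \<open>a\<close> plays the role of a covector, the
  gradient of a function.\<close>

definition cdot :: "nat \<Rightarrow> (nat \<Rightarrow> complex) \<Rightarrow> (nat \<Rightarrow> complex) \<Rightarrow> complex" where
  "cdot n a v = (\<Sum>i<n. a i * v i)"

lemma vscale_apply [simp]: "vscale c v i = c * v i"
  by (simp add: vscale_def)

lemma vscale_simps [simp]: "vscale 0 v = 0" "vscale 1 v = v" "vscale c 0 = 0"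
  by (auto simp: fun_eq_iff)

lemma vscale_algebra:
  "vscale c (v + w) = vscale c v + vscale c w" "vscale c (v - w) = vscale c v - vscale c w"
  "vscale (c + d) v = vscale c v + vscale d v" "vscale (c - d) v = vscale c v - vscale d v"
  "vscale c (vscale d v) = vscale (c * d) v"
  by (auto simp: fun_eq_iff algebra_simps)

lemma cvec_simps [simp]:
  "0 \<in> cvec n" "v \<in> cvec n \<Longrightarrow> vscale c v \<in> cvec n"
  "v \<in> cvec n \<Longrightarrow> w \<in> cvec n \<Longrightarrow> v + w \<in> cvec n"
  "v \<in> cvec n \<Longrightarrow> w \<in> cvec n \<Longrightarrow> v - w \<in> cvec n"
  by (auto simp: cvec_def)

lemma cvec_eqI: "z \<in> cvec n \<Longrightarrow> w \<in> cvec n \<Longrightarrow> (\<And>i. i < n \<Longrightarrow> z i = w i) \<Longrightarrow> z = w"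
  unfolding cvec_def by (rule ext) (metis (mono_tags) mem_Collect_eq not_le_imp_less)

lemma half_add_half: "e / 2 * v + e / 2 * v = (e::real) * v"
  by simp

lemma vnorm_nonneg [simp]: "0 \<le> vnorm n z"
  by (simp add: vnorm_def sum_nonneg)

lemma vnorm_zero [simp]: "vnorm n 0 = 0"
  by (simp add: vnorm_def)

lemma vnorm_scale [simp]: "vnorm n (vscale c v) = cmod c * vnorm n v"
  by (simp add: vnorm_def norm_mult sum_distrib_left)

lemma vnorm_triangle: "vnorm n (v + w) \<le> vnorm n v + vnorm n w"
  by (simp add: vnorm_def flip: sum.distrib) (intro sum_mono norm_triangle_ineq)

lemma vnorm_triangle_diff: "vnorm n (v - w) \<le> vnorm n v + vnorm n w"
  by (simp add: vnorm_def flip: sum.distrib) (intro sum_mono norm_triangle_ineq4)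

lemma vnorm_minus_commute: "vnorm n (v - w) = vnorm n (w - v)"
  by (simp add: vnorm_def norm_minus_commute)

lemma vnorm_uminus [simp]: "vnorm n (- v) = vnorm n v"
  by (simp add: vnorm_def)

lemma vnorm_dist_triangle: "vnorm n (u - w) \<le> vnorm n (u - v) + vnorm n (v - w)"
  using vnorm_triangle[of n "u - v" "v - w"] by simp

lemma vnorm_le_add: "vnorm n v \<le> vnorm n (v - w) + vnorm n w"
  using vnorm_triangle[of n "v - w" w] by simp

lemma norm_le_vnorm: "i < n \<Longrightarrow> cmod (z i) \<le> vnorm n z"
  unfolding vnorm_def by (rule member_le_sum) auto

lemma norm_cvec_le_vnorm: "z \<in> cvec n \<Longrightarrow> cmod (z i) \<le> vnorm n z"
  using norm_le_vnorm[of i n z] by (cases "i < n") (auto simp: cvec_def)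

lemma vnorm_le_bound: "(\<And>i. i < n \<Longrightarrow> cmod (z i) \<le> B) \<Longrightarrow> vnorm n z \<le> real n * B"
  unfolding vnorm_def using sum_bounded_above[of "{..<n}" "\<lambda>i. cmod (z i)" B] by simp

lemma vnorm_eq_0_iff: "z \<in> cvec n \<Longrightarrow> vnorm n z = 0 \<longleftrightarrow> z = 0"
  by (auto simp: vnorm_def sum_nonneg_eq_0_iff intro: cvec_eqI)

lemma vnorm_eq_0D: "z \<in> cvec n \<Longrightarrow> w \<in> cvec n \<Longrightarrow> vnorm n (z - w) \<le> 0 \<Longrightarrow> z = w"
  using vnorm_eq_0_iff[of "z - w" n] vnorm_nonneg[of n "z - w"] by auto

lemma cdot_bound: "cmod (cdot n a v) \<le> vnorm n a * vnorm n v"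
proof -
  have "cmod (cdot n a v) \<le> (\<Sum>i<n. cmod (a i) * cmod (v i))"
    unfolding cdot_def by (rule order_trans[OF norm_sum]) (simp add: norm_mult)
  also have "\<dots> \<le> (\<Sum>i<n. cmod (a i) * vnorm n v)"
    by (intro sum_mono mult_left_mono norm_le_vnorm) auto
  finally show ?thesis by (simp add: vnorm_def sum_distrib_right)
qed

lemma cdot_linear:
  "cdot n a (v + w) = cdot n a v + cdot n a w" "cdot n a (v - w) = cdot n a v - cdot n a w"
  "cdot n a (vscale c v) = c * cdot n a v" "cdot n a 0 = 0"
  "cdot n (a - b) v = cdot n a v - cdot n b v"
  by (auto simp: cdot_def algebra_simps sum.distrib sum_subtractf sum_distrib_left)

definition axisv :: "nat \<Rightarrow> nat \<Rightarrow> complex" where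
  "axisv i = (\<lambda>j. if j = i then 1 else 0)"

lemma axisv_cvec [simp]: "i < n \<Longrightarrow> axisv i \<in> cvec n"
  by (auto simp: axisv_def cvec_def)

lemma cdot_axisv [simp]: "i < n \<Longrightarrow> cdot n a (axisv i) = a i"
  by (simp add: cdot_def axisv_def if_distrib[where f = "\<lambda>x. _ * x"] cong: if_cong)

lemma vnorm_axisv [simp]: "i < n \<Longrightarrow> vnorm n (axisv i) = 1"
  by (simp add: vnorm_def axisv_def if_distrib[where f = cmod] cong: if_cong)

subsection \<open>The topology of complex n-space\<close>

lemma topspace_complex_space [simp]: "topspace (complex_space n) = cvec n"
  by (simp add: complex_space_def cvec_def)

lemma continuous_on_vnorm_diff: "continuous_on UNIV (\<lambda>z. vnorm n (z - p))"
  unfolding vnorm_def minus_apply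
  by (rule continuous_on_sum, rule continuous_on_norm, rule continuous_on_diff,
      rule continuous_on_product_then_coordinatewise, rule continuous_on_id, rule continuous_on_const)

lemma open_fun_box:
  fixes T :: "(nat \<Rightarrow> complex) set"
  assumes "open T" "p \<in> T"
  obtains X where "p \<in> PiE UNIV X" "\<And>i. open (X i)" "PiE UNIV X \<subseteq> T"
proof -
  have "openin euclidean T" using assms(1) by (simp only: open_openin)
  then have "openin (product_topology (\<lambda>i. euclidean) UNIV) T"
    unfolding euclidean_product_topology[symmetric] .
  from product_topology_open_contains_basis[OF this assms(2)] that show thesis
    by (metis open_openin)
qed

text \<open>On \<open>cvec n\<close> only finitely many coordinates vary, so the product topology
  restricted to it is generated by the balls of \<open>vnorm\<close>. All later arguments use these
  balls.\<close>

lemma openin_complex_space: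
  "openin (complex_space n) S \<longleftrightarrow>
     S \<subseteq> cvec n \<and> (\<forall>p\<in>S. \<exists>\<delta>>0. \<forall>z\<in>cvec n. vnorm n (z - p) < \<delta> \<longrightarrow> z \<in> S)"
  (is "_ \<longleftrightarrow> ?R")
proof
  assume "openin (complex_space n) S"
  then obtain T where T: "open T" "S = cvec n \<inter> T"
    unfolding complex_space_def cvec_def by (meson openin_open)
  have "\<exists>\<delta>>0. \<forall>z\<in>cvec n. vnorm n (z - p) < \<delta> \<longrightarrow> z \<in> S" if "p \<in> S" for p
  proof -
    obtain X where X: "p \<in> PiE UNIV X" "\<And>i. open (X i)" "PiE UNIV X \<subseteq> T"
      using T(2) \<open>p \<in> S\<close> by (auto intro: open_fun_box[OF T(1), of p])
    have "\<exists>e>0. ball (p i) e \<subseteq> X i" for i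
      using X by (meson PiE_E UNIV_I openE)
    then obtain e where e: "\<And>i. e i > 0" "\<And>i. ball (p i) (e i) \<subseteq> X i" by metis
    \<comment> \<open>\<open>insert 1\<close> keeps the minimum defined for n = 0. Coordinates from
      \<open>n\<close> on impose nothing, because there z and p both vanish.\<close>
    define \<delta> where "\<delta> = Min (insert 1 (e ` {..<n}))"
    have d: "\<delta> > 0" unfolding \<delta>_def using e by auto
    have "z \<in> S" if z: "z \<in> cvec n" "vnorm n (z - p) < \<delta>" for z
    proof -
      have "z i \<in> X i" for i
      proof (cases "i < n")
        case True
        then have "\<delta> \<le> e i" unfolding \<delta>_def by (intro Min_le) auto
        then have "cmod (z i - p i) < e i"
          using norm_le_vnorm[OF True, of "z - p"] z by simp
        then show ?thesis using e(2)[of i] by (auto simp: dist_norm norm_minus_commute)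
      next
        case False
        then have "z i = p i" using z \<open>p \<in> S\<close> T by (auto simp: cvec_def)
        then show ?thesis using X by (auto simp: PiE_def Pi_def)
      qed
      then have "z \<in> T" using X(3) by (auto simp: PiE_def)
      then show ?thesis using T z by auto
    qed
    then show ?thesis using d by blast
  qed
  then show ?R using T by auto
next
  assume R: ?R
  then obtain \<delta> where \<delta>: "\<And>p. p \<in> S \<Longrightarrow> \<delta> p > 0"
    "\<And>p z. p \<in> S \<Longrightarrow> z \<in> cvec n \<Longrightarrow> vnorm n (z - p) < \<delta> p \<Longrightarrow> z \<in> S" by metis
  define T where "T = (\<Union>p\<in>S. {z. vnorm n (z - p) < \<delta> p})"
  have "open {z. vnorm n (z - p) < \<delta> p}" for p
    by (rule open_Collect_less[OF continuous_on_vnorm_diff]) simp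
  then have "open T" unfolding T_def by auto
  moreover have "S = cvec n \<inter> T"
    unfolding T_def using R \<delta> by auto
  ultimately show "openin (complex_space n) S"
    unfolding complex_space_def cvec_def openin_open by auto
qed

lemma openin_ball_cvec: "openin (complex_space n) {z \<in> cvec n. vnorm n (z - p) < r}"
  unfolding openin_complex_space
proof (intro conjI ballI)
  fix q assume q: "q \<in> {z \<in> cvec n. vnorm n (z - p) < r}"
  show "\<exists>\<delta>>0. \<forall>z\<in>cvec n. vnorm n (z - q) < \<delta> \<longrightarrow> z \<in> {z \<in> cvec n. vnorm n (z - p) < r}"
  proof (intro exI[of _ "r - vnorm n (q - p)"] conjI ballI impI)
    fix z assume "z \<in> cvec n" "vnorm n (z - q) < r - vnorm n (q - p)"
    then show "z \<in> {z \<in> cvec n. vnorm n (z - p) < r}"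
      using vnorm_dist_triangle[of n z p q] by auto
  qed (use q in auto)
qed auto

text \<open>By Tychonoff: the ball is a closed subset of a product of closed discs.\<close>

lemma compactin_cball_cvec:
  assumes "p \<in> cvec n"
  shows "compactin (complex_space n) {z \<in> cvec n. vnorm n (z - p) \<le> r}"
proof -
  define Y where "Y = (\<lambda>i::nat. cball (p i) (max r 0))"
  have Y: "compactin (product_topology (\<lambda>i. euclidean) UNIV) (PiE UNIV Y)"
    by (subst compactin_PiE) (auto simp: Y_def)
  have sub: "{z \<in> cvec n. vnorm n (z - p) \<le> r} \<subseteq> PiE UNIV Y"
  proof
    fix z assume z: "z \<in> {z \<in> cvec n. vnorm n (z - p) \<le> r}"
    have "dist (p i) (z i) \<le> r" for i
      using norm_cvec_le_vnorm[of "z - p" n i] z assms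
      by (auto simp: dist_norm norm_minus_commute)
    then show "z \<in> PiE UNIV Y" by (simp add: Y_def max.coboundedI1 PiE_def)
  qed
  have "closed (cvec n)"
  proof -
    have 1: "cvec n = (\<Inter>i\<in>{n..}. {z. z i = 0})" unfolding cvec_def by blast
    have "closed {z :: nat \<Rightarrow> complex. z i = 0}" for i
      by (rule closed_Collect_eq, rule continuous_on_product_then_coordinatewise, rule continuous_on_id,
          rule continuous_on_const)
    then show ?thesis unfolding 1 by (intro closed_INT) blast
  qed
  moreover have "closed {z. vnorm n (z - p) \<le> r}"
    by (rule closed_Collect_le[OF continuous_on_vnorm_diff]) simp
  ultimately have cl: "closed (cvec n \<inter> {z. vnorm n (z - p) \<le> r})" by (rule closed_Int)
  have "cvec n \<inter> {z. vnorm n (z - p) \<le> r} = {z \<in> cvec n. vnorm n (z - p) \<le> r}" by blast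
  with cl have cl: "closed {z \<in> cvec n. vnorm n (z - p) \<le> r}" by simp
  have "compact (PiE UNIV Y)"
    using Y by (simp only: euclidean_product_topology compactin_euclidean_iff)
  from compact_Int_closed[OF this cl] sub have "compact {z \<in> cvec n. vnorm n (z - p) \<le> r}"
    by (simp only: Int_absorb1)
  then show ?thesis
    unfolding complex_space_def compactin_subtopology cvec_def compactin_euclidean_iff by blast
qed

subsection \<open>Pointwise complex differentiability\<close>

lemmas vapply = minus_apply uminus_apply plus_fun_apply vscale_apply

(* Resolution leaves eta-expanded vectors \<open>\<lambda>i. (z - p) i\<close>, which these rules would push apart. *)
declare vapply [simp del]

text \<open>The Frechet derivative in multiplied-out form, which holds at z = p without an
  exception. Only the entries of \<open>a\<close> below \<open>n\<close> count.\<close>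

definition has_cderiv :: "nat \<Rightarrow> ((nat \<Rightarrow> complex) \<Rightarrow> complex) \<Rightarrow> (nat \<Rightarrow> complex) \<Rightarrow> (nat \<Rightarrow> complex) \<Rightarrow> bool"
  where "has_cderiv n f p a \<longleftrightarrow> (\<forall>\<epsilon>>0. \<exists>\<delta>>0. \<forall>z\<in>cvec n. vnorm n (z - p) < \<delta> \<longrightarrow>
           cmod (f z - f p - cdot n a (z - p)) \<le> \<epsilon> * vnorm n (z - p))"

definition cdiff :: "nat \<Rightarrow> ((nat \<Rightarrow> complex) \<Rightarrow> complex) \<Rightarrow> (nat \<Rightarrow> complex) \<Rightarrow> bool" where
  "cdiff n f p \<longleftrightarrow> (\<exists>a. has_cderiv n f p a)"

lemma has_cderiv_cong:
  assumes "has_cderiv n f p a" "p \<in> cvec n" "\<delta> > 0"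
    and eq: "\<And>z. z \<in> cvec n \<Longrightarrow> vnorm n (z - p) < \<delta> \<Longrightarrow> f z = g z"
  shows "has_cderiv n g p a"
  unfolding has_cderiv_def
proof (intro allI impI)
  fix \<epsilon> :: real assume "\<epsilon> > 0"
  then obtain d where d: "d > 0" "\<forall>z\<in>cvec n. vnorm n (z - p) < d \<longrightarrow>
           cmod (f z - f p - cdot n a (z - p)) \<le> \<epsilon> * vnorm n (z - p)"
    using assms(1) unfolding has_cderiv_def by blast
  have "f p = g p" using eq[of p] assms by simp
  with d eq show "\<exists>\<delta>>0. \<forall>z\<in>cvec n. vnorm n (z - p) < \<delta> \<longrightarrow>
           cmod (g z - g p - cdot n a (z - p)) \<le> \<epsilon> * vnorm n (z - p)"
    by (intro exI[of _ "min d \<delta>"]) (use \<open>\<delta> > 0\<close> in auto)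
qed

lemma cdiff_cong:
  assumes "cdiff n f p" "p \<in> cvec n" "\<delta> > 0"
    and "\<And>z. z \<in> cvec n \<Longrightarrow> vnorm n (z - p) < \<delta> \<Longrightarrow> f z = g z"
  shows "cdiff n g p"
  using assms has_cderiv_cong unfolding cdiff_def by metis

lemma has_cderiv_affine: "has_cderiv n (\<lambda>z. c + cdot n a (z - q)) p a"
proof -
  have "c + cdot n a (z - q) - (c + cdot n a (p - q)) - cdot n a (z - p) = 0" for z
    by (simp add: cdot_linear)
  then show ?thesis unfolding has_cderiv_def by (auto intro!: exI[of _ 1])
qed

lemma has_cderiv_coord: "i < n \<Longrightarrow> has_cderiv n (\<lambda>z. z i) p (axisv i)"
  unfolding has_cderiv_def
  by (auto intro!: exI[of _ 1] simp: vapply cdot_def axisv_def if_distrib[where f = "\<lambda>x. x * _"] cong: if_cong)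

lemma has_cderiv_const: "has_cderiv n (\<lambda>z. c) p 0"
  unfolding has_cderiv_def by (auto intro!: exI[of _ 1] simp: cdot_def)

lemma has_cderiv_add:
  assumes "has_cderiv n f p a" "has_cderiv n g p b"
  shows "has_cderiv n (\<lambda>z. f z + g z) p (a + b)"
  unfolding has_cderiv_def
proof (intro allI impI)
  fix \<epsilon> :: real assume "\<epsilon> > 0"
  then have h: "\<epsilon> / 2 > 0" by simp
  obtain d where d: "d > 0" "\<forall>z\<in>cvec n. vnorm n (z - p) < d \<longrightarrow>
           cmod (f z - f p - cdot n a (z - p)) \<le> \<epsilon> / 2 * vnorm n (z - p)"
    using assms(1) h unfolding has_cderiv_def by blast
  obtain e where e: "e > 0" "\<forall>z\<in>cvec n. vnorm n (z - p) < e \<longrightarrow>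
           cmod (g z - g p - cdot n b (z - p)) \<le> \<epsilon> / 2 * vnorm n (z - p)"
    using assms(2) h unfolding has_cderiv_def by blast
  show "\<exists>\<delta>>0. \<forall>z\<in>cvec n. vnorm n (z - p) < \<delta> \<longrightarrow>
     cmod (f z + g z - (f p + g p) - cdot n (a + b) (z - p)) \<le> \<epsilon> * vnorm n (z - p)"
  proof (intro exI[of _ "min d e"] conjI ballI impI)
    fix z assume z: "z \<in> cvec n" "vnorm n (z - p) < min d e"
    have "f z + g z - (f p + g p) - cdot n (a + b) (z - p) =
      (f z - f p - cdot n a (z - p)) + (g z - g p - cdot n b (z - p))"
      by (simp add: vapply cdot_def algebra_simps sum.distrib sum_subtractf)
    also have "cmod \<dots> \<le> \<epsilon> / 2 * vnorm n (z - p) + \<epsilon> / 2 * vnorm n (z - p)"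
      using z d e by (intro norm_triangle_le add_mono) auto
    finally show "cmod (f z + g z - (f p + g p) - cdot n (a + b) (z - p)) \<le> \<epsilon> * vnorm n (z - p)"
      unfolding half_add_half .
  qed (use d e in auto)
qed

lemma has_cderiv_cmult:
  assumes "has_cderiv n f p a"
  shows "has_cderiv n (\<lambda>z. c * f z) p (vscale c a)"
  unfolding has_cderiv_def
proof (intro allI impI)
  fix \<epsilon> :: real assume "\<epsilon> > 0"
  \<comment> \<open>One is added so that c = 0 causes no division by zero.\<close>
  then have h: "\<epsilon> / (cmod c + 1) > 0" by (auto intro!: divide_pos_pos add_nonneg_pos)
  obtain d where d: "d > 0" "\<forall>z\<in>cvec n. vnorm n (z - p) < d \<longrightarrow>
           cmod (f z - f p - cdot n a (z - p)) \<le> \<epsilon> / (cmod c + 1) * vnorm n (z - p)"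
    using assms(1) h unfolding has_cderiv_def by blast
  show "\<exists>\<delta>>0. \<forall>z\<in>cvec n. vnorm n (z - p) < \<delta> \<longrightarrow>
     cmod (c * f z - c * f p - cdot n (vscale c a) (z - p)) \<le> \<epsilon> * vnorm n (z - p)"
  proof (intro exI[of _ d] conjI ballI impI)
    fix z assume z: "z \<in> cvec n" "vnorm n (z - p) < d"
    have "c * f z - c * f p - cdot n (vscale c a) (z - p) = c * (f z - f p - cdot n a (z - p))"
      by (simp add: vapply cdot_def algebra_simps sum_distrib_left sum_subtractf)
    also have "cmod \<dots> \<le> (cmod c + 1) * (\<epsilon> / (cmod c + 1) * vnorm n (z - p))"
      using z d by (subst norm_mult, intro mult_mono) auto
    also have "\<dots> = \<epsilon> * vnorm n (z - p)"
    proof -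
      have "cmod c + 1 \<noteq> 0" using norm_ge_zero[of c] by linarith
      then show ?thesis by simp
    qed
    finally show "cmod (c * f z - c * f p - cdot n (vscale c a) (z - p)) \<le> \<epsilon> * vnorm n (z - p)" .
  qed (use d in auto)
qed

lemma has_cderiv_minus:
  assumes "has_cderiv n f p a" "has_cderiv n g p b"
  shows "has_cderiv n (\<lambda>z. f z - g z) p (a - b)"
proof -
  have 1: "a + vscale (-1) b = a - b" by (rule ext) (simp add: vapply)
  have 2: "(\<lambda>z. f z + - 1 * g z) = (\<lambda>z. f z - g z)" by (rule ext) simp
  have "has_cderiv n (\<lambda>z. f z + - 1 * g z) p (a + vscale (-1) b)"
    by (rule has_cderiv_add[OF assms(1) has_cderiv_cmult[OF assms(2)]])
  then show ?thesis unfolding 1 2 .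
qed

lemma cdiff_intros:
  "cdiff n (\<lambda>z. c) p"
  "cdiff n f p \<Longrightarrow> cdiff n g p \<Longrightarrow> cdiff n (\<lambda>z. f z + g z) p"
  "cdiff n f p \<Longrightarrow> cdiff n g p \<Longrightarrow> cdiff n (\<lambda>z. f z - g z) p"
  "cdiff n f p \<Longrightarrow> cdiff n (\<lambda>z. c * f z) p"
  unfolding cdiff_def
  by (iprover intro: has_cderiv_const has_cderiv_add has_cderiv_minus has_cderiv_cmult)+

lemma cdiff_coord: "p \<in> cvec n \<Longrightarrow> cdiff n (\<lambda>z. z i) p"
proof (cases "i < n")
  case False
  assume "p \<in> cvec n"
  show ?thesis
    by (rule cdiff_cong[OF cdiff_intros(1)[of n 0] \<open>p \<in> cvec n\<close>, of 1]) (use False in \<open>auto simp: cvec_def\<close>)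
qed (auto simp: cdiff_def intro: has_cderiv_coord)

lemma cdiff_sum: "(\<And>i. i \<in> I \<Longrightarrow> cdiff n (f i) p) \<Longrightarrow> cdiff n (\<lambda>z. \<Sum>i\<in>I. f i z) p"
  by (induction I rule: infinite_finite_induct) (auto intro: cdiff_intros)

text \<open>Moving by t along the i-th axis, both affine approximations are within eps t of f, so t
  |a i - b i| is at most 2 eps t; eps is a quarter of |a i - b i|.\<close>

lemma has_cderiv_unique:
  assumes a: "has_cderiv n f p a" and b: "has_cderiv n f p b" and "p \<in> cvec n" "i < n"
  shows "a i = b i"
proof (rule ccontr)
  assume "a i \<noteq> b i"
  define \<epsilon> where "\<epsilon> = cmod (a i - b i) / 4"
  have e: "\<epsilon> > 0" using \<open>a i \<noteq> b i\<close> by (simp add: \<epsilon>_def)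
  obtain d1 where d1: "d1 > 0" "\<forall>z\<in>cvec n. vnorm n (z - p) < d1 \<longrightarrow>
           cmod (f z - f p - cdot n a (z - p)) \<le> \<epsilon> * vnorm n (z - p)"
    using a e unfolding has_cderiv_def by blast
  obtain d2 where d2: "d2 > 0" "\<forall>z\<in>cvec n. vnorm n (z - p) < d2 \<longrightarrow>
           cmod (f z - f p - cdot n b (z - p)) \<le> \<epsilon> * vnorm n (z - p)"
    using b e unfolding has_cderiv_def by blast
  define t where "t = min d1 d2 / 2"
  have t: "t > 0" "t < d1" "t < d2" using d1 d2 by (auto simp: t_def)
  define z where "z = p + vscale (of_real t) (axisv i)"
  have z: "z \<in> cvec n" "vnorm n (z - p) = t" "cdot n a (z - p) = of_real t * a i"
    "cdot n b (z - p) = of_real t * b i"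
    using assms t by (auto simp: z_def cdot_linear)
  have "cmod (f z - f p - of_real t * a i) \<le> \<epsilon> * t" "cmod (f z - f p - of_real t * b i) \<le> \<epsilon> * t"
    using d1(2)[rule_format, OF z(1)] d2(2)[rule_format, OF z(1)] z(2-) t by auto
  then have "cmod (of_real t * a i - of_real t * b i) \<le> \<epsilon> * t + \<epsilon> * t"
    using norm_triangle_ineq4[of "f z - f p - of_real t * b i" "f z - f p - of_real t * a i"] by simp
  also have "cmod (of_real t * a i - of_real t * b i) = 4 * \<epsilon> * t"
    using t by (simp add: \<epsilon>_def norm_mult flip: right_diff_distrib)
  finally show False using e t by simp
qed

lemma has_cderiv_local_lipschitz:
  assumes "has_cderiv n f p a"
  shows "\<exists>\<delta>>0. \<exists>K>0. \<forall>z\<in>cvec n. vnorm n (z - p) < \<delta> \<longrightarrow> cmod (f z - f p) \<le> K * vnorm n (z - p)"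
proof -
  obtain d where d: "d > 0" "\<forall>z\<in>cvec n. vnorm n (z - p) < d \<longrightarrow>
           cmod (f z - f p - cdot n a (z - p)) \<le> 1 * vnorm n (z - p)"
    using assms unfolding has_cderiv_def using zero_less_one by blast
  have "\<forall>z\<in>cvec n. vnorm n (z - p) < d \<longrightarrow> cmod (f z - f p) \<le> (1 + vnorm n a) * vnorm n (z - p)"
  proof (intro ballI impI)
    fix z assume "z \<in> cvec n" "vnorm n (z - p) < d"
    then have "cmod (f z - f p) \<le> 1 * vnorm n (z - p) + vnorm n a * vnorm n (z - p)"
      using d(2) cdot_bound[of n a "z - p"]
      by (smt (verit) norm_triangle_sub)
    then show "cmod (f z - f p) \<le> (1 + vnorm n a) * vnorm n (z - p)"
      unfolding distrib_right .
  qed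
  moreover have "1 + vnorm n a > 0" by (intro add_pos_nonneg) auto
  ultimately show ?thesis using d(1) by blast
qed

text \<open>Differentiable coordinates make a vector-valued map locally Lipschitz. The chain rule
  and the continuity of maps given in charts rest on this.\<close>

lemma vector_local_lipschitz:
  assumes "\<And>j. j < m \<Longrightarrow> cdiff n (\<lambda>z. G z j) p"
  shows "\<exists>\<delta>>0. \<exists>K>0. \<forall>z\<in>cvec n. vnorm n (z - p) < \<delta> \<longrightarrow> vnorm m (G z - G p) \<le> K * vnorm n (z - p)"
  using assms
proof (induction m)
  case 0
  have "\<forall>z\<in>cvec n. vnorm n (z - p) < 1 \<longrightarrow> vnorm 0 (G z - G p) \<le> 1 * vnorm n (z - p)"
    by (simp add: vnorm_def[of 0])
  then show ?case using zero_less_one by blast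
next
  case (Suc m)
  then obtain d K where d: "d > 0" "K > 0"
    "\<forall>z\<in>cvec n. vnorm n (z - p) < d \<longrightarrow> vnorm m (G z - G p) \<le> K * vnorm n (z - p)"
    by (meson less_Suc_eq)
  obtain a where "has_cderiv n (\<lambda>z. G z m) p a" using Suc.prems unfolding cdiff_def by blast
  then obtain e L where e: "e > 0" "L > 0"
    "\<forall>z\<in>cvec n. vnorm n (z - p) < e \<longrightarrow> cmod (G z m - G p m) \<le> L * vnorm n (z - p)"
    using has_cderiv_local_lipschitz[of n "\<lambda>z. G z m" p a] by blast
  have "\<forall>z\<in>cvec n. vnorm n (z - p) < min d e \<longrightarrow> vnorm (Suc m) (G z - G p) \<le> (K + L) * vnorm n (z - p)"
  proof (intro ballI impI)
    fix z assume z: "z \<in> cvec n" "vnorm n (z - p) < min d e"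
    have "vnorm (Suc m) (G z - G p) = vnorm m (G z - G p) + cmod (G z m - G p m)"
      by (simp add: vapply vnorm_def)
    also have "\<dots> \<le> K * vnorm n (z - p) + L * vnorm n (z - p)"
      using d(3) e(3) z by (intro add_mono) auto
    finally show "vnorm (Suc m) (G z - G p) \<le> (K + L) * vnorm n (z - p)"
      unfolding distrib_right .
  qed
  moreover have "min d e > 0" "K + L > 0" using d e by auto
  ultimately show ?case by blast
qed

lemma has_cderiv_chain:
  assumes h: "has_cderiv m h (G p) b"
    and G: "\<And>j. j < m \<Longrightarrow> has_cderiv n (\<lambda>z. G z j) p (a j)"
    and r: "r > 0" "\<And>z. z \<in> cvec n \<Longrightarrow> vnorm n (z - p) < r \<Longrightarrow> G z \<in> cvec m"
  shows "has_cderiv n (\<lambda>z. h (G z)) p (\<lambda>i. \<Sum>j<m. b j * a j i)"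
  unfolding has_cderiv_def
proof (intro allI impI)
  fix \<epsilon> :: real assume e: "\<epsilon> > 0"
  obtain d K where d: "d > 0" "K > 0"
    "\<And>z. z \<in> cvec n \<Longrightarrow> vnorm n (z - p) < d \<Longrightarrow> vnorm m (G z - G p) \<le> K * vnorm n (z - p)"
  proof -
    have "\<exists>\<delta>>0. \<exists>K>0. \<forall>z\<in>cvec n. vnorm n (z - p) < \<delta> \<longrightarrow> vnorm m (G z - G p) \<le> K * vnorm n (z - p)"
      by (rule vector_local_lipschitz) (use G cdiff_def in blast)
    then show thesis using that by blast
  qed
  obtain d1 where d1: "d1 > 0" "\<And>w. w \<in> cvec m \<Longrightarrow> vnorm m (w - G p) < d1 \<Longrightarrow>
           cmod (h w - h (G p) - cdot m b (w - G p)) \<le> \<epsilon> / (2 * K) * vnorm m (w - G p)"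
  proof -
    have "\<epsilon> / (2 * K) > 0" using e d by simp
    then show thesis using that h unfolding has_cderiv_def by blast
  qed
  \<comment> \<open>Half of \<open>\<epsilon>\<close> pays for the error of \<open>h\<close>, hence
    \<open>\<epsilon> / (2 * K)\<close> above; the other half pays for \<open>b\<close> applied to
    the errors of the components of \<open>G\<close>, hence this choice.\<close>
  define \<eta> where "\<eta> = \<epsilon> / (2 * (vnorm m b + 1))"
  have \<eta>: "\<eta> > 0" "vnorm m b * \<eta> \<le> \<epsilon> / 2"
  proof -
    have pos: "vnorm m b + 1 > 0" by (auto intro: add_nonneg_pos)
    then show "\<eta> > 0" using e by (simp add: \<eta>_def)
    have "vnorm m b * \<eta> \<le> (vnorm m b + 1) * \<eta>" using \<open>\<eta> > 0\<close> by (intro mult_right_mono) auto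
    also have "\<dots> = \<epsilon> / 2" unfolding \<eta>_def using pos by (simp add: field_simps)
    finally show "vnorm m b * \<eta> \<le> \<epsilon> / 2" .
  qed
  have "\<exists>\<delta>>0. \<forall>z\<in>cvec n. vnorm n (z - p) < \<delta> \<longrightarrow> (\<forall>j<m.
      cmod (G z j - G p j - cdot n (a j) (z - p)) \<le> \<eta> * vnorm n (z - p))"
    using G
  proof (induction m)
    case (Suc m)
    then obtain x where x: "x > 0" "\<forall>z\<in>cvec n. vnorm n (z - p) < x \<longrightarrow> (\<forall>j<m.
      cmod (G z j - G p j - cdot n (a j) (z - p)) \<le> \<eta> * vnorm n (z - p))"
      by auto
    obtain y where y: "y > 0" "\<forall>z\<in>cvec n. vnorm n (z - p) < y \<longrightarrow>
      cmod (G z m - G p m - cdot n (a m) (z - p)) \<le> \<eta> * vnorm n (z - p)"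
      using Suc.prems[of m] \<eta>(1) unfolding has_cderiv_def by auto
    show ?case
      by (intro exI[of _ "min x y"]) (use x y in \<open>auto simp: less_Suc_eq\<close>)
  qed (auto intro: exI[of _ 1])
  then obtain d2 where d2: "d2 > 0" "\<And>z j. z \<in> cvec n \<Longrightarrow> vnorm n (z - p) < d2 \<Longrightarrow> j < m \<Longrightarrow>
      cmod (G z j - G p j - cdot n (a j) (z - p)) \<le> \<eta> * vnorm n (z - p)" by blast
  show "\<exists>\<delta>>0. \<forall>z\<in>cvec n. vnorm n (z - p) < \<delta> \<longrightarrow>
     cmod (h (G z) - h (G p) - cdot n (\<lambda>i. \<Sum>j<m. b j * a j i) (z - p)) \<le> \<epsilon> * vnorm n (z - p)"
  proof (intro exI[of _ "Min {d, d2, r, d1 / K}"] conjI ballI impI)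
    fix z assume z: "z \<in> cvec n" "vnorm n (z - p) < Min {d, d2, r, d1 / K}"
    let ?v = "vnorm n (z - p)"
    have Gz: "G z \<in> cvec m" using r z by auto
    have l: "vnorm m (G z - G p) \<le> K * ?v" using d z by auto
    also have "\<dots> < d1" using z d by (auto simp: field_simps)
    finally have "cmod (h (G z) - h (G p) - cdot m b (G z - G p)) \<le> \<epsilon> / (2 * K) * vnorm m (G z - G p)"
      using d1 Gz by blast
    also have "\<dots> \<le> \<epsilon> / (2 * K) * (K * ?v)" using l e d by (intro mult_left_mono) auto
    also have "\<dots> = \<epsilon> / 2 * ?v" using d by simp
    finally have 1: "cmod (h (G z) - (h (G p) + cdot m b (G z - G p))) \<le> \<epsilon> / 2 * ?v"
      by (simp only: diff_diff_eq)
    have "cdot n (\<lambda>i. \<Sum>j<m. b j * a j i) (z - p) = (\<Sum>j<m. b j * cdot n (a j) (z - p))"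
      unfolding cdot_def sum_distrib_left sum_distrib_right by (subst sum.swap) (simp add: mult.assoc)
    then have "cdot m b (G z - G p) - cdot n (\<lambda>i. \<Sum>j<m. b j * a j i) (z - p) =
        (\<Sum>j<m. b j * (G z j - G p j - cdot n (a j) (z - p)))"
      by (simp add: vapply cdot_def right_diff_distrib sum_subtractf)
    also have "cmod \<dots> \<le> (\<Sum>j<m. cmod (b j) * (\<eta> * ?v))"
      by (rule order_trans[OF norm_sum], intro sum_mono)
        (use d2 z in \<open>auto simp: norm_mult intro!: mult_left_mono\<close>)
    also have "\<dots> = vnorm m b * \<eta> * ?v" by (simp add: vnorm_def sum_distrib_right mult.assoc)
    also have "\<dots> \<le> \<epsilon> / 2 * ?v" using \<eta> by (intro mult_right_mono) auto
    finally have 2: "cmod (cdot m b (G z - G p) - cdot n (\<lambda>i. \<Sum>j<m. b j * a j i) (z - p)) \<le> \<epsilon> / 2 * ?v" .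
    have 3: "cmod ((h (G p) + cdot m b (G z - G p)) -
        (h (G p) + cdot n (\<lambda>i. \<Sum>j<m. b j * a j i) (z - p))) \<le> \<epsilon> / 2 * ?v"
      using 2 by simp
    show "cmod (h (G z) - h (G p) - cdot n (\<lambda>i. \<Sum>j<m. b j * a j i) (z - p)) \<le> \<epsilon> * ?v"
      using norm_diff_triangle_le[OF 1 3] by (simp only: half_add_half diff_diff_eq)
  qed (use d d1 d2 r in simp)
qed

lemma cdiff_chain:
  assumes "cdiff m h (G p)" "\<And>j. j < m \<Longrightarrow> cdiff n (\<lambda>z. G z j) p"
    and "r > 0" "\<And>z. z \<in> cvec n \<Longrightarrow> vnorm n (z - p) < r \<Longrightarrow> G z \<in> cvec m"
  shows "cdiff n (\<lambda>z. h (G z)) p"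
proof -
  obtain b where b: "has_cderiv m h (G p) b" using assms(1) unfolding cdiff_def by blast
  define A where "A j = (SOME a. has_cderiv n (\<lambda>z. G z j) p a)" for j
  have A: "has_cderiv n (\<lambda>z. G z j) p (A j)" if "j < m" for j
    using assms(2)[OF that] unfolding cdiff_def A_def by (rule someI_ex)
  have "has_cderiv n (\<lambda>z. h (G z)) p (\<lambda>i. \<Sum>j<m. b j * A j i)"
    by (rule has_cderiv_chain[of m h G p b n A r]) (rule b, erule A, rule assms(3), erule (1) assms(4))
  then show ?thesis unfolding cdiff_def by (rule exI[of "has_cderiv n (\<lambda>z. h (G z)) p"])
qed

text \<open>The Euclidean norm is at most the l^1 norm, which is at most n times the Euclidean norm;
  so the two difference quotients tend to 0 together.\<close>

lemma holo_fun_on_iff: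
  assumes S: "openin (complex_space n) S"
  shows "holo_fun_on n S f \<longleftrightarrow> (\<forall>p\<in>S. cdiff n f p)"
proof -
  have *: "((\<lambda>z. cmod (f z - f p - (\<Sum>i<n. a i * (z i - p i))) /
          L2_set (\<lambda>i. cmod (z i - p i)) {..<n}) \<longlongrightarrow> 0) (at p within S) \<longleftrightarrow> has_cderiv n f p a"
    (is "(?q \<longlongrightarrow> 0) _ \<longleftrightarrow> _") if p: "p \<in> S" for p a
  proof
    note Sc = S[unfolded openin_complex_space]
    obtain r where r: "r > 0" "\<And>z. z \<in> cvec n \<Longrightarrow> vnorm n (z - p) < r \<Longrightarrow> z \<in> S"
      using Sc p by blast
    have L1: "L2_set (\<lambda>i. cmod (z i - p i)) {..<n} \<le> vnorm n (z - p)" for z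
      unfolding vnorm_def using L2_set_le_sum[of "{..<n}" "\<lambda>i. cmod (z i - p i)"] by (simp add: vapply)
    {
      assume T: "(?q \<longlongrightarrow> 0) (at p within S)"
      show "has_cderiv n f p a"
        unfolding has_cderiv_def
      proof (intro allI impI)
        fix \<epsilon> :: real assume e: "\<epsilon> > 0"
        have "eventually (\<lambda>z. dist (?q z) 0 < \<epsilon>) (at p within S)"
          using T e by (simp add: tendsto_iff)
        then obtain V where V: "open V" "p \<in> V" "\<And>z. z \<in> V \<Longrightarrow> z \<noteq> p \<Longrightarrow> z \<in> S \<Longrightarrow> dist (?q z) 0 < \<epsilon>"
          unfolding eventually_at_topological by blast
        have "openin (complex_space n) (cvec n \<inter> V)"
          using V(1) unfolding complex_space_def cvec_def by auto
        moreover have "p \<in> cvec n \<inter> V" using p V Sc by auto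
        ultimately obtain \<delta> where \<delta>: "\<delta> > 0" "\<And>z. z \<in> cvec n \<Longrightarrow> vnorm n (z - p) < \<delta> \<Longrightarrow> z \<in> V"
          unfolding openin_complex_space by blast
        show "\<exists>\<delta>>0. \<forall>z\<in>cvec n. vnorm n (z - p) < \<delta> \<longrightarrow>
           cmod (f z - f p - cdot n a (z - p)) \<le> \<epsilon> * vnorm n (z - p)"
        proof (intro exI[of _ "min \<delta> r"] conjI ballI impI)
          fix z assume z: "z \<in> cvec n" "vnorm n (z - p) < min \<delta> r"
          show "cmod (f z - f p - cdot n a (z - p)) \<le> \<epsilon> * vnorm n (z - p)"
          proof (cases "z = p")
            case True then show ?thesis by (simp add: cdot_def)
          next
            case False
            then obtain i where i: "i < n" "z i \<noteq> p i" using cvec_eqI[of z n p] z p Sc by auto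
            then have pos: "L2_set (\<lambda>i. cmod (z i - p i)) {..<n} > 0"
              using member_le_L2_set[of "{..<n}" i "\<lambda>i. cmod (z i - p i)"]
              by (smt (verit) finite_lessThan lessThan_iff right_minus_eq zero_less_norm_iff)
            have "?q z < \<epsilon>" using V(3)[of z] False \<delta>(2)[of z] r(2)[of z] z by auto
            then have "cmod (f z - f p - cdot n a (z - p)) \<le> \<epsilon> * L2_set (\<lambda>i. cmod (z i - p i)) {..<n}"
              using pos by (simp add: vapply cdot_def field_simps)
            also have "\<dots> \<le> \<epsilon> * vnorm n (z - p)" using L1 e by simp
            finally show ?thesis .
          qed
        qed (use \<delta> r in auto)
      qed
    next
      assume D: "has_cderiv n f p a"
      show "(?q \<longlongrightarrow> 0) (at p within S)"
        unfolding tendsto_iff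
      proof (intro allI impI)
        fix \<epsilon> :: real assume e: "\<epsilon> > 0"
        \<comment> \<open>The factor n is lost in passing from l^1 to the Euclidean norm; n + 1
          makes the final inequality strict.\<close>
        then have e': "\<epsilon> / (real n + 1) > 0" by simp
        then obtain \<delta> where \<delta>: "\<delta> > 0" "\<And>z. z \<in> cvec n \<Longrightarrow> vnorm n (z - p) < \<delta> \<Longrightarrow>
          cmod (f z - f p - cdot n a (z - p)) \<le> \<epsilon> / (real n + 1) * vnorm n (z - p)"
          using D unfolding has_cderiv_def by blast
        have "open {z. vnorm n (z - p) < \<delta>}"
          by (rule open_Collect_less[OF continuous_on_vnorm_diff]) simp
        moreover have "dist (?q z) 0 < \<epsilon>" if z: "z \<in> {z. vnorm n (z - p) < \<delta>}" "z \<noteq> p" "z \<in> S" for z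
        proof -
          obtain i where i: "i < n" "z i \<noteq> p i" using cvec_eqI[of z n p] z p Sc by auto
          let ?L = "L2_set (\<lambda>i. cmod (z i - p i)) {..<n}"
          have mem: "j < n \<Longrightarrow> cmod (z j - p j) \<le> ?L" for j
            by (intro member_le_L2_set) auto
          have pos: "?L > 0" using mem[OF i(1)] i by (smt (verit) right_minus_eq zero_less_norm_iff)
          have "cmod (f z - f p - cdot n a (z - p)) \<le> \<epsilon> / (real n + 1) * vnorm n (z - p)"
            using \<delta>(2) z Sc by auto
          also have "\<dots> \<le> \<epsilon> / (real n + 1) * (real n * ?L)"
            using e' mem vnorm_le_bound[of n "z - p" ?L] by (intro mult_left_mono) (auto simp: vapply)
          also have "\<dots> < \<epsilon> * ?L" using e pos by (simp add: field_simps)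
          finally show ?thesis using pos by (simp add: vapply cdot_def field_simps)
        qed
        ultimately show "\<forall>\<^sub>F z in at p within S. dist (?q z) 0 < \<epsilon>"
          unfolding eventually_at_topological using \<delta>(1)
          by (intro exI[of _ "{z. vnorm n (z - p) < \<delta>}"]) auto
      qed
    }
  qed
  show ?thesis unfolding holo_fun_on_def cdiff_def
    by (rule ball_cong[OF refl], rule ex_cong1, rule *)
qed

section \<open>Cauchy and Schwarz estimates, uniform in the function\<close>

subsection \<open>Estimates for bounded holomorphic functions\<close>

text \<open>The Schwarz lemma with radius and bound: on the circle of radius s the quotient is at
  most B / s, the maximum principle carries this inside, and s tends to
  \<open>\<rho>\<close>.\<close>

lemma Schwarz_quotient:
  assumes g: "g holomorphic_on ball 0 \<rho>" "g 0 = 0" and "\<rho> > 0"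
    and B: "\<And>\<zeta>. cmod \<zeta> < \<rho> \<Longrightarrow> cmod (g \<zeta>) \<le> B"
  obtains h where "h holomorphic_on ball 0 \<rho>" "\<And>\<zeta>. cmod \<zeta> < \<rho> \<Longrightarrow> g \<zeta> = \<zeta> * h \<zeta>"
    "deriv g 0 = h 0" "\<And>\<zeta>. cmod \<zeta> < \<rho> \<Longrightarrow> cmod (h \<zeta>) \<le> B / \<rho>"
proof -
  obtain h where h: "h holomorphic_on ball 0 \<rho>" "\<And>\<zeta>. cmod \<zeta> < \<rho> \<Longrightarrow> g \<zeta> = \<zeta> * h \<zeta>"
    "deriv g 0 = h 0"
    using Schwarz3[OF g(1,2)] by blast
  have "cmod (h \<zeta>) \<le> B / \<rho>" if \<zeta>: "cmod \<zeta> < \<rho>" for \<zeta>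
  proof -
    have s: "cmod (h \<zeta>) \<le> B / s" if s: "cmod \<zeta> < s" "s < \<rho>" for s
    proof (rule maximum_modulus_frontier[of h "ball 0 s"])
      have "s > 0" using s norm_ge_zero[of \<zeta>] by linarith
      have sub: "cball 0 s \<subseteq> ball (0::complex) \<rho>" using s by auto
      then show "h holomorphic_on interior (ball 0 s)"
        using h(1) by (intro holomorphic_on_subset[OF h(1)]) auto
      show "continuous_on (closure (ball 0 s)) h"
        using sub \<open>s > 0\<close> by (intro continuous_on_subset[OF holomorphic_on_imp_continuous_on[OF h(1)]]) auto
      show "bounded (ball (0::complex) s)" "\<zeta> \<in> ball 0 s" using s by auto
      fix z :: complex assume "z \<in> frontier (ball 0 s)"
      then have z: "cmod z = s" using \<open>s > 0\<close> by auto
      have "s * cmod (h z) \<le> B" using B[of z] h(2)[of z] z s by (simp add: norm_mult)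
      then show "cmod (h z) \<le> B / s" using \<open>s > 0\<close> by (simp add: field_simps)
    qed
    have "((\<lambda>s. B / s) \<longlongrightarrow> B / \<rho>) (at_left \<rho>)"
      using \<open>\<rho> > 0\<close> by (intro tendsto_intros) auto
    moreover have "eventually (\<lambda>s. cmod (h \<zeta>) \<le> B / s) (at_left \<rho>)"
      using eventually_at_left_real[OF \<zeta>] by eventually_elim (auto intro: s)
    ultimately show ?thesis
      by (intro tendsto_lowerbound) auto
  qed
  with h show thesis using that by blast
qed

text \<open>The Schwarz quotient applied twice: g - g 0 is bounded by 2 M and equals z k with |k| at
  most 2 M / \<open>\<rho>\<close>; then k - k 0 is bounded by 4 M / \<open>\<rho>\<close> and is
  divided by z again. The constants depend only on the bound M, which is what allows passing to
  limits of functions.\<close>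

lemma holomorphic_taylor_bounds:
  assumes g: "g holomorphic_on ball 0 \<rho>" and \<rho>: "\<rho> > 0"
    and M: "\<And>\<zeta>. cmod \<zeta> < \<rho> \<Longrightarrow> cmod (g \<zeta>) \<le> M" and \<zeta>: "cmod \<zeta> < \<rho>"
  shows "cmod (g \<zeta> - g 0) \<le> 2 * M / \<rho> * cmod \<zeta>" "cmod (deriv g 0) \<le> 2 * M / \<rho>"
    "cmod (g \<zeta> - g 0 - \<zeta> * deriv g 0) \<le> 4 * M / \<rho>^2 * cmod \<zeta> ^ 2"
proof -
  have "(\<lambda>z. g z - g 0) holomorphic_on ball 0 \<rho>" using g by (intro holomorphic_intros)
  moreover have "cmod (g z - g 0) \<le> 2 * M" if "cmod z < \<rho>" for z
    using norm_triangle_ineq4[of "g z" "g 0"] M[OF that] M[of 0] \<rho> by simp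
  ultimately obtain k where k: "k holomorphic_on ball 0 \<rho>"
    "\<And>z. cmod z < \<rho> \<Longrightarrow> g z - g 0 = z * k z"
    "deriv (\<lambda>z. g z - g 0) 0 = k 0" "\<And>z. cmod z < \<rho> \<Longrightarrow> cmod (k z) \<le> 2 * M / \<rho>"
    using Schwarz_quotient[of "\<lambda>z. g z - g 0" \<rho> "2 * M"] \<rho> by auto
  have "g field_differentiable at 0"
    using g \<rho> holomorphic_on_imp_differentiable_at[of g "ball 0 \<rho>" 0] by auto
  then have d: "deriv g 0 = k 0" using k(3) by simp
  show "cmod (g \<zeta> - g 0) \<le> 2 * M / \<rho> * cmod \<zeta>"
    unfolding k(2)[OF \<zeta>] norm_mult mult.commute[of "cmod \<zeta>"]
    by (rule mult_right_mono[OF k(4)[OF \<zeta>]]) simp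
  show "cmod (deriv g 0) \<le> 2 * M / \<rho>" unfolding d using k(4)[of 0] \<rho> by simp
  define l where "l z = k z - k 0" for z
  have l: "l holomorphic_on ball 0 \<rho>" "l 0 = 0"
    using k(1) unfolding l_def by (auto intro!: holomorphic_intros)
  have "cmod (l z) \<le> 4 * M / \<rho>" if "cmod z < \<rho>" for z
    using norm_triangle_ineq4[of "k z" "k 0"] k(4)[OF that] k(4)[of 0] \<rho> by (simp add: l_def)
  from Schwarz_quotient[OF l \<rho> this] obtain q where "\<And>z. cmod z < \<rho> \<Longrightarrow> l z = z * q z"
    and q2: "\<And>z. cmod z < \<rho> \<Longrightarrow> cmod (q z) \<le> 4 * M / \<rho> / \<rho>"
    by metis
  then have q: "\<And>z. cmod z < \<rho> \<Longrightarrow> k z - k 0 = z * q z" unfolding l_def by blast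
  have "g \<zeta> - g 0 - \<zeta> * deriv g 0 = \<zeta> * (k \<zeta> - k 0)"
    unfolding d k(2)[OF \<zeta>] by (simp add: algebra_simps)
  also have "\<dots> = q \<zeta> * \<zeta>^2" unfolding q[OF \<zeta>] by
 (simp add: power2_eq_square)
  finally have "cmod (g \<zeta> - g 0 - \<zeta> * deriv g 0) = cmod (q \<zeta>) * cmod \<zeta> ^ 2"
    by (simp add: norm_mult norm_power)
  also have "\<dots> \<le> 4 * M / \<rho>^2 * cmod \<zeta> ^ 2"
    using q2[OF \<zeta>] by
 (intro mult_right_mono) (auto simp: power2_eq_square)
  finally show "cmod (g \<zeta> - g 0 - \<zeta> * deriv g 0) \<le> 4 * M / \<rho>^2 * cmod \<zeta> ^ 2" .
qed

lemma has_cderiv_line: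
  assumes f: "has_cderiv n f (p + vscale \<zeta> v) a" and "p \<in> cvec n" "v \<in> cvec n"
  shows "((\<lambda>\<zeta>. f (p + vscale \<zeta> v)) has_field_derivative cdot n a v) (at \<zeta>)"
  unfolding has_field_derivative_iff LIM_def dist_norm
proof (intro allI impI)
  fix \<epsilon> :: real assume e: "\<epsilon> > 0"
  define \<eta> where "\<eta> = \<epsilon> / (2 * (vnorm n v + 1))"
  have v: "vnorm n v + 1 > 0" by (intro add_nonneg_pos) auto
  have \<eta>: "\<eta> > 0" using e v by (simp add: \<eta>_def)
  then obtain \<delta> where \<delta>: "\<delta> > 0" "\<And>z. z \<in> cvec n \<Longrightarrow> vnorm n (z - (p + vscale \<zeta> v)) < \<delta> \<Longrightarrow>
      cmod (f z - f (p + vscale \<zeta> v) - cdot n a (z - (p + vscale \<zeta> v))) \<le> \<eta> * vnorm n (z - (p + vscale \<zeta> v))"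
    using f unfolding has_cderiv_def by blast
  show "\<exists>s>0. \<forall>x. x \<noteq> \<zeta> \<and> norm (x - \<zeta>) < s \<longrightarrow>
      norm ((f (p + vscale x v) - f (p + vscale \<zeta> v)) / (x - \<zeta>) - cdot n a v) < \<epsilon>"
  proof (intro exI[of _ "\<delta> / (vnorm n v + 1)"] conjI allI impI)
    fix x assume x: "x \<noteq> \<zeta> \<and> norm (x - \<zeta>) < \<delta> / (vnorm n v + 1)"
    define t where "t = x - \<zeta>"
    have t: "cmod t > 0" "cmod t * (vnorm n v + 1) < \<delta>" "t \<noteq> 0" using x v by (auto simp: t_def field_simps)
    have eq: "p + vscale x v - (p + vscale \<zeta> v) = vscale t v"
      by (rule ext) (simp add: t_def vapply algebra_simps)
    have "cmod t * vnorm n v \<le> cmod t * (vnorm n v + 1)" by (intro mult_left_mono) auto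
    then have "vnorm n (vscale t v) < \<delta>" unfolding vnorm_scale by (rule le_less_trans[OF _ t(2)])
    then have "cmod (f (p + vscale x v) - f (p + vscale \<zeta> v) - t * cdot n a v) \<le> \<eta> * (cmod t * vnorm n v)"
      using \<delta>(2)[of "p + vscale x v"] assms unfolding eq cdot_linear vnorm_scale by simp
    also have "\<dots> \<le> \<epsilon> / 2 * cmod t"
    proof -
      have "\<eta> * vnorm n v \<le> \<eta> * (vnorm n v + 1)" using \<eta> by simp
      also have "\<dots> = \<epsilon> / 2" unfolding \<eta>_def using v by (simp add: field_simps)
      finally show ?thesis using mult_right_mono[of "\<eta> * vnorm n v" "\<epsilon> / 2" "cmod t"] by (simp add: algebra_simps)
    qed
    also have "\<dots> < \<epsilon> * cmod t" using e t by simp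
    finally have "cmod ((f (p + vscale x v) - f (p + vscale \<zeta> v) - t * cdot n a v) / t) < \<epsilon>"
      using t by (simp add: norm_divide field_simps)
    also have "(f (p + vscale x v) - f (p + vscale \<zeta> v) - t * cdot n a v) / t =
      (f (p + vscale x v) - f (p + vscale \<zeta> v)) / t - cdot n a v"
      using t by (simp add: diff_divide_distrib)
    finally show "norm ((f (p + vscale x v) - f (p + vscale \<zeta> v)) / (x - \<zeta>) - cdot n a v) < \<epsilon>"
      by (simp add: t_def)
  qed (use \<delta> v in auto)
qed

text \<open>Restrict f to the complex line through p with direction v, where the parameter runs
  through a disc of radius R / |v| > 1, and read off the one-variable bounds at the parameter value
  1.\<close>

lemma bounded_cdiff_bounds:
  assumes p: "p \<in> cvec n" and R: "R > 0"
    and f: "\<And>z. z \<in> cvec n \<Longrightarrow> vnorm n (z - p) < R \<Longrightarrow> cdiff n f z \<and> cmod (f z) \<le> M"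
    and v: "v \<in> cvec n" "vnorm n v < R" and a: "has_cderiv n f p a"
  shows "cmod (f (p + v) - f p) \<le> 2 * M / R * vnorm n v"
    "cmod (f (p + v) - f p - cdot n a v) \<le> 4 * M / R^2 * vnorm n v ^ 2"
    "cmod (cdot n a v) \<le> 2 * M / R * vnorm n v"
proof -
  have "cmod (f (p + v) - f p) \<le> 2 * M / R * vnorm n v \<and>
    cmod (f (p + v) - f p - cdot n a v) \<le> 4 * M / R^2 * vnorm n v ^ 2 \<and>
    cmod (cdot n a v) \<le> 2 * M / R * vnorm n v"
  proof (cases "v = 0")
    case True
    then show ?thesis by (simp add: cdot_linear)
  next
    case False
    then have pos: "vnorm n v > 0" using v vnorm_eq_0_iff[of v n] vnorm_nonneg[of n v] by linarith
    define \<rho> where "\<rho> = R / vnorm n v"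
    define g where "g \<zeta> = f (p + vscale \<zeta> v)" for \<zeta>
    have \<rho>: "\<rho> > 1" "\<rho> > 0" using v R pos by (auto simp: \<rho>_def)
    have small: "cmod \<zeta> * vnorm n v < R" if "cmod \<zeta> < \<rho>" for \<zeta>
      using that pos by (simp add: \<rho>_def field_simps)
    have f': "cdiff n f (p + vscale \<zeta> v) \<and> cmod (g \<zeta>) \<le> M" if "cmod \<zeta> < \<rho>" for \<zeta>
      unfolding g_def by (rule f) (use p v small[OF that] in auto)
    have "\<exists>d. (g has_field_derivative d) (at \<zeta>)" if "cmod \<zeta> < \<rho>" for \<zeta>
      using f'[OF that] has_cderiv_line[OF _ p v(1)] unfolding cdiff_def g_def by blast
    then have hol: "g holomorphic_on ball 0 \<rho>"
      unfolding holomorphic_on_def field_differentiable_def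
      by (metis has_field_derivative_at_within mem_ball_0)
    have "(g has_field_derivative cdot n a v) (at 0)"
      unfolding g_def by (rule has_cderiv_line) (use a p v in auto)
    then have d: "deriv g 0 = cdot n a v" by (rule DERIV_imp_deriv)
    have g01: "g 0 = f p" "g 1 = f (p + v)" by (auto simp: g_def)
    have e: "2 * M / \<rho> = 2 * M / R * vnorm n v" "4 * M / \<rho>^2 = 4 * M / R^2 * vnorm n v ^ 2"
      by (auto simp: \<rho>_def power_divide)
    from holomorphic_taylor_bounds[OF hol \<rho>(2), of M 1] f' \<rho>(1) show ?thesis
      unfolding d g01 e by (simp add: \<rho>(1))
  qed
  then show "cmod (f (p + v) - f p) \<le> 2 * M / R * vnorm n v"
    "cmod (f (p + v) - f p - cdot n a v) \<le> 4 * M / R^2 * vnorm n v ^ 2"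
    "cmod (cdot n a v) \<le> 2 * M / R * vnorm n v" by auto
qed

text \<open>If z and w are closer than R, then z lies in the ball of radius R around w, which is
  inside the ball of radius 2 R around p. Otherwise the trivial bound 2 M on the difference is
  already enough.\<close>

lemma bounded_cdiff_lipschitz:
  assumes p: "p \<in> cvec n" and R: "R > 0"
    and f: "\<And>z. z \<in> cvec n \<Longrightarrow> vnorm n (z - p) < 2 * R \<Longrightarrow> cdiff n f z \<and> cmod (f z) \<le> M"
    and z: "z \<in> cvec n" "vnorm n (z - p) < R" and w: "w \<in> cvec n" "vnorm n (w - p) < R"
  shows "cmod (f z - f w) \<le> 2 * M / R * vnorm n (z - w)"
proof (cases "vnorm n (z - w) < R")
  case True
  have f': "cdiff n f u \<and> cmod (f u) \<le> M" if "u \<in> cvec n" "vnorm n (u - w) < R" for u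
    using that w vnorm_dist_triangle[of n u p w] by (intro f) auto
  obtain a where "has_cderiv n f w a" using f'[of w] w R unfolding cdiff_def by auto
  from bounded_cdiff_bounds(1)[OF w(1) R f' _ True this] z w show ?thesis by simp
next
  case False
  have "vnorm n (z - p) < 2 * R" using z R by linarith
  then have "cmod (f z) \<le> M" using f[of z] z by blast
  then have "M \<ge> 0" using norm_ge_zero[of "f z"] by linarith
  have "cmod (f z - f w) \<le> 2 * M"
  proof -
    have "vnorm n (w - p) < 2 * R" using w R by linarith
    then have "cmod (f w) \<le> M" using f[of w] w by blast
    with \<open>cmod (f z) \<le> M\<close> show ?thesis using norm_triangle_ineq4[of "f z" "f w"] by linarith
  qed
  also have "\<dots> \<le> 2 * M / R * vnorm n (z - w)"
    using False R \<open>M \<ge> 0\<close> mult_left_mono[of R "vnorm n (z - w)" "2 * M"] by (simp add: field_simps)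
  finally show ?thesis .
qed

section \<open>Ultrafilters and the Weierstrass convergence theorem\<close>

subsection \<open>Limits along ultrafilters\<close>

text \<open>Along one ultrafilter every sequence in a compact set converges, so infinitely many
  limits can be taken with a single choice and no diagonal sequence.\<close>

definition ultra :: "'a filter \<Rightarrow> bool" where
  "ultra U \<longleftrightarrow> U \<noteq> bot \<and> (\<forall>P. eventually P U \<or> eventually (\<lambda>x. \<not> P x) U)"

lemma ultra_not_bot [simp]: "ultra U \<Longrightarrow> U \<noteq> bot"
  by (simp add: ultra_def)

text \<open>Zorn's lemma for the proper filters below \<open>F0\<close>, minimal meaning finest. The
  infimum of a chain stays proper because an event of the infimum is already an event of some
  member. Minimality decides each P: intersecting with P either gives the trivial filter or changes
  nothing.\<close>

lemma ultra_exists: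
  assumes "F0 \<noteq> bot"
  shows "\<exists>U. ultra U \<and> U \<le> (F0 :: 'a filter)"
proof -
  let ?A = "{F. F \<noteq> bot \<and> F \<le> F0}" and ?P = "\<lambda>F G :: 'a filter. G \<le> F"
  have "\<exists>m\<in>?A. \<forall>a\<in>?A. ?P m a \<longrightarrow> a = m"
  proof (rule predicate_Zorn)
    show "partial_order_on ?A (relation_of ?P ?A)"
      by (rule partial_order_on_relation_ofI) auto
    fix C assume C: "C \<in> Chains (relation_of ?P ?A)"
    show "\<exists>u\<in>?A. \<forall>a\<in>C. ?P a u"
    proof (cases "C = {}")
      case True
      then show ?thesis using assms by auto
    next
      case False
      have C': "(a, b) \<in> relation_of ?P ?A \<or> (b, a) \<in> relation_of ?P ?A" if "a \<in> C" "b \<in> C" for a b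
        using C that unfolding Chains_def by blast
      have sub: "C \<subseteq> ?A"
        using C' unfolding relation_of_def by blast
      have tot: "a \<le> b \<or> b \<le> a" if "a \<in> C" "b \<in> C" for a b
        using C'[OF that] unfolding relation_of_def by blast
      have "eventually P (Inf C) \<longleftrightarrow> (\<exists>b\<in>C. eventually P b)" for P
      proof (rule eventually_Inf_base[OF False])
        fix F G assume "F \<in> C" "G \<in> C"
        then show "\<exists>x\<in>C. x \<le> inf F G" using tot[of F G] by (metis le_inf_iff order_refl)
      qed
      then have "Inf C \<noteq> bot"
        using sub unfolding trivial_limit_def by auto
      moreover have "Inf C \<le> F0" using False sub by (auto intro: Inf_lower2)
      ultimately show ?thesis by (auto intro!: bexI[of _ "Inf C"] Inf_lower)
    qed
  qed
  then obtain U where U: "U \<noteq> bot" "U \<le> F0" and min: "\<And>F. F \<noteq> bot \<Longrightarrow> F \<le> U \<Longrightarrow> F = U"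
    by (metis (mono_tags, lifting) mem_Collect_eq order_trans)
  have "eventually P U \<or> eventually (\<lambda>x. \<not> P x) U" for P
  proof (cases "inf U (principal {x. P x}) = bot")
    case True
    then show ?thesis by (auto simp: trivial_limit_def eventually_inf_principal)
  next
    case False
    then have "inf U (principal {x. P x}) = U" by (intro min) auto
    then have "eventually P (inf U (principal {x. P x})) \<Longrightarrow> eventually P U" by simp
    then show ?thesis by (simp add: eventually_inf_principal)
  qed
  with U show ?thesis unfolding ultra_def by blast
qed

text \<open>If no point of C were a limit, each would have a neighbourhood that f eventually avoids,
  as the ultrafilter decides every event; finitely many of these cover C.\<close>

lemma ultra_compactin:
  assumes U: "ultra U" and C: "compactin T C" and ev: "eventually (\<lambda>m. f m \<in> C) U"
  shows "\<exists>l\<in>C. limitin T f l U"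
proof (rule ccontr)
  assume "\<not> ?thesis"
  then have "\<exists>V. openin T V \<and> c \<in> V \<and> \<not> eventually (\<lambda>m. f m \<in> V) U" if "c \<in> C" for c
    using that compactin_subset_topspace[OF C] unfolding limitin_def by blast
  then obtain V where V: "\<And>c. c \<in> C \<Longrightarrow> openin T (V c)" "\<And>c. c \<in> C \<Longrightarrow> c \<in> V c"
    "\<And>c. c \<in> C \<Longrightarrow> \<not> eventually (\<lambda>m. f m \<in> V c) U"
    by metis
  have "\<exists>\<F>. finite \<F> \<and> \<F> \<subseteq> V ` C \<and> C \<subseteq> \<Union>\<F>"
    by (rule compactinD[OF C]) (use V in auto)
  then obtain \<F> where F: "finite \<F>" "\<F> \<subseteq> V ` C" "C \<subseteq> \<Union>\<F>" by blast
  have "eventually (\<lambda>m. \<forall>W\<in>\<F>. f m \<notin> W) U"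
    using F V(3) U by (intro eventually_ball_finite) (auto simp: ultra_def)
  with ev have "eventually (\<lambda>m. False) U"
    by eventually_elim (use F in auto)
  then show False using U by (simp add: ultra_def)
qed

lemma ultra_bounded_complex:
  assumes "ultra U" "eventually (\<lambda>m. cmod (f m) \<le> B) U"
  shows "\<exists>l. (f \<longlongrightarrow> l) U"
  using ultra_compactin[of U euclidean "cball 0 B" f] assms
  by (auto simp: limitin_canonical_iff dist_norm)

text \<open>Weierstrass for pointwise limits of uniformly bounded functions. The Cauchy estimate
  bounds the derivatives, so they converge along U, and the uniform quadratic bound on the remainder
  survives the limit. Convergence of the derivatives themselves is a conclusion because
  \<open>local_retract\<close> compares the maps \<open>g m\<close> with their limit to first
  order.\<close>

lemma cdiff_ultra_limit:
  assumes U: "ultra U" and p: "p \<in> cvec n" and R: "R > 0"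
    and G: "eventually (\<lambda>m. \<forall>z\<in>cvec n. vnorm n (z - p) < R \<longrightarrow> cdiff n (G m) z \<and> cmod (G m z) \<le> M) U"
    and lim: "\<And>z. z \<in> cvec n \<Longrightarrow> vnorm n (z - p) < R \<Longrightarrow> ((\<lambda>m. G m z) \<longlongrightarrow> g z) U"
  obtains a where "has_cderiv n g p a"
    "\<And>b i. eventually (\<lambda>m. has_cderiv n (G m) p (b m)) U \<Longrightarrow> i < n \<Longrightarrow> ((\<lambda>m. b m i) \<longlongrightarrow> a i) U"
proof -
  define b where "b m = (SOME b. has_cderiv n (G m) p b)" for m
  have b: "eventually (\<lambda>m. has_cderiv n (G m) p (b m)) U"
    using G
  proof eventually_elim
    case (elim m)
    then have "cdiff n (G m) p" using p R by simp
    then show ?case unfolding b_def cdiff_def by (rule someI_ex)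
  qed
  have M0: "M \<ge> 0"
  proof -
    have "eventually (\<lambda>m. M \<ge> 0) U"
      using G by eventually_elim (use p R in \<open>force intro: order_trans[OF norm_ge_zero]\<close>)
    then show ?thesis using U by (simp add: ultra_def)
  qed
  have "\<exists>l. ((\<lambda>m. b m i) \<longlongrightarrow> l) U" if i: "i < n" for i
  proof (rule ultra_bounded_complex[OF U])
    show "eventually (\<lambda>m. cmod (b m i) \<le> 2 * M / R) U"
      using b G
    proof eventually_elim
      case (elim m)
      define v where "v = vscale (of_real (R / 2)) (axisv i)"
      have v: "v \<in> cvec n" "vnorm n v = R / 2" using i R by (auto simp: v_def)
      have "cmod (cdot n (b m) v) \<le> 2 * M / R * vnorm n v"
        by (rule bounded_cdiff_bounds(3)[OF p R _ v(1) _ elim(1)]) (use elim(2) v R in auto)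
      moreover have "cdot n (b m) v = of_real (R / 2) * b m i" using i by (simp add: v_def cdot_linear)
      ultimately have "R / 2 * cmod (b m i) \<le> R / 2 * (2 * M / R)"
        using v R by (simp add: norm_mult)
      then show ?case using R by (simp only: mult_le_cancel_left_pos half_gt_zero)
    qed
  qed
  then obtain a where a: "\<And>i. i < n \<Longrightarrow> ((\<lambda>m. b m i) \<longlongrightarrow> a i) U" by metis
  have quad: "cmod (g (p + v) - g p - cdot n a v) \<le> 4 * M / R^2 * vnorm n v ^ 2"
    if v: "v \<in> cvec n" "vnorm n v < R" for v
  proof (rule tendsto_upperbound)
    show "((\<lambda>m. cmod (G m (p + v) - G m p - cdot n (b m) v)) \<longlongrightarrow> cmod (g (p + v) - g p - cdot n a v)) U"
      unfolding cdot_def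
      by (intro tendsto_norm tendsto_diff lim tendsto_sum tendsto_mult a tendsto_const) (use p v R in auto)
    show "eventually (\<lambda>m. cmod (G m (p + v) - G m p - cdot n (b m) v) \<le> 4 * M / R^2 * vnorm n v ^ 2) U"
      using b G
    proof eventually_elim
      case (elim m)
      show ?case
        by (rule bounded_cdiff_bounds(2)[OF p R _ v elim(1)]) (use elim(2) in auto)
    qed
  qed (use U in auto)
  have ga: "has_cderiv n g p a"
    unfolding has_cderiv_def
  proof (intro allI impI)
    fix \<epsilon> :: real assume e: "\<epsilon> > 0"
    define K where "K = 4 * M / R^2 + 1"
    have K: "K > 0" using M0 R by (auto simp: K_def intro!: add_nonneg_pos)
    show "\<exists>\<delta>>0. \<forall>z\<in>cvec n. vnorm n (z - p) < \<delta> \<longrightarrow>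
           cmod (g z - g p - cdot n a (z - p)) \<le> \<epsilon> * vnorm n (z - p)"
    proof (intro exI[of _ "min R (\<epsilon> / K)"] conjI ballI impI)
      fix z assume z: "z \<in> cvec n" "vnorm n (z - p) < min R (\<epsilon> / K)"
      let ?v = "vnorm n (z - p)"
      have "cmod (g z - g p - cdot n a (z - p)) \<le> 4 * M / R^2 * ?v ^ 2"
        using quad[of "z - p"] z p by simp
      also have "\<dots> \<le> K * ?v ^ 2" by (intro mult_right_mono) (auto simp: K_def)
      also have "\<dots> = (K * ?v) * ?v" by (simp add: power2_eq_square)
      also have "\<dots> \<le> \<epsilon> * ?v"
        using z K by (intro mult_right_mono) (auto simp: field_simps)
      finally show "cmod (g z - g p - cdot n a (z - p)) \<le> \<epsilon> * ?v" .
    qed (use R K e in auto)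
  qed
  moreover have "((\<lambda>m. c m i) \<longlongrightarrow> a i) U"
    if c: "eventually (\<lambda>m. has_cderiv n (G m) p (c m)) U" and i: "i < n" for c i
  proof (rule Lim_transform_eventually[OF a[OF i]])
    show "eventually (\<lambda>m. b m i = c m i) U"
      using b c by eventually_elim (rule has_cderiv_unique[OF _ _ p i])
  qed
  ultimately show thesis using that by blast
qed

section \<open>Maps between manifolds, holomorphic at a point\<close>

section \<open>Pointwise holomorphy on manifolds\<close>

text \<open>The atlas clauses of \<open>complex_manifold\<close>, isolated so that C^n, the disc and
  the retract can be sources and targets of holomorphic maps as soon as their charts are in
  place.\<close>

definition premfd :: "'a cmfd \<Rightarrow> bool" where
  "premfd M \<longleftrightarrow>
     (\<Union>(U, \<phi>)\<in>mfd_atlas M. U) = carrier_of M \<and>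
     (\<forall>(U, \<phi>)\<in>mfd_atlas M.
        openin (mfd_top M) U \<and> openin (complex_space (mfd_dim M)) (\<phi> ` U) \<and>
        homeomorphic_map (subtopology (mfd_top M) U)
          (subtopology (complex_space (mfd_dim M)) (\<phi> ` U)) \<phi>) \<and>
     (\<forall>(U, \<phi>)\<in>mfd_atlas M. \<forall>(V, \<psi>)\<in>mfd_atlas M. \<forall>j<mfd_dim M.
        holo_fun_on (mfd_dim M) (\<phi> ` (U \<inter> V)) (\<lambda>z. \<psi> (inv_into U \<phi> z) j))"

lemma premfd_complex_manifold: "complex_manifold M \<Longrightarrow> premfd M"
  unfolding complex_manifold_def premfd_def by (elim conjE) (intro conjI)

definition tcont :: "'a topology \<Rightarrow> 'b topology \<Rightarrow> ('a \<Rightarrow> 'b) \<Rightarrow> 'a \<Rightarrow> bool" where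
  "tcont S T f x \<longleftrightarrow> (\<forall>W. openin T W \<and> f x \<in> W \<longrightarrow> (\<exists>V. openin S V \<and> x \<in> V \<and> f ` V \<subseteq> W))"

lemma continuous_map_iff_tcont:
  "continuous_map S T f \<longleftrightarrow> (\<forall>x\<in>topspace S. f x \<in> topspace T \<and> tcont S T f x)"
proof
  assume c: "continuous_map S T f"
  show "\<forall>x\<in>topspace S. f x \<in> topspace T \<and> tcont S T f x"
  proof (intro ballI conjI)
    fix x assume x: "x \<in> topspace S"
    show "f x \<in> topspace T" using c x by (auto simp: continuous_map_def)
    show "tcont S T f x"
      unfolding tcont_def
    proof (intro allI impI)
      fix W assume W: "openin T W \<and> f x \<in> W"
      then have "openin S {y \<in> topspace S. f y \<in> W}" using c by (auto simp: continuous_map_def)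
      then show "\<exists>V. openin S V \<and> x \<in> V \<and> f ` V \<subseteq> W"
        using W x by (intro exI[of _ "{y \<in> topspace S. f y \<in> W}"]) auto
    qed
  qed
next
  assume R: "\<forall>x\<in>topspace S. f x \<in> topspace T \<and> tcont S T f x"
  show "continuous_map S T f"
    unfolding continuous_map_def
  proof (intro conjI allI impI)
    show "f \<in> topspace S \<rightarrow> topspace T" using R by auto
    fix W assume W: "openin T W"
    show "openin S {x \<in> topspace S. f x \<in> W}"
    proof (subst openin_subopen, intro ballI)
      fix x assume x: "x \<in> {x \<in> topspace S. f x \<in> W}"
      then obtain V where V: "openin S V" "x \<in> V" "f ` V \<subseteq> W"
        using R W unfolding tcont_def by blast
      then have "V \<subseteq> {x \<in> topspace S. f x \<in> W}" using openin_subset[OF V(1)] by auto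
      with V show "\<exists>V. openin S V \<and> x \<in> V \<and> V \<subseteq> {x \<in> topspace S. f x \<in> W}" by blast
    qed
  qed
qed

lemma tcont_comp: "tcont S T f x \<Longrightarrow> tcont T R g (f x) \<Longrightarrow> tcont S R (\<lambda>x. g (f x)) x"
  unfolding tcont_def by (metis image_image image_mono order_trans)

subsection \<open>Charts\<close>

lemma
  assumes "premfd M" "(U, \<phi>) \<in> mfd_atlas M"
  shows chart_open: "openin (mfd_top M) U"
    and chart_image_open: "openin (complex_space (mfd_dim M)) (\<phi> ` U)"
    and chart_homeo: "homeomorphic_map (subtopology (mfd_top M) U)
          (subtopology (complex_space (mfd_dim M)) (\<phi> ` U)) \<phi>"
  using assms unfolding premfd_def by blast+

lemma chart_subset: "premfd M \<Longrightarrow> (U, \<phi>) \<in> mfd_atlas M \<Longrightarrow> U \<subseteq> carrier_of M"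
  by (meson chart_open openin_subset)

lemma chart_exists:
  assumes "premfd M" "x \<in> carrier_of M"
  obtains U \<phi> where "(U, \<phi>) \<in> mfd_atlas M" "x \<in> U"
  using assms unfolding premfd_def by blast

lemma chart_inj:
  assumes "premfd M" "(U, \<phi>) \<in> mfd_atlas M"
  shows "inj_on \<phi> U"
  using homeomorphic_imp_injective_map[OF chart_homeo[OF assms]] chart_subset[OF assms]
  by (simp add: Int_absorb1)

lemma chart_inv [simp]:
  assumes "premfd M" "(U, \<phi>) \<in> mfd_atlas M" "x \<in> U"
  shows "inv_into U \<phi> (\<phi> x) = x"
  using chart_inj[OF assms(1,2)] assms(3) by simp

lemma chart_cvec:
  assumes "premfd M" "(U, \<phi>) \<in> mfd_atlas M" "x \<in> U"
  shows "\<phi> x \<in> cvec (mfd_dim M)"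
  using openin_subset[OF chart_image_open[OF assms(1,2)]] assms(3) by auto

lemma chart_open_image:
  assumes "premfd M" "(U, \<phi>) \<in> mfd_atlas M" "openin (mfd_top M) W"
  shows "openin (complex_space (mfd_dim M)) (\<phi> ` (U \<inter> W))"
proof -
  have "openin (subtopology (mfd_top M) U) (U \<inter> W)"
    using assms(3) by (simp add: openin_subtopology_Int2)
  then have "openin (subtopology (complex_space (mfd_dim M)) (\<phi> ` U)) (\<phi> ` (U \<inter> W))"
    using homeomorphic_imp_open_map[OF chart_homeo[OF assms(1,2)]] unfolding open_map_def by blast
  then show ?thesis using chart_image_open[OF assms(1,2)] openin_trans_full by blast
qed

lemma chart_nbhd:
  assumes "premfd M" "(U, \<phi>) \<in> mfd_atlas M" "x \<in> U" "openin (mfd_top M) W" "x \<in> W"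
  obtains \<delta> where "\<delta> > 0" "\<And>z. z \<in> cvec (mfd_dim M) \<Longrightarrow> vnorm (mfd_dim M) (z - \<phi> x) < \<delta> \<Longrightarrow>
      z \<in> \<phi> ` U \<and> inv_into U \<phi> z \<in> W \<and> inv_into U \<phi> z \<in> U \<and> \<phi> (inv_into U \<phi> z) = z"
proof -
  have "\<phi> x \<in> \<phi> ` (U \<inter> W)" using assms by blast
  then obtain \<delta> where \<delta>: "\<delta> > 0" "\<And>z. z \<in> cvec (mfd_dim M) \<Longrightarrow> vnorm (mfd_dim M) (z - \<phi> x) < \<delta> \<Longrightarrow>
      z \<in> \<phi> ` (U \<inter> W)"
    using chart_open_image[OF assms(1,2,4)] unfolding openin_complex_space by blast
  show thesis
  proof (rule that[OF \<delta>(1)])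
    fix z assume "z \<in> cvec (mfd_dim M)" "vnorm (mfd_dim M) (z - \<phi> x) < \<delta>"
    then obtain y where y: "y \<in> U" "y \<in> W" "z = \<phi> y" using \<delta>(2) by blast
    then show "z \<in> \<phi> ` U \<and> inv_into U \<phi> z \<in> W \<and> inv_into U \<phi> z \<in> U \<and> \<phi> (inv_into U \<phi> z) = z"
      using chart_inv[OF assms(1,2) y(1)] by auto
  qed
qed

lemma chart_nbhd_cont:
  assumes "premfd M" "(U, \<phi>) \<in> mfd_atlas M"
  shows "openin (mfd_top M) {y \<in> U. vnorm (mfd_dim M) (\<phi> y - p) < r}"
proof -
  let ?n = "mfd_dim M"
  have c: "continuous_map (subtopology (mfd_top M) U) (complex_space ?n) \<phi>"
    using homeomorphic_imp_continuous_map[OF chart_homeo[OF assms]]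
    by (simp add: continuous_map_in_subtopology)
  have "openin (subtopology (mfd_top M) U)
     {y \<in> topspace (subtopology (mfd_top M) U). \<phi> y \<in> {z \<in> cvec ?n. vnorm ?n (z - p) < r}}"
    by (rule openin_continuous_map_preimage[OF c openin_ball_cvec])
  also have "{y \<in> topspace (subtopology (mfd_top M) U). \<phi> y \<in> {z \<in> cvec ?n. vnorm ?n (z - p) < r}} =
      {y \<in> U. vnorm ?n (\<phi> y - p) < r}"
    using chart_subset[OF assms] chart_cvec[OF assms] by auto
  finally show ?thesis using chart_open[OF assms] openin_trans_full by blast
qed

lemma chart_transition:
  assumes M: "premfd M" and U: "(U, \<phi>) \<in> mfd_atlas M" "x \<in> U" and V: "(V, \<psi>) \<in> mfd_atlas M" "x \<in> V"
    and j: "j < mfd_dim M"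
  shows "cdiff (mfd_dim M) (\<lambda>z. \<psi> (inv_into U \<phi> z) j) (\<phi> x)"
proof -
  have "holo_fun_on (mfd_dim M) (\<phi> ` (U \<inter> V)) (\<lambda>z. \<psi> (inv_into U \<phi> z) j)"
    using M U V j unfolding premfd_def by blast
  then show ?thesis
    using holo_fun_on_iff[OF chart_open_image[OF M U(1) chart_open[OF M V(1)]]] U V by blast
qed

text \<open>The chain rule through an intermediate chart. Continuity of f at x keeps the image in V,
  where inserting \<open>\<psi>\<close> and its inverse changes nothing. With f the identity this is
  a change of charts.\<close>

lemma charts_cdiff_comp:
  assumes M: "premfd M" and U: "(U, \<phi>) \<in> mfd_atlas M" "x \<in> U"
    and N: "premfd N" and V: "(V, \<psi>) \<in> mfd_atlas N" "f x \<in> V"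
    and c: "tcont (mfd_top M) (mfd_top N) f x"
    and f: "\<And>j. j < mfd_dim N \<Longrightarrow> cdiff (mfd_dim M) (\<lambda>z. \<psi> (f (inv_into U \<phi> z)) j) (\<phi> x)"
    and h: "cdiff (mfd_dim N) (\<lambda>w. h (inv_into V \<psi> w)) (\<psi> (f x))"
  shows "cdiff (mfd_dim M) (\<lambda>z. h (f (inv_into U \<phi> z))) (\<phi> x)"
proof -
  obtain W where W: "openin (mfd_top M) W" "x \<in> W" "f ` W \<subseteq> V"
    using c chart_open[OF N V(1)] V(2) unfolding tcont_def by blast
  obtain \<delta> where \<delta>: "\<delta> > 0" "\<And>z. z \<in> cvec (mfd_dim M) \<Longrightarrow> vnorm (mfd_dim M) (z - \<phi> x) < \<delta> \<Longrightarrow>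
      z \<in> \<phi> ` U \<and> inv_into U \<phi> z \<in> W \<and> inv_into U \<phi> z \<in> U \<and> \<phi> (inv_into U \<phi> z) = z"
    using chart_nbhd[OF M U W(1,2)] by blast
  have fV: "f (inv_into U \<phi> z) \<in> V" if "z \<in> cvec (mfd_dim M)" "vnorm (mfd_dim M) (z - \<phi> x) < \<delta>" for z
    using \<delta>(2)[OF that] W(3) by blast
  have "cdiff (mfd_dim M) (\<lambda>z. h (inv_into V \<psi> (\<psi> (f (inv_into U \<phi> z))))) (\<phi> x)"
  proof (rule cdiff_chain[where m = "mfd_dim N" and h = "\<lambda>w. h (inv_into V \<psi> w)"
        and G = "\<lambda>z. \<psi> (f (inv_into U \<phi> z))" and r = \<delta>])
    show "cdiff (mfd_dim N) (\<lambda>w. h (inv_into V \<psi> w)) (\<psi> (f (inv_into U \<phi> (\<phi> x))))"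
      using h chart_inv[OF M U] by simp
    show "\<psi> (f (inv_into U \<phi> z)) \<in> cvec (mfd_dim N)"
      if "z \<in> cvec (mfd_dim M)" "vnorm (mfd_dim M) (z - \<phi> x) < \<delta>" for z
      by (rule chart_cvec[OF N V(1) fV[OF that]])
  qed (use f \<delta> in auto)
  then show ?thesis
    by (rule cdiff_cong[OF _ chart_cvec[OF M U] \<delta>(1)]) (simp add: chart_inv[OF N V(1) fV])
qed

subsection \<open>Holomorphy at a point\<close>

text \<open>Tested in a single pair of charts, which is easy to establish;
  \<open>mdiff_charts\<close> transfers it to every other pair. Continuity is included because it
  makes the expression in charts meaningful near x.\<close>

definition mdiff :: "'a cmfd \<Rightarrow> 'b cmfd \<Rightarrow> ('a \<Rightarrow> 'b) \<Rightarrow> 'a \<Rightarrow> bool" where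
  "mdiff M N f x \<longleftrightarrow> x \<in> carrier_of M \<and> f x \<in> carrier_of N \<and> tcont (mfd_top M) (mfd_top N) f x \<and>
     (\<exists>U \<phi> V \<psi>. (U, \<phi>) \<in> mfd_atlas M \<and> (V, \<psi>) \<in> mfd_atlas N \<and> x \<in> U \<and> f x \<in> V \<and>
        (\<forall>j<mfd_dim N. cdiff (mfd_dim M) (\<lambda>z. \<psi> (f (inv_into U \<phi> z)) j) (\<phi> x)))"

lemma mdiff_tcont: "mdiff M N f x \<Longrightarrow> tcont (mfd_top M) (mfd_top N) f x"
  by (simp add: mdiff_def)

lemma mdiff_carrier: "mdiff M N f x \<Longrightarrow> x \<in> carrier_of M" "mdiff M N f x \<Longrightarrow> f x \<in> carrier_of N"
  by (simp_all add: mdiff_def)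

lemma mdiff_charts:
  assumes M: "premfd M" and N: "premfd N" and f: "mdiff M N f x"
    and U: "(U, \<phi>) \<in> mfd_atlas M" "x \<in> U" and V: "(V, \<psi>) \<in> mfd_atlas N" "f x \<in> V" and j: "j < mfd_dim N"
  shows "cdiff (mfd_dim M) (\<lambda>z. \<psi> (f (inv_into U \<phi> z)) j) (\<phi> x)"
proof -
  obtain U0 ph0 V0 ps0 where U0: "(U0, ph0) \<in> mfd_atlas M" "x \<in> U0" and V0: "(V0, ps0) \<in> mfd_atlas N" "f x \<in> V0"
    and d: "\<And>j. j < mfd_dim N \<Longrightarrow> cdiff (mfd_dim M) (\<lambda>z. ps0 (f (inv_into U0 ph0 z)) j) (ph0 x)"
    and c: "tcont (mfd_top M) (mfd_top N) f x"
    using f unfolding mdiff_def by blast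
  have id: "tcont (mfd_top M) (mfd_top M) (\<lambda>x. x) x" unfolding tcont_def by auto
  have d': "cdiff (mfd_dim M) (\<lambda>z. ps0 (f (inv_into U \<phi> z)) j) (\<phi> x)" if "j < mfd_dim N" for j
    by (rule charts_cdiff_comp[OF M U M U0(1), where f = "\<lambda>x. x" and h = "\<lambda>y. ps0 (f y) j", OF U0(2) id
          chart_transition[OF M U U0] d[OF that]])
  show ?thesis
    by (rule charts_cdiff_comp[OF M U N V0(1), where f = f and h = "\<lambda>y. \<psi> y j", OF V0(2) c d'
          chart_transition[OF N V0 V j]])
qed

lemma mdiff_comp:
  assumes M: "premfd M" and N: "premfd N" and K: "premfd K"
    and f: "mdiff M N f x" and g: "mdiff N K g (f x)"
  shows "mdiff M K (\<lambda>x. g (f x)) x"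
proof -
  obtain U \<phi> where U: "(U, \<phi>) \<in> mfd_atlas M" "x \<in> U" using chart_exists[OF M mdiff_carrier(1)[OF f]] by blast
  obtain V \<psi> where V: "(V, \<psi>) \<in> mfd_atlas N" "f x \<in> V" using chart_exists[OF N mdiff_carrier(2)[OF f]] by blast
  obtain W \<omega> where W: "(W, \<omega>) \<in> mfd_atlas K" "g (f x) \<in> W" using chart_exists[OF K mdiff_carrier(2)[OF g]] by blast
  have "cdiff (mfd_dim M) (\<lambda>z. \<omega> (g (f (inv_into U \<phi> z))) j) (\<phi> x)" if j: "j < mfd_dim K" for j
    by (rule charts_cdiff_comp[OF M U N V(1), where f = f and h = "\<lambda>y. \<omega> (g y) j", OF V(2) mdiff_tcont[OF f]
          mdiff_charts[OF M N f U V] mdiff_charts[OF N K g V W j]])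
  with U W show ?thesis
    using tcont_comp[OF mdiff_tcont[OF f] mdiff_tcont[OF g]] mdiff_carrier(1)[OF f] mdiff_carrier(2)[OF g]
    unfolding mdiff_def by blast
qed

lemma mdiff_id: assumes M: "premfd M" and x: "x \<in> carrier_of M" shows "mdiff M M (\<lambda>x. x) x"
proof -
  obtain U \<phi> where U: "(U, \<phi>) \<in> mfd_atlas M" "x \<in> U" using chart_exists[OF assms] by blast
  have "tcont (mfd_top M) (mfd_top M) (\<lambda>x. x) x" unfolding tcont_def by auto
  then show ?thesis using x U chart_transition[OF M U U] unfolding mdiff_def by blast
qed

text \<open>Continuity of f makes the domain of its coordinate expression open, as
  \<open>holo_fun_on_iff\<close> demands. From here on \<open>holo_map\<close> is handled one point
  at a time.\<close>

lemma holo_map_iff_mdiff: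
  assumes M: "premfd M" and N: "premfd N"
  shows "holo_map M N f \<longleftrightarrow> (\<forall>x\<in>carrier_of M. mdiff M N f x)"
proof -
  have op: "openin (complex_space (mfd_dim M)) (\<phi> ` (U \<inter> f -` V))"
    if U: "(U, \<phi>) \<in> mfd_atlas M" and V: "(V, \<psi>) \<in> mfd_atlas N"
      and c: "continuous_map (mfd_top M) (mfd_top N) f" for U \<phi> V \<psi>
  proof -
    have "U \<inter> f -` V = U \<inter> {x \<in> carrier_of M. f x \<in> V}" using chart_subset[OF M U] by auto
    then show ?thesis
      using chart_open_image[OF M U openin_continuous_map_preimage[OF c chart_open[OF N V]]] by simp
  qed
  show ?thesis
  proof
    assume h: "holo_map M N f"
    then have c: "continuous_map (mfd_top M) (mfd_top N) f" by (simp add: holo_map_def)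
    show "\<forall>x\<in>carrier_of M. mdiff M N f x"
    proof
      fix x assume x: "x \<in> carrier_of M"
      have fx: "f x \<in> carrier_of N" "tcont (mfd_top M) (mfd_top N) f x"
        using c[unfolded continuous_map_iff_tcont] x by blast+
      obtain U \<phi> where U: "(U, \<phi>) \<in> mfd_atlas M" "x \<in> U" using chart_exists[OF M x] by blast
      obtain V \<psi> where V: "(V, \<psi>) \<in> mfd_atlas N" "f x \<in> V" using chart_exists[OF N fx(1)] by blast
      have "cdiff (mfd_dim M) (\<lambda>z. \<psi> (f (inv_into U \<phi> z)) j) (\<phi> x)" if "j < mfd_dim N" for j
      proof -
        have "holo_fun_on (mfd_dim M) (\<phi> ` (U \<inter> f -` V)) (\<lambda>z. \<psi> (f (inv_into U \<phi> z)) j)"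
          using h U V that unfolding holo_map_def by blast
        then show ?thesis using holo_fun_on_iff[OF op[OF U(1) V(1) c]] U V by blast
      qed
      then show "mdiff M N f x" using x fx U V unfolding mdiff_def by blast
    qed
  next
    assume d: "\<forall>x\<in>carrier_of M. mdiff M N f x"
    then have c: "continuous_map (mfd_top M) (mfd_top N) f"
      unfolding continuous_map_iff_tcont mdiff_def by blast
    have "holo_fun_on (mfd_dim M) (\<phi> ` (U \<inter> f -` V)) (\<lambda>z. \<psi> (f (inv_into U \<phi> z)) j)"
      if U: "(U, \<phi>) \<in> mfd_atlas M" and V: "(V, \<psi>) \<in> mfd_atlas N" and j: "j < mfd_dim N" for U \<phi> V \<psi> j
      unfolding holo_fun_on_iff[OF op[OF U V c]]
    proof
      fix p assume "p \<in> \<phi> ` (U \<inter> f -` V)"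
      then obtain x where x: "x \<in> U" "f x \<in> V" "p = \<phi> x" by blast
      then have f: "mdiff M N f x" using d chart_subset[OF M U] by blast
      show "cdiff (mfd_dim M) (\<lambda>z. \<psi> (f (inv_into U \<phi> z)) j) p"
        unfolding x(3) by (rule mdiff_charts[OF M N f U x(1) V x(2) j])
    qed
    with c show "holo_map M N f" unfolding holo_map_def by blast
  qed
qed

lemma holo_map_carrier: "holo_map M N f \<Longrightarrow> x \<in> carrier_of M \<Longrightarrow> f x \<in> carrier_of N"
  unfolding holo_map_def continuous_map_def by blast

lemma holo_map_comp:
  assumes "premfd M" "premfd N" "premfd K" "holo_map M N f" "holo_map N K g"
  shows "holo_map M K (\<lambda>x. g (f x))"
  using assms holo_map_carrier[OF assms(4)] by (simp add: holo_map_iff_mdiff mdiff_comp)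

lemma holo_map_id: "premfd M \<Longrightarrow> holo_map M M (\<lambda>x. x)"
  by (simp add: holo_map_iff_mdiff mdiff_id)

subsection \<open>The model manifolds\<close>

text \<open>C^n as a manifold, so that coordinate functions and parametrisations compose with other
  maps by \<open>mdiff_comp\<close>.\<close>

definition cspace_mfd :: "nat \<Rightarrow> (nat \<Rightarrow> complex) cmfd" where
  "cspace_mfd n = \<lparr>mfd_dim = n, mfd_top = complex_space n, mfd_atlas = {(cvec n, \<lambda>z. z)}\<rparr>"

lemma cspace_mfd_simps [simp]:
  "mfd_dim (cspace_mfd n) = n" "mfd_top (cspace_mfd n) = complex_space n"
  "mfd_atlas (cspace_mfd n) = {(cvec n, \<lambda>z. z)}"
  by (simp_all add: cspace_mfd_def)

lemma inv_into_id: "z \<in> S \<Longrightarrow> inv_into S (\<lambda>z. z) z = z"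
  using inv_into_f_f[of "\<lambda>z. z" S z] by (simp add: inj_on_def)

lemma premfd_cspace: "premfd (cspace_mfd n)"
proof -
  have o: "openin (complex_space n) (cvec n)"
    by (metis openin_topspace topspace_complex_space)
  have h: "homeomorphic_map (subtopology (complex_space n) (cvec n)) (subtopology (complex_space n) (cvec n)) (\<lambda>z. z)"
    using homeomorphic_map_id[of "subtopology (complex_space n) (cvec n)"] unfolding id_def by blast
  have "holo_fun_on n (cvec n) (\<lambda>z. inv_into (cvec n) (\<lambda>z. z) z j)" for j
    unfolding holo_fun_on_iff[OF o]
  proof
    fix p assume "p \<in> cvec n"
    then show "cdiff n (\<lambda>z. inv_into (cvec n) (\<lambda>z. z) z j) p"
      by (intro cdiff_cong[OF cdiff_coord[of p n j], of 1]) (auto simp: inv_into_id)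
  qed
  with o h show ?thesis unfolding premfd_def by simp
qed

lemma mdiff_from_cspace:
  assumes N: "premfd N" and p: "p \<in> cvec n" and V: "(V, \<psi>) \<in> mfd_atlas N" "f p \<in> V"
    and c: "tcont (complex_space n) (mfd_top N) f p"
    and d: "\<And>j. j < mfd_dim N \<Longrightarrow> cdiff n (\<lambda>z. \<psi> (f z) j) p"
  shows "mdiff (cspace_mfd n) N f p"
proof -
  have "cdiff n (\<lambda>z. \<psi> (f (inv_into (cvec n) (\<lambda>z. z) z)) j) p" if "j < mfd_dim N" for j
    by (rule cdiff_cong[OF d[OF that] p, of 1]) (auto simp: inv_into_id)
  then show ?thesis
    using p V c chart_subset[OF N V(1)] unfolding mdiff_def by auto
qed

lemma mdiff_cspaceD:
  assumes "mdiff (cspace_mfd n) (cspace_mfd m) f p" "j < m"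
  shows "cdiff n (\<lambda>z. f z j) p"
proof -
  have "p \<in> cvec n" "f p \<in> cvec m" using mdiff_carrier[OF assms(1)] by auto
  then have "cdiff n (\<lambda>z. f (inv_into (cvec n) (\<lambda>z. z) z) j) p"
    using mdiff_charts[OF premfd_cspace premfd_cspace assms(1), of "cvec n" "\<lambda>z. z" "cvec m" "\<lambda>z. z" j] assms(2)
    by simp
  from cdiff_cong[OF this \<open>p \<in> cvec n\<close>, of 1 "\<lambda>z. f z j"] show ?thesis
    by (simp add: inv_into_id)
qed

lemma mdiff_to_cspace:
  assumes M: "premfd M" and U: "(U, \<phi>) \<in> mfd_atlas M" "x \<in> U" and f: "f x \<in> cvec m"
    and c: "tcont (mfd_top M) (complex_space m) f x"
    and d: "\<And>j. j < m \<Longrightarrow> cdiff (mfd_dim M) (\<lambda>z. f (inv_into U \<phi> z) j) (\<phi> x)"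
  shows "mdiff M (cspace_mfd m) f x"
proof -
  have "x \<in> carrier_of M" using U chart_subset[OF M U(1)] by blast
  then show ?thesis using U f c d unfolding mdiff_def by auto
qed

abbreviation disc_coord :: "complex \<Rightarrow> nat \<Rightarrow> complex" where
  "disc_coord \<equiv> \<lambda>z i. if i = 0 then z else 0"

lemma unit_disc_simps [simp]:
  "mfd_dim unit_disc = 1" "mfd_top unit_disc = top_of_set (ball 0 1)"
  "mfd_atlas unit_disc = {(ball 0 1, disc_coord)}"
  by (simp_all add: unit_disc_def)

lemma disc_coord_image: "disc_coord ` ball 0 1 = {z \<in> cvec 1. vnorm 1 (z - 0) < 1}"
proof
  show "disc_coord ` ball 0 1 \<subseteq> {z \<in> cvec 1. vnorm 1 (z - 0) < 1}"
    by (auto simp: cvec_def vnorm_def)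
  show "{z \<in> cvec 1. vnorm 1 (z - 0) < 1} \<subseteq> disc_coord ` ball 0 1"
  proof
    fix z assume z: "z \<in> {z \<in> cvec 1. vnorm 1 (z - 0) < 1}"
    then have "z = disc_coord (z 0)" "z 0 \<in> ball 0 1" by (auto simp: cvec_def vnorm_def fun_eq_iff)
    then show "z \<in> disc_coord ` ball 0 1" by blast
  qed
qed

lemma inj_disc_coord: "inj_on disc_coord S"
  by (rule inj_onI) (metis (full_types))

lemma inv_disc_coord: "z \<in> disc_coord ` ball 0 1 \<Longrightarrow> inv_into (ball 0 1) disc_coord z = z 0"
  by (auto simp: inv_into_f_f[OF inj_disc_coord])

lemma premfd_unit_disc: "premfd unit_disc"
proof -
  have o: "openin (complex_space 1) (disc_coord ` ball 0 1)"
    unfolding disc_coord_image by (rule openin_ball_cvec)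
  have s: "subtopology (complex_space 1) (disc_coord ` ball 0 1) = top_of_set (disc_coord ` ball 0 1)"
  proof -
    have "{z. \<forall>i\<ge>1. z i = 0} \<inter> disc_coord ` ball 0 1 = disc_coord ` ball 0 1" by auto
    then show ?thesis unfolding complex_space_def subtopology_subtopology by simp
  qed
  have "homeomorphic_maps (top_of_set (ball 0 1)) (top_of_set (disc_coord ` ball 0 1)) disc_coord (\<lambda>z. z 0)"
    unfolding homeomorphic_maps_def
  proof (intro conjI)
    have "continuous_on (ball 0 1) disc_coord"
    proof (rule continuous_on_coordinatewise_then_product)
      show "continuous_on (ball 0 1) (\<lambda>x. disc_coord x i)" for i
        by (cases "i = 0") (simp_all add: continuous_on_id)
    qed
    then show "continuous_map (top_of_set (ball 0 1)) (top_of_set (disc_coord ` ball 0 1)) disc_coord"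
      by (simp add: continuous_map_in_subtopology)
    have "continuous_on (disc_coord ` ball 0 1) (\<lambda>z. z 0)"
      by (rule continuous_on_product_then_coordinatewise) (rule continuous_on_id)
    then show "continuous_map (top_of_set (disc_coord ` ball 0 1)) (top_of_set (ball 0 1)) (\<lambda>z. z 0)"
      by (auto simp: continuous_map_in_subtopology)
  qed auto
  then have h: "homeomorphic_map (subtopology (top_of_set (ball 0 1)) (ball 0 1))
     (subtopology (complex_space 1) (disc_coord ` ball 0 1)) disc_coord"
    unfolding s using homeomorphic_map_maps by (auto simp: subtopology_subtopology)
  have "holo_fun_on 1 (disc_coord ` ball 0 1) (\<lambda>z. disc_coord (inv_into (ball 0 1) disc_coord z) 0)"
    unfolding holo_fun_on_iff[OF o]
  proof
    fix p assume p: "p \<in> disc_coord ` ball 0 1"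
    then obtain \<delta> where \<delta>: "\<delta> > 0" "\<And>z. z \<in> cvec 1 \<Longrightarrow> vnorm 1 (z - p) < \<delta> \<Longrightarrow> z \<in> disc_coord ` ball 0 1"
      using o unfolding openin_complex_space by blast
    have pc: "p \<in> cvec 1" using p by (auto simp: cvec_def)
    show "cdiff 1 (\<lambda>z. disc_coord (inv_into (ball 0 1) disc_coord z) 0) p"
      by (rule cdiff_cong[OF cdiff_coord[OF pc, of 0] pc \<delta>(1)]) (use \<delta>(2) in \<open>simp add: inv_disc_coord\<close>)
  qed
  with o h show ?thesis unfolding premfd_def by simp
qed

text \<open>Affine discs inside a chart are the only discs constructed explicitly. They connect
  nearby points and show that nearby points have small Kobayashi distance.\<close>

lemma holo_map_unit_disc_affine:
  assumes M: "premfd M" and U: "(U, \<phi>) \<in> mfd_atlas M"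
    and v: "\<And>\<zeta>. cmod \<zeta> < 1 \<Longrightarrow> c + vscale \<zeta> v \<in> \<phi> ` U" and c: "c \<in> cvec (mfd_dim M)" "v \<in> cvec (mfd_dim M)"
  shows "holo_map unit_disc M (\<lambda>\<zeta>. inv_into U \<phi> (c + vscale \<zeta> v))"
  unfolding holo_map_iff_mdiff[OF premfd_unit_disc M]
proof
  let ?n = "mfd_dim M" and ?g = "\<lambda>\<zeta>. inv_into U \<phi> (c + vscale \<zeta> v)"
  fix \<zeta> assume "\<zeta> \<in> carrier_of unit_disc"
  then have \<zeta>: "cmod \<zeta> < 1" by simp
  have gU: "?g \<xi> \<in> U" "\<phi> (?g \<xi>) = c + vscale \<xi> v" if "cmod \<xi> < 1" for \<xi>
    using v[OF that] by (auto intro: inv_into_into f_inv_into_f)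
  have cont: "tcont (top_of_set (ball 0 1)) (mfd_top M) ?g \<zeta>"
    unfolding tcont_def
  proof (intro allI impI)
    fix W assume W: "openin (mfd_top M) W \<and> ?g \<zeta> \<in> W"
    obtain \<delta> where \<delta>: "\<delta> > 0" "\<And>z. z \<in> cvec ?n \<Longrightarrow> vnorm ?n (z - \<phi> (?g \<zeta>)) < \<delta> \<Longrightarrow>
      z \<in> \<phi> ` U \<and> inv_into U \<phi> z \<in> W \<and> inv_into U \<phi> z \<in> U \<and> \<phi> (inv_into U \<phi> z) = z"
      using chart_nbhd[OF M U gU(1)[OF \<zeta>]] W by blast
    define e where "e = \<delta> / (vnorm ?n v + 1)"
    have pos: "vnorm ?n v + 1 > 0" by (intro add_nonneg_pos) auto
    then have e: "e > 0" using \<delta> by (simp add: e_def)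
    have "?g \<xi> \<in> W" if "\<xi> \<in> ball \<zeta> e" for \<xi>
    proof -
      have "c + vscale \<xi> v - \<phi> (?g \<zeta>) = vscale (\<xi> - \<zeta>) v"
        unfolding gU(2)[OF \<zeta>] by (simp add: vscale_algebra)
      then have "vnorm ?n (c + vscale \<xi> v - \<phi> (?g \<zeta>)) = cmod (\<xi> - \<zeta>) * vnorm ?n v" by simp
      also have "\<dots> \<le> cmod (\<xi> - \<zeta>) * (vnorm ?n v + 1)" by (intro mult_left_mono) auto
      also have "\<dots> < e * (vnorm ?n v + 1)"
        using that pos by (intro mult_strict_right_mono) (auto simp: dist_norm norm_minus_commute)
      also have "\<dots> = \<delta>" using pos by (simp add: e_def)
      finally show ?thesis using \<delta>(2)[of "c + vscale \<xi> v"] c by simp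
    qed
    then show "\<exists>V. openin (top_of_set (ball 0 1)) V \<and> \<zeta> \<in> V \<and> ?g ` V \<subseteq> W"
      using e \<zeta> by (intro exI[of _ "ball 0 1 \<inter> ball \<zeta> e"]) (auto simp: openin_open_Int)
  qed
  have cz: "disc_coord \<zeta> \<in> cvec 1" by (simp add: cvec_def)
  obtain \<delta> where \<delta>: "\<delta> > 0" "\<And>z. z \<in> cvec 1 \<Longrightarrow> vnorm 1 (z - disc_coord \<zeta>) < \<delta> \<Longrightarrow> z \<in> disc_coord ` ball 0 1"
  proof -
    have "openin (complex_space 1) (disc_coord ` ball 0 1)"
      unfolding disc_coord_image by (rule openin_ball_cvec)
    moreover have "disc_coord \<zeta> \<in> disc_coord ` ball 0 1" using \<zeta> by simp
    ultimately have "\<exists>\<delta>>0. \<forall>z\<in>cvec 1. vnorm 1 (z - disc_coord \<zeta>) < \<delta> \<longrightarrow> z \<in> disc_coord ` ball 0 1"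
      unfolding openin_complex_space by (elim conjE bspec)
    then show thesis using that by blast
  qed
  have "cdiff 1 (\<lambda>z. \<phi> (?g (inv_into (ball 0 1) disc_coord z)) j) (disc_coord \<zeta>)" for j
  proof (rule cdiff_cong[OF _ cz \<delta>(1)])
    show "cdiff 1 (\<lambda>z. c j + v j * z 0) (disc_coord \<zeta>)"
      by (intro cdiff_intros cdiff_coord cz)
    fix z assume "z \<in> cvec 1" "vnorm 1 (z - disc_coord \<zeta>) < \<delta>"
    then have z: "z \<in> disc_coord ` ball 0 1" by (rule \<delta>(2))
    then have "cmod (z 0) < 1" by auto
    then show "c j + v j * z 0 = \<phi> (?g (inv_into (ball 0 1) disc_coord z)) j"
      unfolding inv_disc_coord[OF z] using gU(2) by (simp add: vapply mult.commute)
  qed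
  then show "mdiff unit_disc M ?g \<zeta>"
    unfolding mdiff_def using \<zeta> cont U gU(1)[OF \<zeta>] chart_subset[OF M U] by auto
qed

section \<open>Chains of discs and the Kobayashi pseudodistance\<close>

section \<open>The Kobayashi pseudodistance\<close>

lemma artanh_mono:
  assumes "0 \<le> s" "s \<le> t" "t < (1::real)"
  shows "artanh s \<le> artanh t"
proof -
  have "(1 + s) / (1 - s) \<le> (1 + t) / (1 - t)"
    using assms by (intro frac_le) auto
  moreover have "(1 + s) / (1 - s) > 0" using assms by (intro divide_pos_pos) auto
  ultimately show ?thesis by (simp add: artanh_def)
qed

lemma poincare_dist_Moebius: "poincare_dist a b = artanh (cmod (Moebius_function 0 a b))"
proof -
  have "(a - b) / (1 - cnj a * b) = - ((b - a) / (1 - cnj a * b))"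
    by (metis minus_diff_eq minus_divide_left)
  then show ?thesis
    unfolding poincare_dist_def Moebius_function_simple by (metis norm_minus_cancel)
qed

lemma poincare_dist_nonneg:
  assumes "a \<in> ball 0 1" "b \<in> ball 0 1"
  shows "0 \<le> poincare_dist a b"
proof -
  have "artanh 0 \<le> artanh (cmod (Moebius_function 0 a b))"
    using Moebius_function_norm_lt_1[of a b 0] assms by (intro artanh_mono) auto
  then show ?thesis by (simp add: poincare_dist_Moebius)
qed

text \<open>S is the closed hyperbolic disc around a through b, the Moebius image of a round disc.
  Its connectedness is what makes a crossing argument along a chain of discs possible.\<close>

lemma poincare_disc_connected:
  assumes a: "a \<in> ball 0 1" and b: "b \<in> ball 0 1"
  obtains S where "connected S" "S \<subseteq> ball 0 1" "a \<in> S" "b \<in> S"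
    "\<And>w. w \<in> S \<Longrightarrow> poincare_dist a w \<le> poincare_dist a b"
proof -
  let ?g = "Moebius_function 0 (- a)" and ?f = "Moebius_function 0 a"
  define r where "r = cmod (?f b)"
  have r: "r < 1" using Moebius_function_norm_lt_1[of a b 0] a b by (simp add: r_def)
  have na: "cmod a < 1" "cmod (- a) < 1" "cmod b < 1" using a b by auto
  have hol: "?g holomorphic_on ball 0 1" using na by (intro Moebius_function_holomorphic)
  show thesis
  proof (rule that)
    have "continuous_on (cball 0 r) ?g"
      using r by (intro continuous_on_subset[OF holomorphic_on_imp_continuous_on[OF hol]]) auto
    then show "connected (?g ` cball 0 r)" by (intro connected_continuous_image) auto
    show "?g ` cball 0 r \<subseteq> ball 0 1"
      using Moebius_function_norm_lt_1[OF na(2)] r by auto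
    have "?g 0 = a" by (simp add: Moebius_function_simple)
    then show "a \<in> ?g ` cball 0 r" by (metis centre_in_cball image_eqI norm_ge_zero r_def)
    have "?g (?f b) = b" using na by (intro Moebius_function_compose) auto
    then show "b \<in> ?g ` cball 0 r" unfolding r_def by (metis dist_0_norm image_eqI mem_cball order_refl)
    fix w assume "w \<in> ?g ` cball 0 r"
    then obtain u where u: "cmod u \<le> r" "w = ?g u" by auto
    then have "?f w = u" using na r by (simp add: Moebius_function_compose)
    then show "poincare_dist a w \<le> poincare_dist a b"
      unfolding poincare_dist_Moebius using u r by (auto intro!: artanh_mono simp: r_def)
  qed
qed

definition disc_chain :: "'a cmfd \<Rightarrow> 'a \<Rightarrow> 'a \<Rightarrow> nat \<Rightarrow> (nat \<Rightarrow> complex) \<Rightarrow> (nat \<Rightarrow> complex) \<Rightarrow>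
    (nat \<Rightarrow> complex \<Rightarrow> 'a) \<Rightarrow> (nat \<Rightarrow> 'a) \<Rightarrow> bool" where
  "disc_chain M x y m a b g p \<longleftrightarrow> 0 < m \<and> p 0 = x \<and> p m = y \<and>
     (\<forall>i<m. holo_map unit_disc M (g i) \<and> a i \<in> ball 0 1 \<and> b i \<in> ball 0 1 \<and>
            g i (a i) = p i \<and> g i (b i) = p (Suc i))"

abbreviation chain_length :: "nat \<Rightarrow> (nat \<Rightarrow> complex) \<Rightarrow> (nat \<Rightarrow> complex) \<Rightarrow> real" where
  "chain_length m a b \<equiv> \<Sum>i<m. poincare_dist (a i) (b i)"

definition reach :: "'a cmfd \<Rightarrow> 'a \<Rightarrow> 'a \<Rightarrow> real \<Rightarrow> bool" where
  "reach M x y s \<longleftrightarrow> (\<exists>m a b g p. s = chain_length m a b \<and> disc_chain M x y m a b g p)"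

lemma kobayashi_eq_Inf:
  "x \<in> carrier_of M \<Longrightarrow> y \<in> carrier_of M \<Longrightarrow> kobayashi M x y = Inf {s. reach M x y s}"
  unfolding kobayashi_def reach_def disc_chain_def by simp

lemma reach_nonneg: "reach M x y s \<Longrightarrow> 0 \<le> s"
  unfolding reach_def disc_chain_def by (auto intro!: sum_nonneg poincare_dist_nonneg)

lemma kobayashi_le: 
  assumes "x \<in> carrier_of M" "y \<in> carrier_of M" "reach M x y s"
  shows "kobayashi M x y \<le> s"
  unfolding kobayashi_eq_Inf[OF assms(1,2)]
proof (rule cInf_lower)
  show "bdd_below {s. reach M x y s}" by (rule bdd_belowI[of _ 0]) (simp add: reach_nonneg)
qed (use assms in simp)

lemma reach_single:
  assumes "holo_map unit_disc M g" "a \<in> ball 0 1" "b \<in> ball 0 1"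
  shows "reach M (g a) (g b) (poincare_dist a b)"
  unfolding reach_def disc_chain_def
  by (rule exI[of _ 1], rule exI[of _ "\<lambda>_. a"], rule exI[of _ "\<lambda>_. b"], rule exI[of _ "\<lambda>_. g"],
      rule exI[of _ "\<lambda>i. if i = 0 then g a else g b"]) (use assms in auto)

text \<open>The chain is cut off inside its disc number i, at the parameter w. This bounds the
  distance from x to every point that the chain passes through.\<close>

lemma disc_chain_prefix:
  assumes c: "disc_chain M x y m a b g p" and "i < m" "w \<in> ball 0 1"
  shows "reach M x (g i w) ((\<Sum>l<i. poincare_dist (a l) (b l)) + poincare_dist (a i) w)"
proof -
  have "disc_chain M x (g i w) (Suc i) a (b(i := w)) g (p(Suc i := g i w))"
    using assms unfolding disc_chain_def by (auto simp: less_Suc_eq)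
  moreover have "chain_length (Suc i) a (b(i := w)) = (\<Sum>l<i. poincare_dist (a l) (b l)) + poincare_dist (a i) w"
    by simp
  ultimately show ?thesis unfolding reach_def by metis
qed

lemma reach_extend:
  assumes r: "reach M x y s" and h: "holo_map unit_disc M h" "u \<in> ball 0 1" "w \<in> ball 0 1" "h u = y"
  shows "reach M x (h w) (s + poincare_dist u w)"
proof -
  obtain m a b g p where s: "s = chain_length m a b" and c: "disc_chain M x y m a b g p"
    using r unfolding reach_def by blast
  have "disc_chain M x (h w) (Suc m) (a(m := u)) (b(m := w)) (g(m := h)) (p(Suc m := h w))"
    using c h unfolding disc_chain_def by (auto simp: less_Suc_eq)
  moreover have "s + poincare_dist u w = chain_length (Suc m) (a(m := u)) (b(m := w))"
    by (simp add: s)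
  ultimately show ?thesis unfolding reach_def by blast
qed

lemma reach_holo:
  assumes "premfd M" "premfd N" "holo_map M N f" "reach M x y s"
  shows "reach N (f x) (f y) s"
proof -
  obtain m a b g p where s: "s = chain_length m a b" and c: "disc_chain M x y m a b g p"
    using assms(4) unfolding reach_def by blast
  have "disc_chain N (f x) (f y) m a b (\<lambda>i z. f (g i z)) (\<lambda>i. f (p i))"
    using c holo_map_comp[OF premfd_unit_disc assms(1-2) _ assms(3)] unfolding disc_chain_def by auto
  with s show ?thesis unfolding reach_def by blast
qed

lemma local_discs:
  assumes M: "premfd M" and x: "x \<in> carrier_of M"
  obtains W where "openin (mfd_top M) W" "x \<in> W"
    "\<And>y y'. y \<in> W \<Longrightarrow> y' \<in> W \<Longrightarrow> \<exists>g. holo_map unit_disc M g \<and> g 0 = y \<and> g (1/2) = y'"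
proof -
  let ?n = "mfd_dim M"
  obtain U \<phi> where U: "(U, \<phi>) \<in> mfd_atlas M" "x \<in> U" using chart_exists[OF M x] by blast
  obtain \<delta> where \<delta>: "\<delta> > 0" "\<And>z. z \<in> cvec ?n \<Longrightarrow> vnorm ?n (z - \<phi> x) < \<delta> \<Longrightarrow> z \<in> \<phi> ` U"
    using chart_nbhd[OF M U chart_open[OF M U(1)] U(2)] by metis
  \<comment> \<open>The disc from y through y' at parameter 1/2 sweeps out twice the difference of
    the coordinates, at most 4 \<open>\<delta>\<close> / 5, and starts within
    \<open>\<delta>\<close> / 5 of the centre.\<close>
  define W where "W = {y \<in> U. vnorm ?n (\<phi> y - \<phi> x) < \<delta> / 5}"
  show thesis
  proof (rule that)
    show "openin (mfd_top M) W" unfolding W_def by (rule chart_nbhd_cont[OF M U(1)])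
    show "x \<in> W" using U \<delta> by (simp add: W_def)
    fix y y' assume y: "y \<in> W" "y' \<in> W"
    let ?v = "vscale 2 (\<phi> y' - \<phi> y)"
    have c: "\<phi> y \<in> cvec ?n" "\<phi> y' \<in> cvec ?n" using y chart_cvec[OF M U(1)] by (auto simp: W_def)
    have "\<phi> y + vscale \<zeta> ?v \<in> \<phi> ` U" if "cmod \<zeta> < 1" for \<zeta>
    proof (rule \<delta>(2))
      have "vnorm ?n (\<phi> y + vscale \<zeta> ?v - \<phi> x) = vnorm ?n ((\<phi> y - \<phi> x) + vscale \<zeta> ?v)"
        by (simp add: algebra_simps)
      also have "\<dots> \<le> vnorm ?n (\<phi> y - \<phi> x) + cmod \<zeta> * (2 * vnorm ?n (\<phi> y' - \<phi> y))"
        using vnorm_triangle[of ?n "\<phi> y - \<phi> x" "vscale \<zeta> ?v"] by simp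
      also have "\<dots> \<le> vnorm ?n (\<phi> y - \<phi> x) + 1 * (2 * vnorm ?n (\<phi> y' - \<phi> y))"
        using that by (intro add_mono mult_right_mono) auto
      also have "vnorm ?n (\<phi> y' - \<phi> y) \<le> vnorm ?n (\<phi> y' - \<phi> x) + vnorm ?n (\<phi> y - \<phi> x)"
        using vnorm_dist_triangle[of ?n "\<phi> y'" "\<phi> y" "\<phi> x"] vnorm_minus_commute[of ?n "\<phi> x" "\<phi> y"] by simp
      finally show "vnorm ?n (\<phi> y + vscale \<zeta> ?v - \<phi> x) < \<delta>" using y \<delta> by (simp add: W_def)
    qed (use c in auto)
    from holo_map_unit_disc_affine[OF M U(1) this]
    have h: "holo_map unit_disc M (\<lambda>\<zeta>. inv_into U \<phi> (\<phi> y + vscale \<zeta> ?v))"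
      using c by simp
    have "\<phi> y + vscale (1/2) ?v = \<phi> y'" by (simp add: vscale_algebra(5))
    then show "\<exists>g. holo_map unit_disc M g \<and> g 0 = y \<and> g (1/2) = y'"
      using h chart_inv[OF M U(1)] y by (intro exI[of _ "\<lambda>\<zeta>. inv_into U \<phi> (\<phi> y + vscale \<zeta> ?v)"]) (auto simp: W_def)
  qed
qed

text \<open>The reachable set is clopen: by \<open>local_discs\<close> a small neighbourhood is
  reached entirely or not at all. Hence the infimum defining \<open>kobayashi\<close> is over a
  nonempty set.\<close>

lemma reach_exists:
  assumes "complex_manifold M" and x: "x \<in> carrier_of M" and y: "y \<in> carrier_of M"
  shows "\<exists>s. reach M x y s"
proof -
  have M: "premfd M" and con: "connected_space (mfd_top M)"
    using assms premfd_complex_manifold unfolding complex_manifold_def by blast+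
  define A where "A = {y \<in> carrier_of M. \<exists>s. reach M x y s}"
  have half: "(0::complex) \<in> ball 0 1" "(1/2::complex) \<in> ball 0 1" by (auto simp: norm_divide)
  have step: "\<exists>W. openin (mfd_top M) W \<and> z \<in> W \<and> (\<forall>y\<in>W. \<forall>y'\<in>W. y \<in> A \<longrightarrow> y' \<in> A)" if z: "z \<in> carrier_of M" for z
  proof -
    obtain W where W: "openin (mfd_top M) W" "z \<in> W"
      "\<And>y y'. y \<in> W \<Longrightarrow> y' \<in> W \<Longrightarrow> \<exists>g. holo_map unit_disc M g \<and> g 0 = y \<and> g (1/2) = y'"
      using local_discs[OF M z] by metis
    have "y' \<in> A" if y: "y \<in> W" "y' \<in> W" "y \<in> A" for y y'
    proof -
      obtain s where s: "reach M x y s" using y unfolding A_def by blast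
      obtain g where g: "holo_map unit_disc M g" "g 0 = y" "g (1/2) = y'" using W(3) y by blast
      have "y' \<in> carrier_of M" using openin_subset[OF W(1)] y by blast
      then show ?thesis using reach_extend[OF s g(1) half g(2)] g(3) unfolding A_def by blast
    qed
    with W show ?thesis by blast
  qed
  have "openin (mfd_top M) A"
  proof (subst openin_subopen, intro ballI)
    fix z assume z: "z \<in> A"
    then have "z \<in> carrier_of M" by (simp add: A_def)
    from step[OF this] z show "\<exists>T. openin (mfd_top M) T \<and> z \<in> T \<and> T \<subseteq> A" by blast
  qed
  moreover have "openin (mfd_top M) (carrier_of M - A)"
  proof (subst openin_subopen, intro ballI)
    fix z assume z: "z \<in> carrier_of M - A"
    then obtain W where W: "openin (mfd_top M) W" "z \<in> W" "\<forall>y\<in>W. \<forall>y'\<in>W. y \<in> A \<longrightarrow> y' \<in> A"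
      using step by blast
    then have "W \<subseteq> carrier_of M - A" using openin_subset[OF W(1)] z by blast
    with W show "\<exists>T. openin (mfd_top M) T \<and> z \<in> T \<and> T \<subseteq> carrier_of M - A" by blast
  qed
  ultimately have "A = {} \<or> A = carrier_of M"
    using con unfolding connected_space_clopen_in closedin_def by (auto simp: A_def)
  moreover have "x \<in> A"
  proof -
    obtain W where W: "x \<in> W" 
      "\<And>y y'. y \<in> W \<Longrightarrow> y' \<in> W \<Longrightarrow> \<exists>g. holo_map unit_disc M g \<and> g 0 = y \<and> g (1/2) = y'"
      using local_discs[OF M x] by metis
    then obtain g where "holo_map unit_disc M g" "g 0 = x" "g (1/2) = x" by blast
    then show ?thesis using reach_single[of M g 0 "1/2"] half x unfolding A_def by auto
  qed
  ultimately show ?thesis using y unfolding A_def by blast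
qed

lemma kobayashi_lessD:
  assumes "complex_manifold M" "x \<in> carrier_of M" "y \<in> carrier_of M" "kobayashi M x y < e"
  obtains s where "reach M x y s" "s < e"
proof -
  have "{s. reach M x y s} \<noteq> {}" using reach_exists[OF assms(1-3)] by blast
  then show thesis
    using cInf_lessD[of "{s. reach M x y s}" e] assms(4) that
    unfolding kobayashi_eq_Inf[OF assms(2,3)] by blast
qed

text \<open>Composing every disc of a chain with f gives a chain of the same length.\<close>

lemma kobayashi_contract:
  assumes M: "complex_manifold M" and N: "premfd N" and f: "holo_map M N f"
    and x: "x \<in> carrier_of M" and y: "y \<in> carrier_of M"
  shows "kobayashi N (f x) (f y) \<le> kobayashi M x y"
proof (rule field_le_epsilon)
  fix e :: real assume "e > 0"
  then obtain s where s: "reach M x y s" "s < kobayashi M x y + e"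
    using kobayashi_lessD[OF M x y, of "kobayashi M x y + e"] by auto
  have "kobayashi N (f x) (f y) \<le> s"
    by (rule kobayashi_le[OF _ _ reach_holo[OF premfd_complex_manifold[OF M] N f s(1)]])
      (use holo_map_carrier[OF f] x y in auto)
  with s show "kobayashi N (f x) (f y) \<le> kobayashi M x y + e" by simp
qed

text \<open>The easy half of the comparison of topologies: Kobayashi balls contain chart balls. The
  converse, \<open>d_ball_subset\<close>, is where hyperbolicity enters.\<close>

lemma kobayashi_small:
  assumes M: "premfd M" and x: "x \<in> carrier_of M" and e: "e > 0"
  obtains W where "openin (mfd_top M) W" "x \<in> W" "\<And>y. y \<in> W \<Longrightarrow> kobayashi M x y < e"
proof -
  let ?n = "mfd_dim M"
  obtain U \<phi> where U: "(U, \<phi>) \<in> mfd_atlas M" "x \<in> U" using chart_exists[OF M x] by blast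
  obtain \<delta> where \<delta>: "\<delta> > 0" "\<And>z. z \<in> cvec ?n \<Longrightarrow> vnorm ?n (z - \<phi> x) < \<delta> \<Longrightarrow> z \<in> \<phi> ` U"
    using chart_nbhd[OF M U chart_open[OF M U(1)] U(2)] by metis
  \<comment> \<open>The point at parameter t of an affine disc has Poincare distance artanh t = e /
    2 from the centre; discs of chart radius \<open>\<delta>\<close> thus reach the whole chart ball
    of radius t \<open>\<delta>\<close>.\<close>
  define t where "t = tanh (e / 2)"
  have t: "0 < t" "t < 1" "artanh t < e"
    using e by (auto simp: t_def tanh_real_lt_1 artanh_tanh_real)
  define W where "W = {y \<in> U. vnorm ?n (\<phi> y - \<phi> x) < t * \<delta>}"
  show thesis
  proof (rule that)
    show W: "openin (mfd_top M) W" unfolding W_def by (rule chart_nbhd_cont[OF M U(1)])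
    show "x \<in> W" using U \<delta> t by (simp add: W_def)
    fix y assume y: "y \<in> W"
    let ?v = "vscale (1 / of_real t) (\<phi> y - \<phi> x)"
    have c: "\<phi> y \<in> cvec ?n" "\<phi> x \<in> cvec ?n" using y U chart_cvec[OF M U(1)] by (auto simp: W_def)
    have "\<phi> x + vscale \<zeta> ?v \<in> \<phi> ` U" if "cmod \<zeta> < 1" for \<zeta>
    proof (rule \<delta>(2))
      have "vnorm ?n (\<phi> x + vscale \<zeta> ?v - \<phi> x) = cmod \<zeta> * (vnorm ?n (\<phi> y - \<phi> x) / t)"
        using t by (simp add: norm_divide)
      also have "\<dots> \<le> 1 * (vnorm ?n (\<phi> y - \<phi> x) / t)"
        using that t by (intro mult_right_mono) auto
      also have "\<dots> < \<delta>" using y t by (simp add: W_def field_simps)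
      finally show "vnorm ?n (\<phi> x + vscale \<zeta> ?v - \<phi> x) < \<delta>" .
    qed (use c in auto)
    from holo_map_unit_disc_affine[OF M U(1) this]
    have h: "holo_map unit_disc M (\<lambda>\<zeta>. inv_into U \<phi> (\<phi> x + vscale \<zeta> ?v))"
      using c by simp
    have "\<phi> x + vscale (of_real t) ?v = \<phi> y" using t by (simp add: vscale_algebra(5))
    then have "reach M x y (poincare_dist 0 (of_real t))"
      using reach_single[OF h, of 0 "of_real t"] t chart_inv[OF M U(1)] U(2) y by (simp add: W_def)
    moreover have "poincare_dist 0 (of_real t) = artanh t" using t by (simp add: poincare_dist_def)
    ultimately have "kobayashi M x y \<le> artanh t"
      using kobayashi_le[OF x, of y "artanh t"] openin_subset[OF W] y by auto
    with t show "kobayashi M x y < e" by simp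
  qed
qed

lemma chart_compactin:
  assumes M: "premfd M" and U: "(U, \<phi>) \<in> mfd_atlas M"
    and C: "compactin (complex_space (mfd_dim M)) C" "C \<subseteq> \<phi> ` U"
  shows "compactin (mfd_top M) (inv_into U \<phi> ` C)"
proof -
  let ?S = "subtopology (complex_space (mfd_dim M)) (\<phi> ` U)"
  obtain g where g: "homeomorphic_maps (subtopology (mfd_top M) U) ?S \<phi> g"
    using chart_homeo[OF M U] homeomorphic_map_maps by blast
  have "inv_into U \<phi> z = g z" if z: "z \<in> C" for z
  proof -
    obtain y where y: "y \<in> U" "z = \<phi> y" using C(2) z by auto
    then have "g (\<phi> y) = y" using g chart_subset[OF M U] unfolding homeomorphic_maps_def by auto
    then show ?thesis using y chart_inv[OF M U] by simp
  qed
  then have eq: "inv_into U \<phi> ` C = g ` C" by auto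
  have "compactin ?S C" using C by (simp add: compactin_subtopology)
  then have "compactin (subtopology (mfd_top M) U) (g ` C)"
    using g image_compactin unfolding homeomorphic_maps_def by blast
  then show ?thesis unfolding eq by (simp add: compactin_subtopology)
qed

section \<open>The Kobayashi distance induces the manifold topology\<close>

subsection \<open>Hyperbolic manifolds\<close>

locale hyperbolic_manifold =
  fixes X :: "'a cmfd"
  assumes cm: "complex_manifold X" and hyp: "kobayashi_hyperbolic X"
begin

abbreviation "S \<equiv> carrier_of X"
abbreviation "T \<equiv> mfd_top X"
abbreviation "d \<equiv> kobayashi X"

lemma pre: "premfd X" by (rule premfd_complex_manifold[OF cm])

lemma Haus: "Hausdorff_space T" using cm by (simp add: complex_manifold_def)

lemma con: "connected_space T" using cm by (simp add: complex_manifold_def)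

lemma metric: "Metric_space S d" using hyp by (simp add: kobayashi_hyperbolic_def)

lemma d_nonneg [simp]: "0 \<le> d x y" using metric by (simp add: Metric_space_def)

lemma d_commute: "d x y = d y x" using metric by (simp add: Metric_space_def)

lemma d_zero: "x \<in> S \<Longrightarrow> y \<in> S \<Longrightarrow> d x y = 0 \<longleftrightarrow> x = y" using metric by (simp add: Metric_space_def)

lemma d_triangle: "x \<in> S \<Longrightarrow> y \<in> S \<Longrightarrow> z \<in> S \<Longrightarrow> d x z \<le> d x y + d y z"
  using metric by (simp add: Metric_space_def)

lemma d_contract: "holo_map X X f \<Longrightarrow> x \<in> S \<Longrightarrow> y \<in> S \<Longrightarrow> d (f x) (f y) \<le> d x y"
  by (rule kobayashi_contract[OF cm pre])

lemma openin_d_ball: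
  assumes x: "x \<in> S"
  shows "openin T {y \<in> S. d x y < e}"
proof (subst openin_subopen, intro ballI)
  fix y assume y: "y \<in> {y \<in> S. d x y < e}"
  then obtain W where W: "openin T W" "y \<in> W" "\<And>z. z \<in> W \<Longrightarrow> d y z < e - d x y"
    using kobayashi_small[OF pre, of y "e - d x y"] by auto
  have "W \<subseteq> {y \<in> S. d x y < e}"
  proof
    fix z assume z: "z \<in> W"
    then have "z \<in> S" using openin_subset[OF W(1)] by blast
    then show "z \<in> {y \<in> S. d x y < e}" using d_triangle[OF x _ \<open>z \<in> S\<close>, of y] y W(3)[OF z] by auto
  qed
  with W show "\<exists>W. openin T W \<and> y \<in> W \<and> W \<subseteq> {y \<in> S. d x y < e}" by blast
qed

lemma continuous_d:
  assumes x: "x \<in> S"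
  shows "continuous_map T euclideanreal (d x)"
  unfolding continuous_map_iff_tcont
proof (intro ballI conjI)
  fix y assume y: "y \<in> S"
  show "tcont T euclideanreal (d x) y"
    unfolding tcont_def
  proof (intro allI impI)
    fix W :: "real set" assume "openin euclideanreal W \<and> d x y \<in> W"
    then obtain e where e: "e > 0" "ball (d x y) e \<subseteq> W"
      using open_openin[of W] by (metis openE)
    have "d x z \<in> W" if z: "z \<in> S" "d y z < e" for z
    proof -
      have "\<bar>d x y - d x z\<bar> < e"
        using d_triangle[OF x y z(1)] d_triangle[OF x z(1) y] d_commute[of y z] z by linarith
      then have "d x z \<in> ball (d x y) e" by (simp add: dist_real_def)
      then show ?thesis using e by blast
    qed
    then have "d x ` {z \<in> S. d y z < e} \<subseteq> W" by blast
    moreover have "y \<in> {z \<in> S. d y z < e}" using y e d_zero[OF y y] by simp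
    ultimately show "\<exists>V. openin T V \<and> y \<in> V \<and> d x ` V \<subseteq> W" using openin_d_ball[OF y, of e] by blast
  qed
qed simp

lemma compact_d_away:
  assumes x: "x \<in> S" and C: "compactin T C" "x \<notin> C"
  obtains e where "e > 0" "\<And>y. y \<in> C \<Longrightarrow> e \<le> d x y"
proof (cases "C = {}")
  case True
  then show thesis using that[of 1] by auto
next
  case False
  have "compact (d x ` C)"
    using image_compactin[OF C(1) continuous_d[OF x]] by simp
  then obtain y where y: "y \<in> C" "\<And>z. z \<in> C \<Longrightarrow> d x y \<le> d x z"
    using compact_attains_inf[of "d x ` C"] False by auto
  have "y \<in> S" using compactin_subset_topspace[OF C(1)] y by blast
  then have "d x y > 0" using d_zero[OF x \<open>y \<in> S\<close>] y C(2) d_nonneg[of x y] by (metis less_eq_real_def)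
  then show thesis using that y by blast
qed

(* A chain of discs shorter than the distance from x to a coordinate sphere around x cannot
   cross that sphere, since every disc of the chain can be cut off at any intermediate point. *)
theorem d_ball_subset:
  assumes W: "openin T W" "x \<in> W"
  obtains e where "e > 0" "\<And>y. y \<in> S \<Longrightarrow> d x y < e \<Longrightarrow> y \<in> W"
    "\<exists>C. compactin T C \<and> {y \<in> S. d x y < e} \<subseteq> C"
proof -
  let ?n = "mfd_dim X"
  have x: "x \<in> S" using openin_subset[OF W(1)] W(2) by blast
  obtain U \<phi> where U: "(U, \<phi>) \<in> mfd_atlas X" "x \<in> U" using chart_exists[OF pre x] by blast
  have xc: "\<phi> x \<in> cvec ?n" by (rule chart_cvec[OF pre U])
  obtain \<delta> where \<delta>: "\<delta> > 0" "\<And>z. z \<in> cvec ?n \<Longrightarrow> vnorm ?n (z - \<phi> x) < \<delta> \<Longrightarrow>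
      z \<in> \<phi> ` U \<and> inv_into U \<phi> z \<in> W \<and> inv_into U \<phi> z \<in> U \<and> \<phi> (inv_into U \<phi> z) = z"
    using chart_nbhd[OF pre U W] by metis
  \<comment> \<open>Half of \<open>\<delta>\<close>, so that the closed coordinate ball of radius r
    still lies in the image of the chart and K is compact.\<close>
  define r where "r = \<delta> / 2"
  have r: "0 < r" "r < \<delta>" using \<delta>(1) by (auto simp: r_def)
  define B where "B = {y \<in> U. vnorm ?n (\<phi> y - \<phi> x) < r}"
  define CB where "CB = {z \<in> cvec ?n. vnorm ?n (z - \<phi> x) \<le> r}"
  define K where "K = inv_into U \<phi> ` CB"
  have CBU: "CB \<subseteq> \<phi> ` U" using \<delta>(2) r unfolding CB_def by force
  have Kc: "compactin T K"
    unfolding K_def by (rule chart_compactin[OF pre U(1) _ CBU]) (simp add: CB_def compactin_cball_cvec[OF xc])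
  have BK: "B \<subseteq> K"
  proof
    fix y assume y: "y \<in> B"
    then have "\<phi> y \<in> CB" using chart_cvec[OF pre U(1)] by (auto simp: B_def CB_def)
    then show "y \<in> K" unfolding K_def using chart_inv[OF pre U(1), of y] y by (force simp: B_def)
  qed
  have Bo: "openin T B" unfolding B_def by (rule chart_nbhd_cont[OF pre U(1)])
  have BW: "B \<subseteq> W"
  proof
    fix y assume y: "y \<in> B"
    then have "y \<in> U" by (simp add: B_def)
    then have "inv_into U \<phi> (\<phi> y) \<in> W"
      using \<delta>(2)[of "\<phi> y"] chart_cvec[OF pre U(1)] y r by (auto simp: B_def)
    then show "y \<in> W" using chart_inv[OF pre U(1) \<open>y \<in> U\<close>] by simp
  qed
  have Ko: "openin T (S - K)"
    using compactin_imp_closedin[OF Haus Kc] by (simp add: closedin_def)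
  have "compactin T (K - B)"
    using closed_compactin[OF Kc, of "K - B"] closedin_diff[OF compactin_imp_closedin[OF Haus Kc] Bo] by blast
  moreover have xB: "x \<in> B" using U r by (simp add: B_def)
  ultimately obtain e where e: "e > 0" "\<And>y. y \<in> K - B \<Longrightarrow> e \<le> d x y"
    using compact_d_away[OF x, of "K - B"] by blast
  have main: "y \<in> B" if y: "y \<in> S" "d x y < e" for y
  proof -
    obtain s where s: "reach X x y s" "s < e" using kobayashi_lessD[OF cm x y] by blast
    then obtain m a b g p where sl: "s = chain_length m a b" and c: "disc_chain X x y m a b g p"
      unfolding reach_def by blast
    have ab: "a i \<in> ball 0 1" "b i \<in> ball 0 1" "holo_map unit_disc X (g i)" "g i (a i) = p i"
      "g i (b i) = p (Suc i)" if "i < m" for i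
      using c that unfolding disc_chain_def by auto
    have "i \<le> m \<Longrightarrow> p i \<in> B" for i
    proof (induction i)
      case 0
      then show ?case using c xB by (simp add: disc_chain_def)
    next
      case (Suc i)
      then have i: "i < m" and pB: "p i \<in> B" by auto
      obtain A where A: "connected A" "A \<subseteq> ball 0 1" "a i \<in> A" "b i \<in> A"
        "\<And>w. w \<in> A \<Longrightarrow> poincare_dist (a i) w \<le> poincare_dist (a i) (b i)"
        using poincare_disc_connected[OF ab(1,2)[OF i]] by metis
      have cont: "continuous_map (top_of_set (ball 0 1)) T (g i)"
        using ab(3)[OF i] by (simp add: holo_map_def)
      have gS: "g i w \<in> S" if "w \<in> ball 0 1" for w
        using holo_map_carrier[OF ab(3)[OF i], of w] that by simp
      have notin: "g i w \<notin> K - B" if w: "w \<in> A" for w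
      proof
        assume "g i w \<in> K - B"
        then have "e \<le> d x (g i w)" by (rule e(2))
        also have "\<dots> \<le> (\<Sum>l<i. poincare_dist (a l) (b l)) + poincare_dist (a i) w"
          using A(2) w by (intro kobayashi_le[OF x gS] disc_chain_prefix[OF c i]) auto
        also have "\<dots> \<le> (\<Sum>l<Suc i. poincare_dist (a l) (b l))" using A(5)[OF w] by simp
        also have "\<dots> \<le> s"
          unfolding sl using i ab by (intro sum_mono2) (auto intro!: poincare_dist_nonneg)
        finally show False using s by simp
      qed
      have o: "open {w \<in> ball 0 1. g i w \<in> V}" if "openin T V" for V
      proof -
        have "openin (top_of_set (ball 0 1)) {w \<in> ball 0 1. g i w \<in> V}"
          using openin_continuous_map_preimage[OF cont that] by simp
        then show ?thesis using openin_open_trans by blast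
      qed
      have "{w \<in> ball 0 1. g i w \<in> B} \<inter> A = {} \<or> {w \<in> ball 0 1. g i w \<in> S - K} \<inter> A = {}"
      proof (rule connectedD[OF A(1) o[OF Bo] o[OF Ko]])
        show "{w \<in> ball 0 1. g i w \<in> B} \<inter> {w \<in> ball 0 1. g i w \<in> S - K} \<inter> A = {}" using BK by blast
        show "A \<subseteq> {w \<in> ball 0 1. g i w \<in> B} \<union> {w \<in> ball 0 1. g i w \<in> S - K}"
          using A(2) notin gS by blast
      qed
      moreover have "a i \<in> {w \<in> ball 0 1. g i w \<in> B} \<inter> A"
        using A pB ab(4)[OF i] by auto
      ultimately have "g i (b i) \<notin> S - K" using A by blast
      moreover have "g i (b i) \<in> S" using gS ab(2)[OF i] by blast
      ultimately show ?case using notin[OF A(4)] ab(5)[OF i] by auto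
    qed
    from this[of m] show "y \<in> B" using c by (simp add: disc_chain_def)
  qed
  show thesis
  proof (rule that[OF e(1)])
    show "y \<in> W" if "y \<in> S" "d x y < e" for y using main[OF that] BW by blast
    show "\<exists>C. compactin T C \<and> {y \<in> S. d x y < e} \<subseteq> C" using Kc main BK by blast
  qed
qed

end

section \<open>Montel's theorem and limits of renormalised iterates\<close>

section \<open>Normal families on cocompact hyperbolic manifolds\<close>

lemma cdiffI: "has_cderiv n f p a \<Longrightarrow> cdiff n f p"
  unfolding cdiff_def by blast

lemma automorphism_holo: "automorphism M g \<Longrightarrow> holo_map M M g"
  by (simp add: automorphism_def)

lemma automorphism_id: "premfd M \<Longrightarrow> automorphism M (\<lambda>x. x)"
  unfolding automorphism_def using holo_map_id by blast

lemma automorphism_comp: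
  assumes M: "premfd M" and g: "automorphism M g" and h: "automorphism M h"
  shows "automorphism M (\<lambda>x. g (h x))"
proof -
  obtain g' h' where g': "holo_map M M g'" "\<And>x. x \<in> carrier_of M \<Longrightarrow> g' (g x) = x \<and> g (g' x) = x"
    and h': "holo_map M M h'" "\<And>x. x \<in> carrier_of M \<Longrightarrow> h' (h x) = x \<and> h (h' x) = x"
    using g h unfolding automorphism_def by blast
  have "holo_map M M (\<lambda>x. g (h x))" "holo_map M M (\<lambda>x. h' (g' x))"
    using holo_map_comp[OF M M M] automorphism_holo[OF g] automorphism_holo[OF h] g'(1) h'(1) by blast+
  moreover have "h' (g' (g (h x))) = x \<and> g (h (h' (g' x))) = x" if "x \<in> carrier_of M" for x
    using g' h' that holo_map_carrier[OF g'(1)] holo_map_carrier[OF automorphism_holo[OF h]] by simp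
  ultimately show ?thesis unfolding automorphism_def by blast
qed

lemma automorphism_inverse:
  assumes "automorphism M g"
  obtains g' where "automorphism M g'" "\<And>x. x \<in> carrier_of M \<Longrightarrow> g' (g x) = x"
    "\<And>x. x \<in> carrier_of M \<Longrightarrow> g (g' x) = x"
  using assms unfolding automorphism_def by metis

text \<open>A is the union of the preimages of B under all automorphisms, hence open and a union of
  orbits; so its image in the orbit space is open and determines it.\<close>

lemma openin_aut_saturation:
  assumes M: "premfd M" and B: "openin (mfd_top M) B"
  defines "A \<equiv> {y \<in> carrier_of M. \<exists>g. automorphism M g \<and> g y \<in> B}"
  shows "openin (orbit_space M) (aut_orbit M ` A)"
    and "\<And>y. y \<in> carrier_of M \<Longrightarrow> aut_orbit M y \<in> aut_orbit M ` A \<Longrightarrow> y \<in> A"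
proof -
  show sat: "y \<in> A" if y: "y \<in> carrier_of M" "aut_orbit M y \<in> aut_orbit M ` A" for y
  proof -
    obtain z where z: "z \<in> A" "aut_orbit M y = aut_orbit M z" using y by blast
    have "y \<in> aut_orbit M y" unfolding aut_orbit_def using automorphism_id[OF M] by force
    then have "y \<in> aut_orbit M z" using z(2) by simp
    then obtain h where h: "automorphism M h" "y = h z" by (auto simp: aut_orbit_def)
    have "z \<in> carrier_of M" using z(1) unfolding A_def by blast
    with h(1) obtain h' where h': "automorphism M h'" "h' (h z) = z"
      unfolding automorphism_def by metis
    obtain g where g: "automorphism M g" "g z \<in> B" using z(1) by (auto simp: A_def)
    have "g (h' y) \<in> B" using g h h' by simp
    then show ?thesis using automorphism_comp[OF M g(1) h'(1)] y unfolding A_def by blast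
  qed
  have "A = (\<Union>g\<in>{g. automorphism M g}. {y \<in> carrier_of M. g y \<in> B})"
    unfolding A_def by blast
  moreover have "openin (mfd_top M) {y \<in> carrier_of M. g y \<in> B}" if "automorphism M g" for g
    using automorphism_holo[OF that] B unfolding holo_map_def
    by (intro openin_continuous_map_preimage) auto
  ultimately have "openin (mfd_top M) A" by (auto intro: openin_Union)
  moreover have "{x \<in> carrier_of M. aut_orbit M x \<in> aut_orbit M ` A} = A"
    using sat unfolding A_def by blast
  moreover have "aut_orbit M ` A \<subseteq> aut_orbit M ` carrier_of M" unfolding A_def by blast
  ultimately show "openin (orbit_space M) (aut_orbit M ` A)" by (simp add: openin_orbit_space)
qed

lemma topspace_orbit_space: "topspace (orbit_space M) = aut_orbit M ` carrier_of M"
  using quotient_imp_surjective_map[OF quotient_map_orbit_space] by metis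

context hyperbolic_manifold
begin

lemma d_ball_nbhd: "openin T W \<Longrightarrow> x \<in> W \<Longrightarrow> \<exists>e>0. \<forall>y\<in>S. d x y < e \<longrightarrow> y \<in> W"
  using d_ball_subset by metis

text \<open>Finitely many relatively compact balls meet every orbit. Their compact hulls form K; and
  since automorphisms do not increase distances, a radius that works near the finitely many centres
  works at every point of X.\<close>

lemma cocompact_radius:
  assumes "cocompact X"
  obtains r K where "r > 0" "\<And>x. x \<in> S \<Longrightarrow> \<exists>C. compactin T C \<and> {y \<in> S. d x y < r} \<subseteq> C"
    "compactin T K" "\<And>x. x \<in> S \<Longrightarrow> \<exists>g. automorphism X g \<and> g x \<in> K"
proof -
  have "\<exists>e C. e > 0 \<and> compactin T C \<and> {y \<in> S. d x y < e} \<subseteq> C" if "x \<in> S" for x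
    using d_ball_subset[of S x] that by (metis openin_topspace)
  then obtain e C where e: "\<And>x. x \<in> S \<Longrightarrow> e x > 0" and C: "\<And>x. x \<in> S \<Longrightarrow> compactin T (C x)"
    and eC: "\<And>x. x \<in> S \<Longrightarrow> {y \<in> S. d x y < e x} \<subseteq> C x" by metis
  define B where "B x = {y \<in> S. d x y < e x / 2}" for x
  define A where "A x = {y \<in> S. \<exists>g. automorphism X g \<and> g y \<in> B x}" for x
  have Bo: "openin T (B x)" if "x \<in> S" for x unfolding B_def by (rule openin_d_ball[OF that])
  have xA: "x \<in> A x" if x: "x \<in> S" for x
    using automorphism_id[OF pre] e[OF x] d_zero[OF x x] x unfolding A_def B_def by auto
  let ?V = "\<lambda>x. aut_orbit X ` A x"
  have "\<forall>V\<in>?V ` S. openin (orbit_space X) V"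
    using openin_aut_saturation(1)[OF pre Bo] unfolding A_def by blast
  moreover have "\<Union>(?V ` S) = topspace (orbit_space X)"
    unfolding topspace_orbit_space
  proof (intro equalityI subsetI)
    fix o' assume "o' \<in> \<Union>(?V ` S)"
    then show "o' \<in> aut_orbit X ` S" by (auto simp: A_def)
  next
    fix o' assume "o' \<in> aut_orbit X ` S"
    then obtain x where "x \<in> S" "o' = aut_orbit X x" by (rule imageE)
    with xA[of x] show "o' \<in> \<Union>(?V ` S)" by (intro UnionI[of "?V x"] imageI) auto
  qed
  ultimately obtain \<F> where F: "finite \<F>" "\<F> \<subseteq> ?V ` S" "\<Union>\<F> = topspace (orbit_space X)"
    using assms unfolding cocompact_def compact_space by metis
  then obtain I where I: "I \<subseteq> S" "finite I" "\<F> = ?V ` I" by (metis finite_subset_image)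
  have cover: "\<exists>x\<in>I. y \<in> A x" if y: "y \<in> S" for y
  proof -
    have "aut_orbit X y \<in> \<Union>(?V ` I)" using F(3) y unfolding I(3) topspace_orbit_space by blast
    then obtain x where x: "x \<in> I" "aut_orbit X y \<in> ?V x" by blast
    have "y \<in> A x"
      using openin_aut_saturation(2)[OF pre Bo, of x y] x I(1) y unfolding A_def by blast
    with x show ?thesis by blast
  qed
  \<comment> \<open>At most half of each \<open>e x\<close>, so that the ball of radius r around a
    point of the half ball \<open>B x\<close> stays in the ball of radius \<open>e x\<close> around
    x.\<close>
  define r where "r = Min (insert 1 ((\<lambda>x. e x / 2) ` I))"
  have "r > 0" unfolding r_def using e I by auto
  moreover have "r \<le> e x / 2" if "x \<in> I" for x unfolding r_def by (rule Min_le) (use I that in auto)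
  ultimately have r: "r > 0" "\<And>x. x \<in> I \<Longrightarrow> r \<le> e x / 2" by auto
  define K where "K = \<Union>(C ` I)"
  show thesis
  proof (rule that[OF r(1)])
    show "compactin T K" unfolding K_def using C I by (intro compactin_Union) auto
    show "\<exists>g. automorphism X g \<and> g y \<in> K" if y: "y \<in> S" for y
    proof -
      obtain x g where x: "x \<in> I" "automorphism X g" "g y \<in> B x" using cover[OF y] unfolding A_def by blast
      have "x \<in> S" using x I by blast
      then have "B x \<subseteq> C x" using eC[of x] e[of x] unfolding B_def by force
      then show ?thesis using x unfolding K_def by blast
    qed
    show "\<exists>C. compactin T C \<and> {z \<in> S. d y z < r} \<subseteq> C" if y: "y \<in> S" for y
    proof -
      obtain x g where x: "x \<in> I" "automorphism X g" "g y \<in> B x" using cover[OF y] unfolding A_def by blast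
      have xS: "x \<in> S" using x I by blast
      obtain g' where g': "automorphism X g'" "\<And>x. x \<in> S \<Longrightarrow> g' (g x) = x"
        by (rule automorphism_inverse[OF x(2)]) (rule that)
      have gh: "holo_map X X g" by (rule automorphism_holo[OF x(2)])
      have "continuous_map T T g'" using automorphism_holo[OF g'(1)] by (simp add: holo_map_def)
      then have "compactin T (g' ` C x)" by (rule image_compactin[OF C[OF xS]])
      moreover have "{z \<in> S. d y z < r} \<subseteq> g' ` C x"
      proof
        fix z assume z: "z \<in> {z \<in> S. d y z < r}"
        then have gz: "g z \<in> S" "g y \<in> S" using holo_map_carrier[OF gh] y by auto
        have "d (g y) (g z) < e x / 2" using d_contract[OF gh y, of z] z r(2)[OF x(1)] by simp
        then have "d x (g z) < e x" using d_triangle[OF xS gz(2,1)] x(3) by (simp add: B_def)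
        then have "g z \<in> C x" using eC[OF xS] gz by blast
        then show "z \<in> g' ` C x" using g'(2)[of z] z by force
      qed
      ultimately show ?thesis by blast
    qed
  qed
qed

text \<open>Metric convergence, to which contractions apply directly. By
  \<open>limitin_iff_dlim\<close> it is convergence in the manifold topology, so compactness
  arguments apply as well.\<close>

definition dlim :: "'i filter \<Rightarrow> ('i \<Rightarrow> 'a) \<Rightarrow> 'a \<Rightarrow> bool" where
  "dlim U g l \<longleftrightarrow> l \<in> S \<and> eventually (\<lambda>m. g m \<in> S) U \<and> (\<forall>e>0. eventually (\<lambda>m. d l (g m) < e) U)"

lemma limitin_iff_dlim: "limitin T g l U \<longleftrightarrow> dlim U g l"
proof
  assume L: "limitin T g l U"
  then have l: "l \<in> S" by (simp add: limitin_def)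
  have ev: "\<And>W. openin T W \<Longrightarrow> l \<in> W \<Longrightarrow> eventually (\<lambda>m. g m \<in> W) U"
    using L unfolding limitin_def by blast
  have "eventually (\<lambda>m. d l (g m) < e) U" if "e > 0" for e
  proof -
    have "l \<in> {y \<in> S. d l y < e}" using l that d_zero[OF l l] by simp
    from ev[OF openin_d_ball[OF l] this] show ?thesis by eventually_elim auto
  qed
  then show "dlim U g l" using l ev[OF openin_topspace l] unfolding dlim_def by blast
next
  assume D: "dlim U g l"
  show "limitin T g l U"
    unfolding limitin_def
  proof (intro conjI allI impI)
    show "l \<in> S" using D by (simp add: dlim_def)
    fix W assume W: "openin T W \<and> l \<in> W"
    then obtain e where e: "e > 0" "\<And>y. y \<in> S \<Longrightarrow> d l y < e \<Longrightarrow> y \<in> W"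
      using d_ball_nbhd by metis
    have "eventually (\<lambda>m. g m \<in> S) U" "eventually (\<lambda>m. d l (g m) < e) U" using D e unfolding dlim_def by auto
    then show "eventually (\<lambda>m. g m \<in> W) U" by eventually_elim (use e in blast)
  qed
qed

lemma dlim_in: "dlim U g l \<Longrightarrow> l \<in> S" by (simp add: dlim_def)

lemma dlim_ev: "dlim U g l \<Longrightarrow> e > 0 \<Longrightarrow> eventually (\<lambda>m. d l (g m) < e) U"
  by (simp add: dlim_def)

lemma dlim_evS: "dlim U g l \<Longrightarrow> eventually (\<lambda>m. g m \<in> S) U"
  by (simp add: dlim_def)

lemma dlim_unique:
  assumes "U \<noteq> bot" "dlim U g l" "dlim U g l'"
  shows "l = l'"
  using assms limitin_Hausdorff_unique[of T g l U l'] Haus unfolding limitin_iff_dlim[symmetric] by blast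

lemma dlim_cong: "dlim U g l \<Longrightarrow> eventually (\<lambda>m. g m = g' m) U \<Longrightarrow> dlim U g' l"
  unfolding dlim_def by (auto elim: eventually_elim2)

lemma dlim_d:
  assumes x: "dlim U f x" and y: "dlim U g y"
  shows "((\<lambda>m. d (f m) (g m)) \<longlongrightarrow> d x y) U"
  unfolding tendsto_iff dist_real_def
proof (intro allI impI)
  fix e :: real assume "e > 0"
  then have "e / 2 > 0" by simp
  from dlim_evS[OF x] dlim_ev[OF x this] dlim_evS[OF y] dlim_ev[OF y this] show
 "eventually (\<lambda>m. \<bar>d (f m) (g m) - d x y\<bar> < e) U"
  proof eventually_elim
    case (elim m)
    note S = dlim_in[OF x] dlim_in[OF y] elim(1,3)
    show ?case
      using d_triangle[OF S(3) S(1) S(4)] d_triangle[OF S(1) S(2) S(4)]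
        d_triangle[OF S(1) S(3) S(2)] d_triangle[OF S(3) S(4) S(2)] elim(2,4)
        d_commute[of "f m" x] d_commute[of "g m" y] by linarith
  qed
qed

lemma dlim_const: "x \<in> S \<Longrightarrow> dlim U (\<lambda>m. x) x"
  unfolding dlim_def using d_zero[of x x] by simp

lemma dlim_le:
  assumes U: "U \<noteq> bot" and "dlim U f x" "dlim U g y" "eventually (\<lambda>m. d (f m) (g m) \<le> c) U"
  shows "d x y \<le> c"
  using tendsto_upperbound[OF dlim_d[OF assms(2,3)] assms(4) U] .

lemma dlim_near:
  assumes f: "dlim U f x" and g: "eventually (\<lambda>m. g m \<in> S) U"
    and le: "eventually (\<lambda>m. d (f m) (g m) \<le> b m) U" and b: "(b \<longlongrightarrow> 0) U"
  shows "dlim U g x"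
  unfolding dlim_def
proof (intro conjI allI impI)
  show "x \<in> S" by (rule dlim_in[OF f])
  show "eventually (\<lambda>m. g m \<in> S) U" by (rule g)
  fix e :: real assume e: "e > 0"
  have "e / 2 > 0" using e by simp
  note dlim_ev[OF f this] dlim_evS[OF f]
  moreover have
 "eventually (\<lambda>m. b m < e / 2) U" using order_tendstoD(2)[OF b, of "e/2"] e by simp
  ultimately show "eventually (\<lambda>m. d x (g m) < e) U"
    using g le
  proof eventually_elim
    case (elim m)
    then show ?case using d_triangle[OF dlim_in[OF f] elim(2,4)] by linarith
  qed
qed

lemma dlim_map:
  assumes "dlim U f x" and h: "holo_map X X h"
  shows "dlim U (\<lambda>m. h (f m)) (h x)"
proof -
  have x: "x \<in> S" by (rule dlim_in[OF assms(1)])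
  have ev: "eventually (\<lambda>m. f m \<in> S) U" using assms(1) by (simp add: dlim_def)
  show ?thesis
    unfolding dlim_def
  proof (intro conjI allI impI)
    show "h x \<in> S" by (rule holo_map_carrier[OF h x])
    show "eventually (\<lambda>m. h (f m) \<in> S) U" using ev by eventually_elim (rule holo_map_carrier[OF h])
    fix e :: real assume "e > 0"
    then have "eventually (\<lambda>m. d x (f m) < e) U" using assms(1) by (simp add: dlim_def)
    then show "eventually (\<lambda>m. d (h x) (h (f m)) < e) U"
      using ev by eventually_elim (use d_contract[OF h x] in \<open>force intro: le_less_trans\<close>)
  qed
qed

text \<open>Equicontinuity from contraction: the ball of radius e / 2 around x goes, for almost all
  m, into the ball of radius e around G x, the other half of e being the distance from
  \<open>g m x\<close> to G x. So one coordinate ball around x serves almost all m, with one target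
  chart and one bound, as \<open>cdiff_ultra_limit\<close> requires.\<close>

lemma limit_coordinates:
  assumes U: "ultra U" and g: "eventually (\<lambda>m. holo_map X X (g m)) U"
    and lim: "\<And>x. x \<in> S \<Longrightarrow> dlim U (\<lambda>m. g m x) (G x)"
    and A: "(A, \<phi>) \<in> mfd_atlas X" "x \<in> A" and V: "(V, \<psi>) \<in> mfd_atlas X" "G x \<in> V"
  obtains \<delta> M where "\<delta> > 0"
    "\<And>z. z \<in> cvec (mfd_dim X) \<Longrightarrow> vnorm (mfd_dim X) (z - \<phi> x) < \<delta> \<Longrightarrow>
        z \<in> \<phi> ` A \<and> inv_into A \<phi> z \<in> A \<and> \<phi> (inv_into A \<phi> z) = z \<and> G (inv_into A \<phi> z) \<in> V"
    "eventually (\<lambda>m. \<forall>z\<in>cvec (mfd_dim X). vnorm (mfd_dim X) (z - \<phi> x) < \<delta> \<longrightarrow> g m (inv_into A \<phi> z) \<in> V \<and>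
        (\<forall>j<mfd_dim X. cdiff (mfd_dim X) (\<lambda>z. \<psi> (g m (inv_into A \<phi> z)) j) z \<and>
            cmod (\<psi> (g m (inv_into A \<phi> z)) j) \<le> M)) U"
    "\<And>z j. z \<in> cvec (mfd_dim X) \<Longrightarrow> vnorm (mfd_dim X) (z - \<phi> x) < \<delta> \<Longrightarrow> j < mfd_dim X \<Longrightarrow>
        ((\<lambda>m. \<psi> (g m (inv_into A \<phi> z)) j) \<longlongrightarrow> \<psi> (G (inv_into A \<phi> z)) j) U"
proof -
  let ?n = "mfd_dim X"
  have x: "x \<in> S" using chart_subset[OF pre A(1)] A(2) by blast
  have Gx: "G x \<in> S" by (rule dlim_in[OF lim[OF x]])
  have Gne: "d (G y) (G z) \<le> d y z" if "y \<in> S" "z \<in> S" for y z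
  proof -
    have "eventually (\<lambda>m. d (g m y) (g m z) \<le> d y z) U"
      using g
    proof eventually_elim
      case (elim m)
      from d_contract[OF elim that] show ?case .
    qed
    then show ?thesis by (rule dlim_le[OF ultra_not_bot[OF U] lim[OF that(1)] lim[OF that(2)]])
  qed
  \<comment> \<open>On W the coordinates stay within 1 of those of G x; this gives the uniform bound
    M below.\<close>
  define W where "W = {y \<in> V. vnorm ?n (\<psi> y - \<psi> (G x)) < 1}"
  have "openin T W" unfolding W_def by (rule chart_nbhd_cont[OF pre V(1)])
  moreover have "G x \<in> W" using V by (simp add: W_def)
  ultimately obtain e where e: "e > 0" "\<And>y. y \<in> S \<Longrightarrow> d (G x) y < e \<Longrightarrow> y \<in> W"
    using d_ball_nbhd by metis
  define N where "N = {y \<in> S. d x y < e / 2}"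
  have "x \<in> N" using x e d_zero[OF x x] by (simp add: N_def)
  moreover have "openin T N" unfolding N_def by (rule openin_d_ball[OF x])
  ultimately obtain \<delta> where \<delta>: "\<delta> > 0" "\<And>z. z \<in> cvec ?n \<Longrightarrow> vnorm ?n (z - \<phi> x) < \<delta> \<Longrightarrow>
      z \<in> \<phi> ` A \<and> inv_into A \<phi> z \<in> N \<and> inv_into A \<phi> z \<in> A \<and> \<phi> (inv_into A \<phi> z) = z"
    using chart_nbhd[OF pre A] by metis
  have GN: "G y \<in> W" if "y \<in> N" for y
    using e(2)[of "G y"] Gne[OF x, of y] that dlim_in[OF lim[of y]] e(1) by (auto simp: N_def)
  define M where "M = vnorm ?n (\<psi> (G x)) + 1"
  show thesis
  proof (rule that[OF \<delta>(1)])
    show "z \<in> \<phi> ` A \<and> inv_into A \<phi> z \<in> A \<and> \<phi> (inv_into A \<phi> z) = z \<and> G (inv_into A \<phi> z) \<in> V"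
      if "z \<in> cvec ?n" "vnorm ?n (z - \<phi> x) < \<delta>" for z
      using \<delta>(2)[OF that] GN unfolding W_def by blast
    have "e / 2 > 0" using e by simp
    from g dlim_ev[OF lim[OF x] this] dlim_evS[OF lim[OF x]] show
 "eventually (\<lambda>m. \<forall>z\<in>cvec ?n. vnorm ?n (z - \<phi> x) < \<delta> \<longrightarrow> g m (inv_into A \<phi> z) \<in> V \<and>
        (\<forall>j<?n. cdiff ?n (\<lambda>z. \<psi> (g m (inv_into A \<phi> z)) j) z \<and> cmod (\<psi> (g m (inv_into A \<phi> z)) j) \<le> M)) U"
    proof eventually_elim
      case (elim m)
      show ?case
      proof (intro ballI impI)
        fix z assume z: "z \<in> cvec ?n" "vnorm ?n (z - \<phi> x) < \<delta>"
        define y where "y = inv_into A \<phi> z"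
        have y: "y \<in> A" "y \<in> N" "\<phi> y = z" "y \<in> S" using \<delta>(2)[OF z] unfolding y_def N_def by auto
        have gy: "g m y \<in> S" by (rule holo_map_carrier[OF elim(1) y(4)])
        have "d (G x) (g m y) < e"
          using d_triangle[OF Gx elim(3) gy] d_contract[OF elim(1) x y(4)] elim(2) y(2) by (simp add: N_def)
        then have gW: "g m y \<in> W" using e(2) gy by blast
        then have gV: "g m y \<in> V" by (simp add: W_def)
        have "mdiff X X (g m) y" using elim(1) y(4) holo_map_iff_mdiff[OF pre pre] by blast
        from mdiff_charts[OF pre pre this A(1) y(1) V(1) gV]
        have "cdiff ?n (\<lambda>z. \<psi> (g m (inv_into A \<phi> z)) j) z" if "j < ?n" for j
          using that y(3) by simp
        moreover have "cmod (\<psi> (g m y) j) \<le> M" if "j < ?n" for j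
        proof -
          have "cmod (\<psi> (g m y) j) \<le> vnorm ?n (\<psi> (g m y))" by (rule norm_le_vnorm[OF that])
          also have "\<dots> \<le> M" using vnorm_le_add[of ?n "\<psi> (g m y)" "\<psi> (G x)"] gW by (simp add: W_def M_def)
          finally show ?thesis .
        qed
        ultimately show "g m (inv_into A \<phi> z) \<in> V \<and>
          (\<forall>j<?n. cdiff ?n (\<lambda>z. \<psi> (g m (inv_into A \<phi> z)) j) z \<and> cmod (\<psi> (g m (inv_into A \<phi> z)) j) \<le> M)"
          using gV unfolding y_def by blast
      qed
    qed
    show "((\<lambda>m. \<psi> (g m (inv_into A \<phi> z)) j) \<longlongrightarrow> \<psi> (G (inv_into A \<phi> z)) j) U"
      if z: "z \<in> cvec ?n" "vnorm ?n (z - \<phi> x) < \<delta>" and j: "j < ?n" for z j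
      unfolding tendsto_iff
    proof (intro allI impI)
      fix \<epsilon> :: real assume \<epsilon>: "\<epsilon> > 0"
      define y where "y = inv_into A \<phi> z"
      have y: "y \<in> N" "y \<in> S" using \<delta>(2)[OF z] unfolding y_def N_def by auto
      define Q where "Q = {w \<in> V. vnorm ?n (\<psi> w - \<psi> (G y)) < \<epsilon>}"
      have "openin T Q" unfolding Q_def by (rule chart_nbhd_cont[OF pre V(1)])
      moreover have "G y \<in> Q" using GN[OF y(1)] \<epsilon> by (simp add: Q_def W_def)
      ultimately have "eventually (\<lambda>m. g m y \<in> Q) U"
        using lim[OF y(2)] unfolding limitin_iff_dlim[symmetric] limitin_def by blast
      then show "eventually (\<lambda>m. dist (\<psi> (g m (inv_into A \<phi> z)) j) (\<psi> (G (inv_into A \<phi> z)) j) < \<epsilon>) U"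
      proof eventually_elim
        case (elim m)
        have "cmod ((\<psi> (g m y) - \<psi> (G y)) j) \<le> vnorm ?n (\<psi> (g m y) - \<psi> (G y))"
          by (rule norm_le_vnorm[OF j])
        then show ?case using elim unfolding y_def[symmetric] by (simp add: Q_def dist_norm vapply)
      qed
    qed
  qed
qed

text \<open>Holomorphy in coordinates is the Weierstrass theorem; continuity of G follows since a
  limit of contractions is a contraction.\<close>

lemma limit_holo:
  assumes U: "ultra U" and g: "eventually (\<lambda>m. holo_map X X (g m)) U"
    and lim: "\<And>x. x \<in> S \<Longrightarrow> dlim U (\<lambda>m. g m x) (G x)"
  shows "holo_map X X G"
  unfolding holo_map_iff_mdiff[OF pre pre]
proof
  let ?n = "mfd_dim X"
  fix x assume x: "x \<in> S"
  have Gx: "G x \<in> S" by (rule dlim_in[OF lim[OF x]])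
  obtain A \<phi> where A: "(A, \<phi>) \<in> mfd_atlas X" "x \<in> A" using chart_exists[OF pre x] by blast
  obtain V \<psi> where V: "(V, \<psi>) \<in> mfd_atlas X" "G x \<in> V" using chart_exists[OF pre Gx] by blast
  obtain \<delta> M where \<delta>: "\<delta> > 0"
    and "\<And>z. z \<in> cvec ?n \<Longrightarrow> vnorm ?n (z - \<phi> x) < \<delta> \<Longrightarrow>
        z \<in> \<phi> ` A \<and> inv_into A \<phi> z \<in> A \<and> \<phi> (inv_into A \<phi> z) = z \<and> G (inv_into A \<phi> z) \<in> V"
    and ev: 
"eventually (\<lambda>m. \<forall>z\<in>cvec ?n. vnorm ?n (z - \<phi> x) < \<delta> \<longrightarrow> g m (inv_into A \<phi> z) \<in> V \<and>
        (\<forall>j<?n. cdiff ?n (\<lambda>z. \<psi> (g m (inv_into A \<phi> z)) j) z \<and> cmod (\<psi> (g m (inv_into A \<phi> z)) j) \<le> M)) U"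
    and L: "\<And>z j. z \<in> cvec ?n \<Longrightarrow> vnorm ?n (z - \<phi> x) < \<delta> \<Longrightarrow> j < ?n \<Longrightarrow>
        ((\<lambda>m. \<psi> (g m (inv_into A \<phi> z)) j) \<longlongrightarrow> \<psi> (G (inv_into A \<phi> z)) j) U"
    by (rule limit_coordinates[of U g G A \<phi> x V \<psi>, OF U g _ A V]) (erule lim, rule that, assumption+)
  have "cdiff ?n (\<lambda>z. \<psi> (G (inv_into A \<phi> z)) j) (\<phi> x)" if j: "j < ?n" for j
  proof -
    have "eventually (\<lambda>m. \<forall>z\<in>cvec ?n. vnorm ?n (z - \<phi> x) < \<delta> \<longrightarrow>
        cdiff ?n (\<lambda>z. \<psi> (g m (inv_into A \<phi> z)) j) z \<and> cmod (\<psi> (g m (inv_into A \<phi> z)) j) \<le> M) U"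
      using ev by eventually_elim (use j in blast)
    then obtain a where "has_cderiv ?n (\<lambda>z. \<psi> (G (inv_into A \<phi> z)) j) (\<phi> x) a"
    proof (rule cdiff_ultra_limit[OF U chart_cvec[OF pre A] \<delta>, where g = "\<lambda>z. \<psi> (G (inv_into A \<phi> z)) j"])
      fix z assume "z \<in> cvec ?n" "vnorm ?n (z - \<phi> x) < \<delta>"
      from L[OF this j] show "((\<lambda>m. \<psi> (g m (inv_into A \<phi> z)) j) \<longlongrightarrow> \<psi> (G (inv_into A \<phi> z)) j) U" .
    next
      fix a assume "has_cderiv ?n (\<lambda>z. \<psi> (G (inv_into A \<phi> z)) j) (\<phi> x) a"
      then show thesis by (rule that)
    qed
    then show ?thesis by (rule cdiffI)
  qed
  moreover have "tcont T T G x"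
    unfolding tcont_def
  proof (intro allI impI)
    fix W assume "openin T W \<and> G x \<in> W"
    then obtain e where e: "e > 0" "\<And>y. y \<in> S \<Longrightarrow> d (G x) y < e \<Longrightarrow> y \<in> W" using d_ball_nbhd by metis
    have "G y \<in> W" if y: "y \<in> S" "d x y < e" for y
    proof -
      have "d (G x) (G y) \<le> d x y"
      proof -
        have "eventually (\<lambda>m. d (g m x) (g m y) \<le> d x y) U"
          using g
        proof eventually_elim
          case (elim m)
          from d_contract[OF elim x y(1)] show ?case .
        qed
        then show ?thesis by (rule dlim_le[OF ultra_not_bot[OF U] lim[OF x] lim[OF y(1)]])
      qed
      then show ?thesis using e(2)[OF dlim_in[OF lim[OF y(1)]]] y by simp
    qed
    then have "G ` {y \<in> S. d x y < e} \<subseteq> W" by blast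
    moreover have "x \<in> {y \<in> S. d x y < e}" using x e d_zero[OF x x] by simp
    ultimately show "\<exists>V. openin T V \<and> x \<in> V \<and> G ` V \<subseteq> W" using openin_d_ball[OF x, of e] by blast
  qed
  ultimately show "mdiff X X G x" using x Gx A V unfolding mdiff_def by blast
qed

text \<open>The set of points where the maps converge along U is clopen, with uniform step r / 2: if
  \<open>g m x\<close> is within r / 2 of its limit and d x y < r / 2, then \<open>g m y\<close>
  lies in a relatively compact ball of radius r. Cocompactness supplies an r that works at all limit
  points, so one convergent point suffices.\<close>

theorem normal_family:
  assumes co: "cocompact X" and U: "ultra U" and g: "eventually (\<lambda>m. holo_map X X (g m)) U"
    and x0: "x0 \<in> S" and l0: "dlim U (\<lambda>m. g m x0) l0"
  obtains G where "holo_map X X G" "\<And>x. x \<in> S \<Longrightarrow> dlim U (\<lambda>m. g m x) (G x)"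
proof -
  obtain r K where r: "r > 0" "\<And>x. x \<in> S \<Longrightarrow> \<exists>C. compactin T C \<and> {y \<in> S. d x y < r} \<subseteq> C"
    using cocompact_radius[OF co] by metis
  define A where "A = {x \<in> S. \<exists>l. dlim U (\<lambda>m. g m x) l}"
  have step: "y \<in> A" if x: "x \<in> A" and y: "y \<in> S" "d x y < r / 2" for x y
  proof -
    obtain l where l: "dlim U (\<lambda>m. g m x) l" using x unfolding A_def by blast
    have xS: "x \<in> S" using x by (simp add: A_def)
    obtain C where C: "compactin T C" "{y \<in> S. d l y < r} \<subseteq> C" using r(2)[OF dlim_in[OF l]] by blast
    have "r / 2 > 0" using r(1) by simp
    from g dlim_ev[OF l this] dlim_evS[OF l] have
 "eventually (\<lambda>m. g m y \<in> C) U"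
    proof eventually_elim
      case (elim m)
      have gy: "g m y \<in> S" by (rule holo_map_carrier[OF elim(1) y(1)])
      have "d l (g m y) < r"
        using d_triangle[OF dlim_in[OF l] elim(3) gy] d_contract[OF elim(1) xS y(1)] elim(2) y(2) by simp
      with gy C show ?case by blast
    qed
    from ultra_compactin[OF U C(1) this] obtain l' where "limitin T (\<lambda>m. g m y) l' U" by blast
    then show ?thesis using y unfolding A_def limitin_iff_dlim by blast
  qed
  have r2: "r / 2 > 0" using r by simp
  have self: "x \<in> {y \<in> S. d x y < r / 2}" if "x \<in> S" for x using that d_zero[OF that that] r2 by simp
  have "openin T A"
  proof (subst openin_subopen, intro ballI)
    fix x assume x: "x \<in> A"
    then have "x \<in> S" by (simp add: A_def)
    then show "\<exists>W. openin T W \<and> x \<in> W \<and> W \<subseteq> A"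
      using openin_d_ball[of x "r / 2"] self step[OF x] by blast
  qed
  moreover have "openin T (S - A)"
  proof (subst openin_subopen, intro ballI)
    fix x assume x: "x \<in> S - A"
    have "{y \<in> S. d x y < r / 2} \<subseteq> S - A"
      using step[of _ x] x d_commute[of x] by auto
    then show "\<exists>W. openin T W \<and> x \<in> W \<and> W \<subseteq> S - A"
      using openin_d_ball[of x "r / 2"] self[of x] x by blast
  qed
  ultimately have "A = {} \<or> A = S"
    using con unfolding connected_space_clopen_in closedin_def by (auto simp: A_def)
  then have "A = S" using x0 l0 unfolding A_def by blast
  then have "\<forall>x\<in>S. \<exists>l. dlim U (\<lambda>m. g m x) l" unfolding A_def by blast
  then obtain G where G: "\<And>x. x \<in> S \<Longrightarrow> dlim U (\<lambda>m. g m x) (G x)" by metis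
  show thesis using that[OF limit_holo[OF U g G] G] by blast
qed

lemma holo_funpow: "holo_map X X f \<Longrightarrow> holo_map X X (f ^^ n)"
proof (induction n)
  case 0
  then show ?case using holo_map_id[OF pre] by (simp add: id_def)
next
  case (Suc n)
  then show ?case using holo_map_comp[OF pre pre pre, of "f ^^ n" f] by (simp add: o_def)
qed

lemma funpow_carrier: "holo_map X X f \<Longrightarrow> x \<in> S \<Longrightarrow> (f ^^ n) x \<in> S"
  by (rule holo_map_carrier[OF holo_funpow])

lemma funpow_commute:
  assumes "holo_map X X f" "holo_map X X G" "\<And>x. x \<in> S \<Longrightarrow> G (f x) = f (G x)" "x \<in> S"
  shows "G ((f ^^ n) x) = (f ^^ n) (G x)"
  by (induction n) (simp_all add: assms funpow_carrier)

(* The idea of the whole construction: precomposing the iterates with automorphisms h m that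
   bring the orbit of a base point back to a compact set makes them converge. *)
theorem abstract_model:
  assumes co: "cocompact X" and f: "holo_map X X f"
  obtains U :: "nat filter" and h h' \<alpha> where
    "ultra U" "U \<le> sequentially"
    "\<And>m. holo_map X X (h m)" "\<And>m. holo_map X X (h' m)"
    "\<And>m x. x \<in> S \<Longrightarrow> h' m (h m x) = x" "\<And>m x. x \<in> S \<Longrightarrow> h m (h' m x) = x"
    "\<And>n. holo_map X X (\<alpha> n)" "\<And>n x. x \<in> S \<Longrightarrow> dlim U (\<lambda>m. h m ((f ^^ (m - n)) x)) (\<alpha> n x)"
    "\<And>n x. x \<in> S \<Longrightarrow> \<alpha> (Suc n) (f x) = \<alpha> n x"
    "\<And>G s. holo_map X X G \<Longrightarrow> (\<And>x. x \<in> S \<Longrightarrow> G (f x) = f (G x)) \<Longrightarrow>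
       \<exists>E. holo_map X X E \<and> (\<forall>x\<in>S. dlim U (\<lambda>m. \<alpha> (m + s) (G (h' m x))) (E x)) \<and>
           (\<forall>n. \<forall>x\<in>S. E (\<alpha> n x) = \<alpha> (n + s) (G x))"
proof -
  obtain x0 where x0: "x0 \<in> S" using cm unfolding complex_manifold_def by blast
  obtain U :: "nat filter" where U: "ultra U" "U \<le> sequentially"
    using ultra_exists[of sequentially] by auto
  \<comment> \<open>As U refines \<open>sequentially\<close>, m may be assumed large, so that the
    truncated difference m - n below is a true one.\<close>
  have ge: "eventually (\<lambda>m. n \<le> m) U" for n
    using filter_leD[OF U(2) eventually_ge_at_top] .
  obtain K where K: "compactin T K" "\<And>x. x \<in> S \<Longrightarrow> \<exists>g. automorphism X g \<and> g x \<in> K"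
    using cocompact_radius[OF co] by metis
  have "\<exists>g g'. holo_map X X g \<and> holo_map X X g' \<and> (\<forall>x\<in>S. g' (g x) = x \<and> g (g' x) = x) \<and> g ((f ^^ m) x0) \<in> K" for m
    using K(2)[OF funpow_carrier[OF f x0, of m]] unfolding automorphism_def by blast
  then obtain h h' where h: "\<And>m. holo_map X X (h m)" and h': "\<And>m. holo_map X X (h' m)"
    and hh: "\<And>m x. x \<in> S \<Longrightarrow> h' m (h m x) = x" "\<And>m x. x \<in> S \<Longrightarrow> h m (h' m x) = x"
    and hK: "\<And>m. h m ((f ^^ m) x0) \<in> K"
    by metis
  have "\<exists>a. holo_map X X a \<and> (\<forall>x\<in>S. dlim U (\<lambda>m. h m ((f ^^ (m - n)) x)) (a x))" for n
  proof -
    have hol: "holo_map X X (\<lambda>x. h m ((f ^^ (m - n)) x))" for m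
      by (rule holo_map_comp[OF pre pre pre holo_funpow[OF f] h])
    \<comment> \<open>The base point is chosen to depend on n: at f^n x0 the n-th family takes the
      value h_m (f^m x0), which lies in K by the choice of h_m.\<close>
    have "eventually (\<lambda>m. h m ((f ^^ (m - n)) ((f ^^ n) x0)) \<in> K) U"
      using ge[of n]
    proof eventually_elim
      case (elim m)
      have "(f ^^ (m - n)) ((f ^^ n) x0) = (f ^^ m) x0"
        using elim by (metis comp_apply funpow_add le_add_diff_inverse2)
      then show ?case using hK by simp
    qed
    from ultra_compactin[OF U(1) K(1) this]
    obtain l where "dlim U (\<lambda>m. h m ((f ^^ (m - n)) ((f ^^ n) x0))) l"
      unfolding limitin_iff_dlim by blast
    from normal_family[OF co U(1) always_eventually[OF allI[OF hol]] funpow_carrier[OF f x0] this]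
    obtain a where a: "holo_map X X a" "\<And>x. x \<in> S \<Longrightarrow> dlim U (\<lambda>m. h m ((f ^^ (m - n)) x)) (a x)"
      by metis
    then show ?thesis by blast
  qed
  then obtain \<alpha> where \<alpha>: "\<And>n. holo_map X X (\<alpha> n)"
    and \<alpha>L: "\<And>n x. x \<in> S \<Longrightarrow> dlim U (\<lambda>m. h m ((f ^^ (m - n)) x)) (\<alpha> n x)"
    by metis
  have \<alpha>S: "\<alpha> n x \<in> S" if "x \<in> S" for n x by (rule holo_map_carrier[OF \<alpha> that])
  have suc: "\<alpha> (Suc n) (f x) = \<alpha> n x" if x: "x \<in> S" for n x
  proof (rule dlim_unique[OF ultra_not_bot[OF U(1)]])
    show "dlim U (\<lambda>m. h m ((f ^^ (m - n)) x)) (\<alpha> n x)" by (rule \<alpha>L[OF x])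
    show "dlim U (\<lambda>m. h m ((f ^^ (m - n)) x)) (\<alpha> (Suc n) (f x))"
    proof (rule dlim_cong[OF \<alpha>L[OF holo_map_carrier[OF f x], of "Suc n"]])
      show "eventually (\<lambda>m. h m ((f ^^ (m - Suc n)) (f x)) = h m ((f ^^ (m - n)) x)) U"
        using ge[of "Suc n"]
      proof eventually_elim
        case (elim m)
        then have "m - n = Suc (m - Suc n)" by simp
        then show ?case by (simp add: funpow_swap1)
      qed
    qed
  qed
  have iter: "\<alpha> (n + k) ((f ^^ k) x) = \<alpha> n x" if x: "x \<in> S" for n k x
  proof (induction k)
    case (Suc k)
    have "\<alpha> (n + Suc k) ((f ^^ Suc k) x) = \<alpha> (Suc (n + k)) (f ((f ^^ k) x))" by simp
    also have "\<dots> = \<alpha> n x" unfolding suc[OF funpow_carrier[OF f x]] by (rule Suc)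
    finally show ?case .
  qed simp
  \<comment> \<open>E carries G over to the limit. G the identity with s = 0 will give the
    retraction; s = 1 will supply inverses.\<close>
  have "\<exists>E. holo_map X X E \<and> (\<forall>x\<in>S. dlim U (\<lambda>m. \<alpha> (m + s) (G (h' m x))) (E x)) \<and>
           (\<forall>n. \<forall>x\<in>S. E (\<alpha> n x) = \<alpha> (n + s) (G x))"
    if G: "holo_map X X G" and comm: "\<And>x. x \<in> S \<Longrightarrow> G (f x) = f (G x)" for G s
  proof -
    have hol: "holo_map X X (\<lambda>x. \<alpha> (m + s) (G (h' m x)))" for m
      by (rule holo_map_comp[OF pre pre pre holo_map_comp[OF pre pre pre h' G] \<alpha>])
    \<comment> \<open>Evaluated at h_m (f^(m-n) x) instead of \<open>\<alpha> n x\<close>, the map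
      has the value \<open>\<alpha> (n + s) (G x)\<close> exactly, for all m >= n. Both arguments
      have the same limit and the maps are contractions, so the error tends to 0.\<close>
    have L: "dlim U (\<lambda>m. \<alpha> (m + s) (G (h' m (\<alpha> n x)))) (\<alpha> (n + s) (G x))" if x: "x \<in> S" for n x
    proof (rule dlim_near[OF dlim_const[OF \<alpha>S[OF holo_map_carrier[OF G x]]]])
      show "eventually (\<lambda>m. \<alpha> (m + s) (G (h' m (\<alpha> n x))) \<in> S) U"
        using holo_map_carrier[OF hol \<alpha>S[OF x]] by simp
      show "((\<lambda>m. d (h m ((f ^^ (m - n)) x)) (\<alpha> n x)) \<longlongrightarrow> 0) U"
        using dlim_d[OF \<alpha>L[OF x, of n] dlim_const[OF \<alpha>S[OF x, of n]]] d_zero[OF \<alpha>S[OF x] \<alpha>S[OF x], of n n]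
        by simp
      show "eventually (\<lambda>m. d (\<alpha> (n + s) (G x)) (\<alpha> (m + s) (G (h' m (\<alpha> n x)))) \<le>
          d (h m ((f ^^ (m - n)) x)) (\<alpha> n x)) U"
        using ge[of n]
      proof eventually_elim
        case (elim m)
        let ?y = "(f ^^ (m - n)) x"
        have y: "?y \<in> S" by (rule funpow_carrier[OF f x])
        have "\<alpha> (m + s) (G (h' m (h m ?y))) = \<alpha> ((n + s) + (m - n)) ((f ^^ (m - n)) (G x))"
          using elim hh(1)[OF y] funpow_commute[OF f G comm x] by (simp add: algebra_simps)
        also have "\<dots> = \<alpha> (n + s) (G x)" by (rule iter[OF holo_map_carrier[OF G x]])
        finally show ?case
          using d_contract[OF hol holo_map_carrier[OF h y] \<alpha>S[OF x], of m m n] by simp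
      qed
    qed
    obtain E where E: "holo_map X X E" "\<And>x. x \<in> S \<Longrightarrow> dlim U (\<lambda>m. \<alpha> (m + s) (G (h' m x))) (E x)"
      using normal_family[OF co U(1) always_eventually[OF allI[OF hol]] \<alpha>S[OF x0] L[OF x0, of 0]] by metis
    moreover have "E (\<alpha> n x) = \<alpha> (n + s) (G x)" if x: "x \<in> S" for n x
      by (rule dlim_unique[OF ultra_not_bot[OF U(1)] E(2)[OF \<alpha>S[OF x]] L[OF x]])
    ultimately show ?thesis by blast
  qed
  with that[OF U h h' hh \<alpha> \<alpha>L suc] show thesis by blast
qed

end

section \<open>Splitting an idempotent, and a quantitative inverse function theorem\<close>

section \<open>Linear maps\<close>

declare zero_fun_apply [simp del]

definition lin :: "((nat \<Rightarrow> complex) \<Rightarrow> nat \<Rightarrow> complex) \<Rightarrow> bool" where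
  "lin f \<longleftrightarrow> (\<forall>v w. f (v + w) = f v + f w) \<and> (\<forall>c v. f (vscale c v) = vscale c (f v))"

lemma linD: "lin f \<Longrightarrow> f (v + w) = f v + f w" "lin f \<Longrightarrow> f (vscale c v) = vscale c (f v)"
  by (simp_all add: lin_def)

lemma lin_zero: assumes "lin f" shows "f 0 = 0"
  using linD(2)[OF assms, of 0 0] by simp

lemma lin_diff: assumes "lin f" shows "f (v - w) = f v - f w"
proof -
  have "f v = f (v - w) + f w" using linD(1)[OF assms, of "v - w" w] by simp
  then show ?thesis by simp
qed

definition vproj :: "nat \<Rightarrow> (nat \<Rightarrow> complex) \<Rightarrow> nat \<Rightarrow> complex" where
  "vproj r w = (\<lambda>i. if i < r then w i else 0)"

lemma vproj_cvec [simp]: "vproj r w \<in> cvec r"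
  by (simp add: vproj_def cvec_def)

lemma vproj_0: "vproj 0 v = 0"
  by (auto simp: vproj_def fun_eq_iff zero_fun_apply)

lemma vproj_id: "w \<in> cvec r \<Longrightarrow> vproj r w = w"
  by (auto simp: vproj_def cvec_def fun_eq_iff)

lemma vproj_Suc: "vproj (Suc r) w = vproj r w + vscale (w r) (axisv r)"
  by (rule ext) (auto simp: vproj_def axisv_def vapply less_Suc_eq)

lemma lin_vproj: "lin (vproj r)"
  by (auto simp: lin_def vproj_def fun_eq_iff vapply)

lemma lin_cdot:
  assumes f: "lin f" and v: "v \<in> cvec n"
  shows "f v j = cdot n (\<lambda>i. f (axisv i) j) v"
proof -
  have "f (vproj k v) j = cdot k (\<lambda>i. f (axisv i) j) v" for k
  proof (induction k)
    case 0
    have "f (vproj 0 v) = 0" using lin_zero[OF f] by (simp add: vproj_0)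
    then show ?case by (simp add: cdot_def zero_fun_apply)
  next
    case (Suc k)
    then show ?case unfolding vproj_Suc linD[OF f] by (simp add: vapply cdot_def)
  qed
  from this[of n] show ?thesis by (simp add: vproj_id[OF v])
qed

lemma lin_bounded:
  assumes f: "lin f"
  obtains K where "K > 0" "\<And>v. v \<in> cvec n \<Longrightarrow> vnorm m (f v) \<le> K * vnorm n v"
proof
  let ?K = "(\<Sum>j<m. vnorm n (\<lambda>i. f (axisv i) j)) + 1"
  show "?K > 0" by (intro add_nonneg_pos sum_nonneg) auto
  fix v assume v: "v \<in> cvec n"
  have "vnorm m (f v) \<le> (\<Sum>j<m. vnorm n (\<lambda>i. f (axisv i) j) * vnorm n v)"
    unfolding vnorm_def[of m] by (intro sum_mono) (simp add: lin_cdot[OF f v] cdot_bound)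
  also have "\<dots> \<le> ?K * vnorm n v" by (simp add: sum_distrib_right distrib_right)
  finally show "vnorm m (f v) \<le> ?K * vnorm n v" .
qed

lemma has_cderiv_lin:
  assumes f: "lin f" and p: "p \<in> cvec n"
  shows "has_cderiv n (\<lambda>z. f z j) p (\<lambda>i. f (axisv i) j)"
proof (rule has_cderiv_cong[OF has_cderiv_affine[of n 0 "\<lambda>i. f (axisv i) j" 0 p] p zero_less_one])
  fix z assume "z \<in> cvec n"
  then show "0 + cdot n (\<lambda>i. f (axisv i) j) (z - 0) = f z j" using lin_cdot[OF f] by simp
qed

(* Gaussian elimination: one after the other, the rows of P - B A are made to vanish. *)
lemma idempotent_factorization:
  assumes P: "lin P" "\<And>v. P v \<in> cvec n" "\<And>v. P (P v) = P v"
  obtains r A B where "lin A" "lin B" "\<And>v. A v \<in> cvec r" "\<And>w. B w \<in> cvec n"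
    "\<And>w. w \<in> cvec r \<Longrightarrow> A (B w) = w" "\<And>v. B (A v) = P v"
proof -
  have "\<exists>r A B. lin A \<and> lin B \<and> (\<forall>v. A v \<in> cvec r) \<and> (\<forall>w. B w \<in> cvec n) \<and> (\<forall>w\<in>cvec r. A (B w) = w) \<and>
      (\<forall>w. P (B w) = B w) \<and> (\<forall>v. A (P v) = A v) \<and> (\<forall>i<j. \<forall>v. P v i = B (A v) i)" for j
  proof (induction j)
    case 0
    have w0: "w = 0" if "w \<in> cvec 0" for w using that by (auto simp: cvec_def fun_eq_iff zero_fun_apply)
    have "\<forall>w\<in>cvec 0. vproj 0 (vproj 0 w) = w" using w0 vproj_0 by metis
    moreover have "\<forall>w. P (vproj 0 w) = vproj 0 w" using lin_zero[OF P(1)] vproj_0 by metis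
    moreover have "\<forall>v. vproj 0 (P v) = vproj 0 v" "\<forall>w. vproj 0 w \<in> cvec n" using vproj_0 cvec_simps(1) by metis+
    ultimately show ?case using lin_vproj vproj_cvec by blast
  next
    case (Suc j)
    then obtain r A B where A: "lin A" "\<And>v. A v \<in> cvec r" and B: "lin B" "\<And>w. B w \<in> cvec n"
      and AB: "\<And>w. w \<in> cvec r \<Longrightarrow> A (B w) = w" and PB: "\<And>w. P (B w) = B w" and AP: "\<And>v. A (P v) = A v"
      and rows: "\<And>i v. i < j \<Longrightarrow> P v i = B (A v) i"
      by blast
    define R where "R v = P v - B (A v)" for v
    have linR: "R (v + w) = R v + R w" "R (vscale c v) = vscale c (R v)" for v w c
      unfolding R_def by (simp_all add: linD[OF P(1)] linD[OF A(1)] linD[OF B(1)] vscale_algebra)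
    show ?case
    proof (cases "\<forall>v. R v j = 0")
      case True
      then have "P v i = B (A v) i" if "i < Suc j" for i v
        using rows[of i v] that by (cases "i = j") (auto simp: R_def vapply)
      with A B AB PB AP show ?thesis by blast
    next
      case False
      then obtain x where x: "R x j \<noteq> 0" by blast
      \<comment> \<open>A nonzero entry in row j gives a pivot. Every residue satisfies A u = 0 and
        P u = u, so u is a new direction, independent of the image of B.\<close>
      define u where "u = R x"
      have uj: "u j \<noteq> 0" using x by (simp add: u_def)
      have Au: "A u = 0" unfolding u_def R_def by (simp add: lin_diff[OF A(1)] AP AB A(2))
      have Pu: "P u = u" unfolding u_def R_def by (simp add: lin_diff[OF P(1)] P(3) PB)
      have un: "u \<in> cvec n" unfolding u_def R_def using P(2) B(2) by simp
      \<comment> \<open>The new coordinate is chosen so that the residue becomes R v - (R v j / u j)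
        u. Its row j vanishes, and the earlier rows stay zero because those of R and of u
        do.\<close>
      define A' where "A' v = A v + vscale (R v j / u j) (axisv r)" for v
      define B' where "B' w = B (vproj r w) + vscale (w r) u" for w
      have cv: "cvec r \<subseteq> cvec (Suc r)" by (auto simp: cvec_def)
      have Ar: "A v r = 0" for v using A(2)[of v] by (simp add: cvec_def)
      have 1: "lin A'"
        unfolding lin_def A'_def linR linD[OF A(1)] vapply add_divide_distrib vscale_algebra
        by (simp add: algebra_simps)
      have 2: "lin B'"
        unfolding lin_def B'_def linD[OF lin_vproj] linD[OF B(1)] vapply vscale_algebra
        by (simp add: algebra_simps)
      have 3: "A' v \<in> cvec (Suc r)" for v unfolding A'_def using A(2)[of v] cv by auto
      have 4: "B' w \<in> cvec n" for w unfolding B'_def using B(2) un by simp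
      have AB': "A (B' w) = vproj r w" for w
        unfolding B'_def by (simp add: linD[OF A(1)] AB Au)
      have PB': "P (B' w) = B' w" for w
        unfolding B'_def by (simp add: linD[OF P(1)] PB Pu)
      have RB': "R (B' w) = vscale (w r) u" for w
        unfolding R_def PB' AB' by (simp add: B'_def)
      have 5: "A' (B' w) = w" if "w \<in> cvec (Suc r)" for w
      proof -
        have "A' (B' w) = vproj r w + vscale (w r) (axisv r)"
          unfolding A'_def AB' RB' using uj by (simp add: vapply)
        then show ?thesis using vproj_Suc[of r w] vproj_id[OF that] by simp
      qed
      have "R (P v) = R v" for v unfolding R_def by (simp add: P(3) AP)
      then have 6: "A' (P v) = A' v" for v unfolding A'_def by (simp add: AP)
      have A'r: "A' v r = R v j / u j" for v unfolding A'_def by (simp add: vapply Ar axisv_def)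
      have "vproj r (A' v) = A v" for v
        unfolding A'_def linD[OF lin_vproj] using vproj_id[OF A(2)] 
        by (auto simp: vproj_def axisv_def fun_eq_iff vapply)
      then have "B' (A' v) = B (A v) + vscale (R v j / u j) u" for v
        unfolding B'_def A'r by simp
      then have R': "P v i - B' (A' v) i = R v i - R v j / u j * u i" for v i
        by (simp add: R_def vapply)
      have 7: "P v i = B' (A' v) i" if "i < Suc j" for v i
      proof (cases "i = j")
        case True
        then show ?thesis using R'[of v i] uj by simp
      next
        case False
        then have "R y i = 0" for y using rows that unfolding R_def by (simp add: vapply)
        then show ?thesis using R'[of v i] by (simp add: u_def)
      qed
      show ?thesis using 1 2 3 4 5 PB' 6 7 by blast
    qed
  qed
  from this[of n] obtain r A B where *: "lin A" "lin B" "\<And>v. A v \<in> cvec r" "\<And>w. B w \<in> cvec n"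
    "\<And>w. w \<in> cvec r \<Longrightarrow> A (B w) = w" "\<And>i v. i < n \<Longrightarrow> P v i = B (A v) i" by blast
  have "B (A v) = P v" for v
    by (rule cvec_eqI[OF *(4) P(2)]) (simp add: *(6))
  with * that show thesis by blast
qed

subsection \<open>Perturbations of the identity\<close>

text \<open>The equation u + H u = w is solved by iterating u -> w - H u from 0. The first step has
  length at most \<open>\<tau>\<close> / 8 + \<open>\<tau>\<close> / 8 and the steps halve, so the
  iterates stay within \<open>\<tau>\<close> / 2, where H is a contraction. Differentiability of H
  is a premise of the second conclusion only: for the maps approximating the retraction the first
  conclusion is applied alone.\<close>

lemma perturbed_identity:
  assumes \<tau>: "\<tau> > 0" and H: "\<And>u. u \<in> cvec r \<Longrightarrow> H u \<in> cvec r"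
    and lip: "\<And>u u'. u \<in> cvec r \<Longrightarrow> vnorm r u < \<tau> \<Longrightarrow> u' \<in> cvec r \<Longrightarrow> vnorm r u' < \<tau> \<Longrightarrow>
        vnorm r (H u - H u') \<le> vnorm r (u - u') / 2"
    and H0: "vnorm r (H 0) \<le> \<tau> / 8"
  obtains F where "\<And>w. w \<in> cvec r \<Longrightarrow> vnorm r w < \<tau> / 8 \<Longrightarrow>
      F w \<in> cvec r \<and> vnorm r (F w) \<le> \<tau> / 2 \<and> F w + H (F w) = w"
    "(\<And>u j. u \<in> cvec r \<Longrightarrow> vnorm r u < \<tau> \<Longrightarrow> j < r \<Longrightarrow> cdiff r (\<lambda>u. H u j) u) \<Longrightarrow>
      (\<And>w j. w \<in> cvec r \<Longrightarrow> vnorm r w < \<tau> / 8 \<Longrightarrow> j < r \<Longrightarrow> cdiff r (\<lambda>w. F w j) w)"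
proof -
  define it where "it k w = ((\<lambda>u. w - H u) ^^ k) 0" for k w
  have it0: "it 0 w = 0" and itS: "it (Suc k) w = w - H (it k w)" for k w
    by (simp_all add: it_def)
  have itc: "it k w \<in> cvec r" if "w \<in> cvec r" for k w
    using that by (induction k) (auto simp: it0 itS H)
  have bnd: "vnorm r (it k w) \<le> \<tau> / 2 - \<tau> / 2 * (1/2)^k \<and> vnorm r (it (Suc k) w - it k w) \<le> \<tau> / 4 * (1/2)^k"
    if w: "w \<in> cvec r" "vnorm r w < \<tau> / 8" for k w
  proof (induction k)
    case 0
    have "vnorm r (w - H 0) \<le> \<tau> / 8 + \<tau> / 8"
      using vnorm_triangle_diff[of r w "H 0"] w H0 by linarith
    then show ?case using \<tau> by (simp add: it0 itS)
  next
    case (Suc k)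
    have k: "(1/2::real)^k > 0" by simp
    have "vnorm r (it (Suc k) w) \<le> vnorm r (it (Suc k) w - it k w) + vnorm r (it k w)"
      by (rule vnorm_le_add)
    then have 1: "vnorm r (it (Suc k) w) \<le> \<tau> / 2 - \<tau> / 2 * (1/2)^Suc k" using Suc by simp
    have "\<tau> / 2 * (1/2)^k > 0" "\<tau> / 2 * (1/2)^Suc k > 0" using \<tau> by simp_all
    then have "vnorm r (it k w) < \<tau>" "vnorm r (it (Suc k) w) < \<tau>" using Suc 1 \<tau> by linarith+
    then have "vnorm r (H (it k w) - H (it (Suc k) w)) \<le> vnorm r (it k w - it (Suc k) w) / 2"
      using lip itc w(1) by blast
    moreover have "it (Suc (Suc k)) w - it (Suc k) w = H (it k w) - H (it (Suc k) w)"
      unfolding itS[of "Suc k"] itS[of k] by simp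
    ultimately have "vnorm r (it (Suc (Suc k)) w - it (Suc k) w) \<le> \<tau> / 4 * (1/2)^k / 2"
      using Suc vnorm_minus_commute[of r "it k w" "it (Suc k) w"] by simp
    with 1 show ?case by simp
  qed
  have half: "vnorm r (it k w) \<le> \<tau> / 2" if w: "w \<in> cvec r" "vnorm r w < \<tau> / 8" for k w
  proof -
    have "\<tau> / 2 * (1/2)^k > 0" using \<tau> by simp
    then show ?thesis using bnd[OF w, of k] by linarith
  qed
  define F where "F w = (\<lambda>j. lim (\<lambda>k. it k w j))" for w
  have lim: "(\<lambda>k. it k w j) \<longlonglongrightarrow> F w j" if w: "w \<in> cvec r" "vnorm r w < \<tau> / 8" for w j
  proof -
    have "summable (\<lambda>k. it (Suc k) w j - it k w j)"
    proof (rule summable_comparison_test)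
      show "summable (\<lambda>k. \<tau> / 4 * (1/2)^k)" by (intro summable_mult summable_geometric) simp
      have "cmod (it (Suc k) w j - it k w j) \<le> \<tau> / 4 * (1/2)^k" for k
      proof -
        have "cmod ((it (Suc k) w - it k w) j) \<le> vnorm r (it (Suc k) w - it k w)"
          by (rule norm_cvec_le_vnorm) (intro cvec_simps itc w)
        then show ?thesis using bnd[OF w, of k] by (simp add: vapply)
      qed
      then show "\<exists>N. \<forall>k\<ge>N. norm (it (Suc k) w j - it k w j) \<le> \<tau> / 4 * (1/2)^k" by blast
    qed
    then have "convergent (\<lambda>m. \<Sum>k<m. it (Suc k) w j - it k w j)"
      using summable_LIMSEQ convergent_def by blast
    moreover have "(\<Sum>k<m. it (Suc k) w j - it k w j) = it m w j" for m
      using sum_lessThan_telescope[of "\<lambda>k. it k w j" m] by (simp add: it0 zero_fun_apply)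
    ultimately show ?thesis unfolding F_def by (simp add: convergent_LIMSEQ_iff)
  qed
  have Fc: "F w \<in> cvec r" if w: "w \<in> cvec r" "vnorm r w < \<tau> / 8" for w
    unfolding cvec_def
  proof (clarify)
    fix i assume "r \<le> i"
    then have "(\<lambda>k. it k w i) = (\<lambda>k. 0)" using itc[OF w(1)] by (auto simp: cvec_def)
    then show "F w i = 0" using lim[OF w, of i] LIMSEQ_unique[of "\<lambda>k. 0" "F w i" 0] by simp
  qed
  have limv: "(\<lambda>k. vnorm r (it k w - F w)) \<longlonglongrightarrow> 0" if w: "w \<in> cvec r" "vnorm r w < \<tau> / 8" for w
  proof -
    have "(\<lambda>k. vnorm r (it k w - F w)) \<longlonglongrightarrow> (\<Sum>j<r. cmod (F w j - F w j))"
      unfolding vnorm_def minus_apply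
      by (intro tendsto_sum tendsto_norm tendsto_diff lim[OF w] tendsto_const)
    then show ?thesis by simp
  qed
  have Fhalf: "vnorm r (F w) \<le> \<tau> / 2" if w: "w \<in> cvec r" "vnorm r w < \<tau> / 8" for w
  proof (rule LIMSEQ_le_const2)
    show "(\<lambda>k. vnorm r (it k w)) \<longlonglongrightarrow> vnorm r (F w)"
      unfolding vnorm_def by (intro tendsto_sum tendsto_norm lim[OF w])
    show "\<exists>N. \<forall>n\<ge>N. vnorm r (it n w) \<le> \<tau> / 2" using half[OF w] by blast
  qed
  have fixp: "F w + H (F w) = w" if w: "w \<in> cvec r" "vnorm r w < \<tau> / 8" for w
  proof -
    have Fw: "vnorm r (F w) < \<tau>" using Fhalf[OF w] \<tau> by linarith
    have "vnorm r (F w - (w - H (F w))) \<le> 0"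
    proof (rule LIMSEQ_le_const)
      have "(\<lambda>k. vnorm r (it (Suc k) w - F w) + vnorm r (it k w - F w) / 2) \<longlonglongrightarrow> 0 + 0 / 2"
        by (intro tendsto_add tendsto_divide tendsto_const limv[OF w] LIMSEQ_Suc) simp
      then show "(\<lambda>k. vnorm r (it (Suc k) w - F w) + vnorm r (it k w - F w) / 2) \<longlonglongrightarrow> 0" by simp
      have "vnorm r (F w - (w - H (F w))) \<le> vnorm r (it (Suc k) w - F w) + vnorm r (it k w - F w) / 2" for k
      proof -
        have "vnorm r (it k w) < \<tau>" using half[OF w, of k] \<tau> by linarith
        then have "vnorm r (H (it k w) - H (F w)) \<le> vnorm r (it k w - F w) / 2"
          using lip[OF itc[OF w(1)] _ Fc[OF w] Fw] by blast
        moreover have "it (Suc k) w - (w - H (F w)) = - (H (it k w) - H (F w))"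
          unfolding itS by simp
        moreover have "vnorm r (F w - (w - H (F w))) \<le> vnorm r (F w - it (Suc k) w) + vnorm r (it (Suc k) w - (w - H (F w)))"
          by (rule vnorm_dist_triangle)
        ultimately show ?thesis using vnorm_minus_commute[of r "F w" "it (Suc k) w"]
          by (simp only: vnorm_uminus)
      qed
      then show "\<exists>N. \<forall>k\<ge>N. vnorm r (F w - (w - H (F w))) \<le> vnorm r (it (Suc k) w - F w) + vnorm r (it k w - F w) / 2"
        by blast
    qed
    then have "F w = w - H (F w)"
      by (rule vnorm_eq_0D[rotated 2]) (use Fc[OF w] H w in auto)
    then show ?thesis by (metis diff_add_cancel)
  qed
  have hol: "cdiff r (\<lambda>w. F w j) w"
    if dH: "\<And>u j. u \<in> cvec r \<Longrightarrow> vnorm r u < \<tau> \<Longrightarrow> j < r \<Longrightarrow> cdiff r (\<lambda>u. H u j) u"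
      and w: "w \<in> cvec r" "vnorm r w < \<tau> / 8" and j: "j < r" for w j
  proof -
    \<comment> \<open>The iterates are holomorphic and bounded, so their limit F is holomorphic by
      \<open>cdiff_ultra_limit\<close>, for any ultrafilter refining
      \<open>sequentially\<close>.\<close>
    obtain U :: "nat filter" where U: "ultra U" "U \<le> sequentially" using ultra_exists[of sequentially] by auto
    have dit: "cdiff r (\<lambda>w. it k w j) w" if "w \<in> cvec r" "vnorm r w < \<tau> / 8" "j < r" for k w j
      using that
    proof (induction k arbitrary: j)
      case 0
      then show ?case by (simp add: it0 cdiff_intros)
    next
      case (Suc k)
      have "cdiff r (\<lambda>w. H (it k w) j) w"
      proof (rule cdiff_chain[where m = r and h = "\<lambda>u. H u j" and G = "it k" and r = 1])
        have "vnorm r (it k w) < \<tau>" using half[OF Suc.prems(1,2), of k] \<tau> by linarith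
        then show "cdiff r (\<lambda>u. H u j) (it k w)" by (rule dH[OF itc[OF Suc.prems(1)] _ Suc.prems(3)])
      qed (use Suc itc in auto)
      then show ?case unfolding itS minus_apply
        by (intro cdiff_intros cdiff_coord Suc.prems)
    qed
    define R where "R = \<tau> / 8 - vnorm r w"
    have R: "R > 0" using w by (simp add: R_def)
    have near: "vnorm r z < \<tau> / 8" if "vnorm r (z - w) < R" for z
      using that vnorm_le_add[of r z w] by (simp add: R_def)
    have "\<forall>k. \<forall>z\<in>cvec r. vnorm r (z - w) < R \<longrightarrow> cdiff r (\<lambda>w. it k w j) z \<and> cmod (it k z j) \<le> \<tau> / 2"
    proof (intro allI ballI impI conjI)
      fix k z assume z: "z \<in> cvec r" "vnorm r (z - w) < R"
      show "cdiff r (\<lambda>w. it k w j) z" by (rule dit[OF z(1) near[OF z(2)] j])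
      show "cmod (it k z j) \<le> \<tau> / 2"
        using norm_le_vnorm[OF j, of "it k z"] half[OF z(1) near[OF z(2)], of k] by linarith
    qed
    then have ev: "eventually (\<lambda>k. \<forall>z\<in>cvec r. vnorm r (z - w) < R \<longrightarrow> cdiff r (\<lambda>w. it k w j) z \<and> cmod (it k z j) \<le> \<tau> / 2) U"
      by (rule always_eventually)
    obtain a where "has_cderiv r (\<lambda>w. F w j) w a"
    proof (rule cdiff_ultra_limit[OF U(1) w(1) R ev, where g = "\<lambda>w. F w j"])
      fix z assume z: "z \<in> cvec r" "vnorm r (z - w) < R"
      show "((\<lambda>k. it k z j) \<longlongrightarrow> F z j) U"
        by (rule tendsto_mono[OF U(2) lim[OF z(1) near[OF z(2)]]])
    next
      fix a assume "has_cderiv r (\<lambda>w. F w j) w a"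
      then show thesis by (rule that)
    qed
    then show ?thesis by (rule cdiffI)
  qed
  show thesis
    by (rule that[of F]) (use Fc Fhalf fixp hol in blast)+
qed

text \<open>On the ball of radius 2 \<open>\<delta>\<close> the function minus its affine part is at
  most 4 M / R^2 times (2 \<open>\<delta>\<close>)^2; the Lipschitz estimate divides by
  \<open>\<delta>\<close>. The constant is thus linear in \<open>\<delta>\<close>, and the same for
  all functions bounded by M.\<close>

lemma remainder_lipschitz:
  assumes p: "p \<in> cvec n" and \<delta>: "0 < \<delta>" "2 * \<delta> \<le> R"
    and f: "\<And>z. z \<in> cvec n \<Longrightarrow> vnorm n (z - p) < R \<Longrightarrow> cdiff n f z \<and> cmod (f z) \<le> M"
    and a: "has_cderiv n f p a"
    and v: "v \<in> cvec n" "vnorm n v < \<delta>" and w: "w \<in> cvec n" "vnorm n w < \<delta>"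
  shows "cmod ((f (p + v) - cdot n a v) - (f (p + w) - cdot n a w)) \<le> 32 * M / R^2 * \<delta> * vnorm n (v - w)"
proof -
  have R: "R > 0" using \<delta> by linarith
  have "cmod (f p) \<le> M" using f[OF p] R by simp
  then have M: "M \<ge> 0" using norm_ge_zero[of "f p"] by linarith
  define h where "h z = f z - (f p + cdot n a (z - p))" for z
  define M' where "M' = 4 * M / R^2 * (2 * \<delta>)^2"
  have h: "cdiff n h z \<and> cmod (h z) \<le> M'" if z: "z \<in> cvec n" "vnorm n (z - p) < 2 * \<delta>" for z
  proof
    have zR: "vnorm n (z - p) < R" using z \<delta> by linarith
    have "cdiff n f z" using f[OF z(1) zR] by blast
    then show "cdiff n h z"
      unfolding h_def by (intro cdiff_intros(3) cdiffI[OF has_cderiv_affine])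
    have "cmod (h z) \<le> 4 * M / R^2 * vnorm n (z - p) ^ 2"
      using bounded_cdiff_bounds(2)[OF p R f _ zR a] z p by (simp add: h_def diff_diff_eq)
    also have "\<dots> \<le> M'"
      unfolding M'_def using z M by (intro mult_left_mono power_mono) auto
    finally show "cmod (h z) \<le> M'" .
  qed
  have "cmod (h (p + v) - h (p + w)) \<le> 2 * M' / \<delta> * vnorm n ((p + v) - (p + w))"
    by (rule bounded_cdiff_lipschitz[OF p \<delta>(1) h]) (use p v w in auto)
  moreover have "2 * M' / \<delta> = 32 * M / R^2 * \<delta>"
    using \<delta> R by (simp add: M'_def power2_eq_square field_simps)
  moreover have "h (p + v) - h (p + w) = (f (p + v) - cdot n a v) - (f (p + w) - cdot n a w)"
    by (simp add: h_def)
  ultimately show ?thesis by simp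
qed

subsection \<open>Holomorphic maps from and to complex n-space\<close>

text \<open>Once f stays in one chart, continuity follows from the differentiable coordinates by
  \<open>vector_local_lipschitz\<close>. The next lemma is the counterpart for maps into
  C^m.\<close>

lemma mdiff_from_cspaceI:
  assumes N: "premfd N" and p: "p \<in> cvec n" and V: "(V, \<psi>) \<in> mfd_atlas N"
    and \<delta>: "\<delta> > 0" "\<And>w. w \<in> cvec n \<Longrightarrow> vnorm n (w - p) < \<delta> \<Longrightarrow> f w \<in> V"
    and d: "\<And>j. j < mfd_dim N \<Longrightarrow> cdiff n (\<lambda>z. \<psi> (f z) j) p"
  shows "mdiff (cspace_mfd n) N f p"
proof -
  have fp: "f p \<in> V" using \<delta> p by simp
  have "tcont (complex_space n) (mfd_top N) f p"
    unfolding tcont_def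
  proof (intro allI impI)
    fix W assume W: "openin (mfd_top N) W \<and> f p \<in> W"
    obtain e where e: "e > 0" "\<And>z. z \<in> cvec (mfd_dim N) \<Longrightarrow> vnorm (mfd_dim N) (z - \<psi> (f p)) < e \<Longrightarrow>
      z \<in> \<psi> ` V \<and> inv_into V \<psi> z \<in> W \<and> inv_into V \<psi> z \<in> V \<and> \<psi> (inv_into V \<psi> z) = z"
      using chart_nbhd[OF N V fp] W by blast
    have "\<exists>\<delta>>0. \<exists>K>0. \<forall>z\<in>cvec n. vnorm n (z - p) < \<delta> \<longrightarrow>
        vnorm (mfd_dim N) (\<psi> (f z) - \<psi> (f p)) \<le> K * vnorm n (z - p)"
      by (rule vector_local_lipschitz[of "mfd_dim N" n "\<lambda>z. \<psi> (f z)" p]) (rule d)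
    then obtain \<delta>' K where K: "\<delta>' > 0" "K > 0" "\<And>z. z \<in> cvec n \<Longrightarrow> vnorm n (z - p) < \<delta>' \<Longrightarrow>
        vnorm (mfd_dim N) (\<psi> (f z) - \<psi> (f p)) \<le> K * vnorm n (z - p)" by blast
    define t where "t = min (min \<delta> \<delta>') (e / K)"
    have t: "t > 0" using \<delta> K e by (simp add: t_def)
    have "f w \<in> W" if w: "w \<in> cvec n" "vnorm n (w - p) < t" for w
    proof -
      have fw: "f w \<in> V" using w \<delta>(2) by (simp add: t_def)
      have "vnorm (mfd_dim N) (\<psi> (f w) - \<psi> (f p)) \<le> K * vnorm n (w - p)" using K(3) w by (simp add: t_def)
      also have "\<dots> < e" using w K(2) by (simp add: t_def field_simps)
      finally have "inv_into V \<psi> (\<psi> (f w)) \<in> W" using e(2)[OF chart_cvec[OF N V fw]] by blast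
      then show ?thesis by (simp add: chart_inv[OF N V fw])
    qed
    then have "f ` {z \<in> cvec n. vnorm n (z - p) < t} \<subseteq> W" by blast
    moreover have "p \<in> {z \<in> cvec n. vnorm n (z - p) < t}" using p t by simp
    ultimately show "\<exists>V. openin (complex_space n) V \<and> p \<in> V \<and> f ` V \<subseteq> W"
      using openin_ball_cvec[of n p t] by blast
  qed
  then show ?thesis by (rule mdiff_from_cspace[OF N p V fp _ d])
qed

lemma mdiff_to_cspaceI:
  assumes M: "premfd M" and U: "(U, \<phi>) \<in> mfd_atlas M" "x \<in> U" and f: "\<And>y. y \<in> U \<Longrightarrow> f y \<in> cvec m"
    and d: "\<And>j. j < m \<Longrightarrow> cdiff (mfd_dim M) (\<lambda>z. f (inv_into U \<phi> z) j) (\<phi> x)"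
  shows "mdiff M (cspace_mfd m) f x"
proof (rule mdiff_to_cspace[OF M U f[OF U(2)] _ d])
  let ?n = "mfd_dim M"
  show "tcont (mfd_top M) (complex_space m) f x"
    unfolding tcont_def
  proof (intro allI impI)
    fix W assume W: "openin (complex_space m) W \<and> f x \<in> W"
    then obtain e where e: "e > 0" "\<And>z. z \<in> cvec m \<Longrightarrow> vnorm m (z - f x) < e \<Longrightarrow> z \<in> W"
      unfolding openin_complex_space by blast
    have "\<exists>\<delta>>0. \<exists>K>0. \<forall>z\<in>cvec ?n. vnorm ?n (z - \<phi> x) < \<delta> \<longrightarrow>
        vnorm m (f (inv_into U \<phi> z) - f (inv_into U \<phi> (\<phi> x))) \<le> K * vnorm ?n (z - \<phi> x)"
      by (rule vector_local_lipschitz[of m ?n "\<lambda>z. f (inv_into U \<phi> z)" "\<phi> x"]) (rule d)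
    then obtain \<delta>' K where K: "\<delta>' > 0" "K > 0" "\<And>z. z \<in> cvec ?n \<Longrightarrow> vnorm ?n (z - \<phi> x) < \<delta>' \<Longrightarrow>
        vnorm m (f (inv_into U \<phi> z) - f (inv_into U \<phi> (\<phi> x))) \<le> K * vnorm ?n (z - \<phi> x)" by blast
    define t where "t = min \<delta>' (e / K)"
    have t: "t > 0" using K e by (simp add: t_def)
    have "f y \<in> W" if y: "y \<in> U" "vnorm ?n (\<phi> y - \<phi> x) < t" for y
    proof -
      have "vnorm m (f y - f x) \<le> K * vnorm ?n (\<phi> y - \<phi> x)"
        using K(3)[OF chart_cvec[OF M U(1) y(1)]] y(2)
        by (simp add: t_def chart_inv[OF M U(1) y(1)] chart_inv[OF M U])
      also have "\<dots> < e" using y K(2) by (simp add: t_def field_simps)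
      finally show ?thesis using e(2)[OF f[OF y(1)]] by blast
    qed
    then have "f ` {y \<in> U. vnorm ?n (\<phi> y - \<phi> x) < t} \<subseteq> W" by blast
    moreover have "x \<in> {y \<in> U. vnorm ?n (\<phi> y - \<phi> x) < t}" using U t by simp
    ultimately show "\<exists>V. openin (mfd_top M) V \<and> x \<in> V \<and> f ` V \<subseteq> W"
      using chart_nbhd_cont[OF M U(1), of "\<phi> x" t] by blast
  qed
qed

subsection \<open>Invariance of dimension\<close>

(* If J and J' are the derivatives of the two maps, then n = tr (J' J) = tr (J J') = m. *)
lemma dimension_invariance:
  assumes p: "p \<in> cvec n" "g p \<in> cvec m" and \<delta>: "\<delta> > 0"
    and g: "\<And>j. j < m \<Longrightarrow> cdiff n (\<lambda>z. g z j) p" and h: "\<And>i. i < n \<Longrightarrow> cdiff m (\<lambda>w. h w i) (g p)"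
    and gc: "\<And>z. z \<in> cvec n \<Longrightarrow> vnorm n (z - p) < \<delta> \<Longrightarrow> g z \<in> cvec m \<and> h (g z) = z"
    and hc: "\<And>w. w \<in> cvec m \<Longrightarrow> vnorm m (w - g p) < \<delta> \<Longrightarrow> h w \<in> cvec n \<and> g (h w) = w"
  shows "n = m"
proof -
  have hgp: "h (g p) = p" using gc[OF p(1)] \<delta> by simp
  obtain J where J: "\<And>j. j < m \<Longrightarrow> has_cderiv n (\<lambda>z. g z j) p (J j)" using g unfolding cdiff_def by metis
  obtain J' where J': "\<And>i. i < n \<Longrightarrow> has_cderiv m (\<lambda>w. h w i) (g p) (J' i)" using h unfolding cdiff_def by metis
  have 1: "(\<Sum>j<m. J' i j * J j l) = axisv i l" if il: "i < n" "l < n" for i l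
  proof (rule has_cderiv_unique[OF _ _ p(1) il(2)])
    have "has_cderiv n (\<lambda>z. h (g z) i) p (\<lambda>l. \<Sum>j<m. J' i j * J j l)"
      by (rule has_cderiv_chain[where h = "\<lambda>w. h w i" and G = g and r = \<delta>, OF J'[OF il(1)] J \<delta>]) (use gc in auto)
    then show "has_cderiv n (\<lambda>z. z i) p (\<lambda>l. \<Sum>j<m. J' i j * J j l)"
      by (rule has_cderiv_cong[OF _ p(1) \<delta>]) (simp add: gc)
    show "has_cderiv n (\<lambda>z. z i) p (axisv i)" by (rule has_cderiv_coord[OF il(1)])
  qed
  have 2: "(\<Sum>i<n. J j i * J' i l) = axisv j l" if jl: "j < m" "l < m" for j l
  proof (rule has_cderiv_unique[OF _ _ p(2) jl(2)])
    have Jh: "has_cderiv n (\<lambda>z. g z j) (h (g p)) (J j)" unfolding hgp by (rule J[OF jl(1)])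
    have "has_cderiv m (\<lambda>w. g (h w) j) (g p) (\<lambda>l. \<Sum>i<n. J j i * J' i l)"
      by (rule has_cderiv_chain[where h = "\<lambda>z. g z j" and G = h and r = \<delta>, OF Jh J' \<delta>]) (use hc in auto)
    then show "has_cderiv m (\<lambda>w. w j) (g p) (\<lambda>l. \<Sum>i<n. J j i * J' i l)"
      by (rule has_cderiv_cong[OF _ p(2) \<delta>]) (simp add: hc)
    show "has_cderiv m (\<lambda>w. w j) (g p) (axisv j)" by (rule has_cderiv_coord[OF jl(1)])
  qed
  have "of_nat n = (\<Sum>i<n. \<Sum>j<m. J' i j * J j i)" using 1 by (simp add: axisv_def)
  also have "\<dots> = (\<Sum>j<m. \<Sum>i<n. J j i * J' i j)" by (subst sum.swap) (simp add: mult.commute)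
  also have "\<dots> = (of_nat m :: complex)" using 2 by (simp add: axisv_def)
  finally show ?thesis using of_nat_eq_iff by blast
qed

section \<open>The rank theorem for a retraction and for maps close to it\<close>

section \<open>Holomorphic retracts\<close>

lemma lin_matrix: "lin (\<lambda>v i. if i < n then cdot n (a i) v else 0)"
  unfolding lin_def by (auto simp: fun_eq_iff cdot_linear vapply)

context hyperbolic_manifold
begin

(* In a chart around p, the derivative P = B A of the retraction is idempotent, and A is a
   coordinate on the fixed point set: A (\<rho> (B u)) is a small perturbation of u.  The same
   perturbation argument for the approximations g m of \<rho> shows that they attain the value p. *)
theorem local_retract:
  assumes U: "ultra U" and g: "eventually (\<lambda>m. holo_map X X (g m)) U"
    and lim: "\<And>x. x \<in> S \<Longrightarrow> dlim U (\<lambda>m. g m x) (\<rho> x)"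
    and \<rho>: "holo_map X X \<rho>" and idem: "\<And>x. x \<in> S \<Longrightarrow> \<rho> (\<rho> x) = \<rho> x"
    and \<rho>g: "\<And>m x. x \<in> S \<Longrightarrow> \<rho> (g m x) = g m x" and p: "p \<in> S" "\<rho> p = p"
  shows "\<exists>r a s D \<tau>. \<tau> > 0 \<and> openin T D \<and> p \<in> D \<and> (\<forall>x\<in>D. mdiff X (cspace_mfd r) a x) \<and>
    (\<forall>w\<in>cvec r. vnorm r w < \<tau> \<longrightarrow> mdiff (cspace_mfd r) X s w \<and> s w \<in> D \<and> \<rho> (s w) = s w \<and> a (s w) = w) \<and>
    (\<forall>x\<in>D. \<rho> x = x \<longrightarrow> vnorm r (a x) < \<tau> \<and> s (a x) = x) \<and> eventually (\<lambda>m. p \<in> g m ` S) U"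
proof -
  let ?n = "mfd_dim X"
  obtain A \<phi> where A: "(A, \<phi>) \<in> mfd_atlas X" "p \<in> A" using chart_exists[OF pre p(1)] by blast
  have AS: "A \<subseteq> S" by (rule chart_subset[OF pre A(1)])
  define c where "c = \<phi> p"
  have c: "c \<in> cvec ?n" unfolding c_def by (rule chart_cvec[OF pre A])
  have \<rho>pA: "\<rho> p \<in> A" using p A by simp
  let ?i = "inv_into A \<phi>"
  obtain \<delta>' M' where \<delta>': "\<delta>' > 0"
    and inA': "\<And>z. z \<in> cvec ?n \<Longrightarrow> vnorm ?n (z - \<phi> p) < \<delta>' \<Longrightarrow>
        z \<in> \<phi> ` A \<and> ?i z \<in> A \<and> \<phi> (?i z) = z \<and> \<rho> (?i z) \<in> A"
    and ev': "eventually (\<lambda>m. \<forall>z\<in>cvec ?n. vnorm ?n (z - \<phi> p) < \<delta>' \<longrightarrow> g m (?i z) \<in> A \<and>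
        (\<forall>j<?n. cdiff ?n (\<lambda>z. \<phi> (g m (?i z)) j) z \<and> cmod (\<phi> (g m (?i z)) j) \<le> M')) U"
    and L': "\<And>z j. z \<in> cvec ?n \<Longrightarrow> vnorm ?n (z - \<phi> p) < \<delta>' \<Longrightarrow> j < ?n \<Longrightarrow>
        ((\<lambda>m. \<phi> (g m (?i z)) j) \<longlongrightarrow> \<phi> (\<rho> (?i z)) j) U"
    by (rule limit_coordinates[of U g \<rho> A \<phi> p A \<phi>, OF U g _ A A(1) \<rho>pA]) (erule lim, rule that, assumption+)
  define M where "M = \<bar>M'\<bar>"
  have M: "M \<ge> 0" "M' \<le> M" by (auto simp: M_def)
  define ball where "ball z \<longleftrightarrow> z \<in> cvec ?n \<and> vnorm ?n (z - c) < \<delta>'" for z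
  have ballc: "ball c" using c \<delta>' by (simp add: ball_def)
  have inA: "?i z \<in> A" "\<phi> (?i z) = z" "\<rho> (?i z) \<in> A" "?i z \<in> S" if "ball z" for z
    using inA'[of z] that AS unfolding ball_def c_def by auto
  define G where "G z = \<phi> (\<rho> (?i z))" for z
  define Gm where "Gm m z = \<phi> (g m (?i z))" for m z
  have ic: "?i c = p" unfolding c_def by (rule chart_inv[OF pre A])
  have Gc: "G c = c" unfolding G_def ic p(2) by (rule c_def[symmetric])
  have Gcv: "G z \<in> cvec ?n" if "ball z" for z
    unfolding G_def by (rule chart_cvec[OF pre A(1) inA(3)[OF that]])
  have ev: "eventually (\<lambda>m. \<forall>z. ball z \<longrightarrow> g m (?i z) \<in> A \<and>
        (\<forall>j<?n. cdiff ?n (\<lambda>z. Gm m z j) z \<and> cmod (Gm m z j) \<le> M)) U"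
    using ev'
  proof eventually_elim
    case (elim m)
    show ?case
    proof (intro allI impI)
      fix z assume "ball z"
      then have z: "z \<in> cvec ?n" "vnorm ?n (z - \<phi> p) < \<delta>'" by (simp_all add: ball_def c_def)
      have "g m (?i z) \<in> A \<and> (\<forall>j<?n. cdiff ?n (\<lambda>z. Gm m z j) z \<and> cmod (Gm m z j) \<le> M')"
        unfolding Gm_def using elim z by blast
      then show "g m (?i z) \<in> A \<and> (\<forall>j<?n. cdiff ?n (\<lambda>z. Gm m z j) z \<and> cmod (Gm m z j) \<le> M)"
        using M(2) order_trans by blast
    qed
  qed
  have L: "((\<lambda>m. Gm m z j) \<longlongrightarrow> G z j) U" if "ball z" "j < ?n" for z j
    unfolding Gm_def G_def by (rule L') (use that in \<open>auto simp: ball_def c_def\<close>)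
  have Gd: "cdiff ?n (\<lambda>z. G z j) z \<and> cmod (G z j) \<le> M" if z: "ball z" and j: "j < ?n" for z j
  proof
    have "mdiff X X \<rho> (?i z)" using \<rho> inA(4)[OF z] holo_map_iff_mdiff[OF pre pre] by blast
    from mdiff_charts[OF pre pre this A(1) inA(1)[OF z] A(1) inA(3)[OF z] j]
    show "cdiff ?n (\<lambda>z. G z j) z" unfolding G_def inA(2)[OF z] .
    show "cmod (G z j) \<le> M"
    proof (rule tendsto_upperbound[OF tendsto_norm[OF L[OF z j]] _ ultra_not_bot[OF U]])
      show "eventually (\<lambda>m. cmod (Gm m z j) \<le> M) U"
        using ev by eventually_elim (use z j in blast)
    qed
  qed
  \<comment> \<open>One gradient is to be both the derivative of the limit and the limit of the
    derivatives, so both properties are packed together before choosing.\<close>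
  define der where "der i a \<longleftrightarrow> has_cderiv ?n (\<lambda>z. G z i) c a \<and>
      (\<forall>b l. eventually (\<lambda>m. has_cderiv ?n (\<lambda>z. Gm m z i) c (b m)) U \<longrightarrow> l < ?n \<longrightarrow> ((\<lambda>m. b m l) \<longlongrightarrow> a l) U)"
    for i a
  have der_ex: "\<exists>a. der i a" if i: "i < ?n" for i
  proof -
    have ev1: "eventually (\<lambda>m. \<forall>z\<in>cvec ?n. vnorm ?n (z - c) < \<delta>' \<longrightarrow>
        cdiff ?n (\<lambda>z. Gm m z i) z \<and> cmod (Gm m z i) \<le> M) U"
      using ev
    proof eventually_elim
      case (elim m)
      then show ?case using i unfolding ball_def by blast
    qed
    show ?thesis
    proof (rule cdiff_ultra_limit[OF U c \<delta>' ev1, where g = "\<lambda>z. G z i"])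
      fix z assume "z \<in> cvec ?n" "vnorm ?n (z - c) < \<delta>'"
      then show "((\<lambda>m. Gm m z i) \<longlongrightarrow> G z i) U" using L[of z i] i by (simp add: ball_def)
    next
      fix a assume 1: "has_cderiv ?n (\<lambda>z. G z i) c a"
        and 2: "\<And>b l. eventually (\<lambda>m. has_cderiv ?n (\<lambda>z. Gm m z i) c (b m)) U \<Longrightarrow> l < ?n \<Longrightarrow> ((\<lambda>m. b m l) \<longlongrightarrow> a l) U"
      show ?thesis unfolding der_def by (rule exI[of _ a]) (use 1 2 in simp)
    qed
  qed
  define a where "a i = (SOME a. der i a)" for i
  have der: "der i (a i)" if "i < ?n" for i
    unfolding a_def by (rule someI_ex[OF der_ex[OF that]])
  have a: "has_cderiv ?n (\<lambda>z. G z i) c (a i)" if "i < ?n" for i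
    using der[OF that] unfolding der_def by (rule conjunct1)
  have alim: "((\<lambda>m. b m l) \<longlongrightarrow> a i l) U"
    if "i < ?n" "eventually (\<lambda>m. has_cderiv ?n (\<lambda>z. Gm m z i) c (b m)) U" "l < ?n" for i b l
    using der[OF that(1)] that(2,3) unfolding der_def by (elim conjE allE impE)
  define b where "b m i = (SOME b. has_cderiv ?n (\<lambda>z. Gm m z i) c b)" for m i
  have evb: "eventually (\<lambda>m. \<forall>i<?n. has_cderiv ?n (\<lambda>z. Gm m z i) c (b m i)) U"
    using ev
  proof eventually_elim
    case (elim m)
    show ?case
    proof (intro allI impI)
      fix i assume "i < ?n"
      then have "cdiff ?n (\<lambda>z. Gm m z i) c" using elim ballc by blast
      then show "has_cderiv ?n (\<lambda>z. Gm m z i) c (b m i)" unfolding b_def cdiff_def by (rule someI_ex)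
    qed
  qed
  have blim: "((\<lambda>m. b m i l) \<longlongrightarrow> a i l) U" if "i < ?n" "l < ?n" for i l
  proof (rule alim[OF that(1) _ that(2), of "\<lambda>m. b m i"])
    show "eventually (\<lambda>m. has_cderiv ?n (\<lambda>z. Gm m z i) c (b m i)) U"
      using evb by eventually_elim (use that in blast)
  qed
  define P where "P v = (\<lambda>i. if i < ?n then cdot ?n (a i) v else 0)" for v
  have linP: "lin P" unfolding P_def by (rule lin_matrix)
  have Pc: "P v \<in> cvec ?n" for v by (simp add: P_def cvec_def)
  \<comment> \<open>The matrix is idempotent: differentiate G (G z) = G z at the fixed point
    c.\<close>
  have aa: "(\<Sum>j<?n. a i j * a j l) = a i l" if i: "i < ?n" and l: "l < ?n" for i l
  proof (rule has_cderiv_unique[OF _ a[OF i] c l])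
    have ai: "has_cderiv ?n (\<lambda>z. G z i) (G c) (a i)" unfolding Gc by (rule a[OF i])
    have "has_cderiv ?n (\<lambda>z. G (G z) i) c (\<lambda>l. \<Sum>j<?n. a i j * a j l)"
    proof (rule has_cderiv_chain[of ?n "\<lambda>z. G z i" G c "a i" ?n a \<delta>', OF ai _ \<delta>'])
      show "has_cderiv ?n (\<lambda>z. G z j) c (a j)" if "j < ?n" for j by (rule a[OF that])
      show "G z \<in> cvec ?n" if "z \<in> cvec ?n" "vnorm ?n (z - c) < \<delta>'" for z
        using Gcv[of z] that by (simp add: ball_def)
    qed
    then show "has_cderiv ?n (\<lambda>z. G z i) c (\<lambda>l. \<Sum>j<?n. a i j * a j l)"
    proof (rule has_cderiv_cong[OF _ c \<delta>'])
      fix z assume "z \<in> cvec ?n" "vnorm ?n (z - c) < \<delta>'"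
      then have z: "ball z" by (simp add: ball_def)
      show "G (G z) i = G z i"
        unfolding G_def chart_inv[OF pre A(1) inA(3)[OF z]] idem[OF inA(4)[OF z]] ..
    qed
  qed
  have PP: "P (P v) = P v" for v
  proof (rule cvec_eqI[OF Pc Pc])
    fix i assume i: "i < ?n"
    have "P (P v) i = (\<Sum>j<?n. a i j * (\<Sum>l<?n. a j l * v l))" using i by (simp add: P_def cdot_def)
    also have "\<dots> = (\<Sum>l<?n. (\<Sum>j<?n. a i j * a j l) * v l)"
      unfolding sum_distrib_left sum_distrib_right by (subst sum.swap) (simp add: mult.assoc)
    also have "\<dots> = P v i" using i by (simp add: P_def cdot_def aa)
    finally show "P (P v) i = P v i" .
  qed
  obtain r LA LB where LA: "lin LA" "\<And>v. LA v \<in> cvec r" and LB: "lin LB" "\<And>w. LB w \<in> cvec ?n"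
    and AB: "\<And>w. w \<in> cvec r \<Longrightarrow> LA (LB w) = w" and BA: "\<And>v. LB (LA v) = P v"
  proof (rule idempotent_factorization[of P ?n, OF linP Pc PP])
    fix r A B
    assume "lin A" "lin B" "\<And>v. A v \<in> cvec r" "\<And>w. B w \<in> cvec ?n" "\<And>w. w \<in> cvec r \<Longrightarrow> A (B w) = w"
      "\<And>v. B (A v) = P v"
    then show thesis by (intro that[of A r B])
  qed
  obtain \<alpha> where \<alpha>: "\<alpha> > 0" "\<And>v. v \<in> cvec ?n \<Longrightarrow> vnorm r (LA v) \<le> \<alpha> * vnorm ?n v"
    by (rule lin_bounded[OF LA(1), where n = ?n and m = r]) (rule that)
  obtain \<beta> where \<beta>: "\<beta> > 0" "\<And>v. v \<in> cvec r \<Longrightarrow> vnorm ?n (LB v) \<le> \<beta> * vnorm r v"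
    by (rule lin_bounded[OF LB(1), where n = r and m = ?n]) (rule that)
  \<comment> \<open>\<open>\<eta>\<close> bounds the Lipschitz constant of the deviation
    \<open>E\<close> below. At most 1/2 it separates fixed points with equal coordinates; with
    \<open>\<alpha> * \<eta> * \<beta>\<close> at most 1/2 it makes \<open>H\<close> a contraction
    by one half.\<close>
  define \<eta> where "\<eta> = 1 / (2 * (\<alpha> * \<beta> + 1))"
  have ab: "\<alpha> * \<beta> > 0" using \<alpha>(1) \<beta>(1) by simp
  have \<eta>: "\<eta> > 0" "\<eta> \<le> 1/2" "\<alpha> * \<eta> * \<beta> \<le> 1/2"
    using ab by (auto simp: \<eta>_def field_simps)
  define Q where "Q = real ?n * (32 * M / \<delta>'^2)"
  have Q: "Q \<ge> 0" using M by (simp add: Q_def)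
  \<comment> \<open>Small enough that the nonlinear remainder has Lipschitz constant Q
    \<open>\<delta>\<close> at most \<open>\<eta>\<close> / 2. The other half of
    \<open>\<eta>\<close> is left for the difference between the derivatives of an approximating map
    and of G.\<close>
  define \<delta> where "\<delta> = min (\<delta>' / 2) (\<eta> / 2 / (Q + 1))"
  have \<delta>: "\<delta> > 0" "2 * \<delta> \<le> \<delta>'" "\<delta> < \<delta>'" using \<delta>' \<eta> Q by (auto simp: \<delta>_def)
  have Q\<delta>: "Q * \<delta> \<le> \<eta> / 2"
  proof -
    have "Q * \<delta> \<le> (Q + 1) * \<delta>" using \<delta> by simp
    also have "\<dots> \<le> (Q + 1) * (\<eta> / 2 / (Q + 1))" using Q by (intro mult_left_mono) (auto simp: \<delta>_def)
    also have "\<dots> = \<eta> / 2" using Q by (simp add: field_simps)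
    finally show ?thesis .
  qed
  \<comment> \<open>Chosen so that \<open>LB\<close> sends the ball of radius \<open>\<tau>\<close>
    into vectors of norm at most \<open>\<delta>\<close> / 2.\<close>
  define \<tau> where "\<tau> = \<delta> / (2 * \<beta>)"
  have \<tau>: "\<tau> > 0" "\<beta> * \<tau> = \<delta> / 2" using \<delta> \<beta>(1) by (auto simp: \<tau>_def)
  \<comment> \<open>The allowed displacement of the centre: the first term keeps
    \<open>H K 0\<close> below \<open>\<tau>\<close> / 8, as \<open>perturbed_identity\<close> asks,
    and the second keeps values of K inside the \<open>\<delta>\<close> ball.\<close>
  define \<sigma> where "\<sigma> = min (\<tau> / (8 * \<alpha>)) (\<delta> / 4)"
  have \<sigma>: "\<sigma> > 0" "\<sigma> \<le> \<delta> / 4" "\<alpha> * \<sigma> \<le> \<tau> / 8"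
  proof -
    show "\<sigma> > 0" "\<sigma> \<le> \<delta> / 4" using \<tau> \<alpha> \<delta> by (auto simp: \<sigma>_def)
    have "\<alpha> * \<sigma> \<le> \<alpha> * (\<tau> / (8 * \<alpha>))" using \<alpha>(1) by (intro mult_left_mono) (auto simp: \<sigma>_def)
    then show "\<alpha> * \<sigma> \<le> \<tau> / 8" using \<alpha>(1) by simp
  qed
  define small where "small v \<longleftrightarrow> v \<in> cvec ?n \<and> vnorm ?n v < \<delta>" for v
  have ball_small: "ball (c + v)" if "small v" for v
    using that \<delta> c by (simp add: ball_def small_def)
  \<comment> \<open>\<open>E K\<close> is the deviation of K from the affine map c + P v. The
    predicate \<open>good\<close> collects what G and almost all approximating maps have in common,
    so that one argument serves both.\<close>
  define E where "E K v = K (c + v) - c - P v" for K :: "(nat \<Rightarrow> complex) \<Rightarrow> nat \<Rightarrow> complex" and v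
  define good where "good K \<longleftrightarrow> (\<forall>z. ball z \<longrightarrow> K z \<in> cvec ?n) \<and>
      (\<forall>v w. small v \<longrightarrow> small w \<longrightarrow> vnorm ?n (E K v - E K w) \<le> \<eta> * vnorm ?n (v - w)) \<and>
      vnorm ?n (E K 0) \<le> \<sigma>" for K
  have E0: "E K 0 = K c - c" for K by (simp add: E_def lin_zero[OF linP])
  have Elip: "vnorm ?n (E K v - E K w) \<le> \<eta> * vnorm ?n (v - w)"
    if K: "\<And>z j. ball z \<Longrightarrow> j < ?n \<Longrightarrow> cdiff ?n (\<lambda>z. K z j) z \<and> cmod (K z j) \<le> M"
      and bK: "\<And>i. i < ?n \<Longrightarrow> has_cderiv ?n (\<lambda>z. K z i) c (bb i)"
      and sb: "(\<Sum>i<?n. vnorm ?n (bb i - a i)) \<le> \<eta> / 2" and v: "small v" and w: "small w" for K bb v w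
  proof -
    let ?d = "vnorm ?n (v - w)"
    have "cmod ((E K v - E K w) i) \<le> 32 * M / \<delta>'^2 * \<delta> * ?d + vnorm ?n (bb i - a i) * ?d" if i: "i < ?n" for i
    proof -
      have eq: "(E K v - E K w) i = ((K (c + v) i - cdot ?n (bb i) v) - (K (c + w) i - cdot ?n (bb i) w)) +
          cdot ?n (bb i - a i) (v - w)"
        using i by (simp add: E_def P_def vapply cdot_linear)
      have 1: "cmod ((K (c + v) i - cdot ?n (bb i) v) - (K (c + w) i - cdot ?n (bb i) w)) \<le> 32 * M / \<delta>'^2 * \<delta> * ?d"
        by (rule remainder_lipschitz[of c ?n \<delta> \<delta>' "\<lambda>z. K z i" M "bb i" v w, OF c \<delta>(1,2) _ bK[OF i]])
          (use K i v w in \<open>auto simp: ball_def small_def\<close>)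
      have 2: "cmod (cdot ?n (bb i - a i) (v - w)) \<le> vnorm ?n (bb i - a i) * ?d" by (rule cdot_bound)
      show ?thesis unfolding eq by (rule order_trans[OF norm_triangle_ineq add_mono[OF 1 2]])
    qed
    then have "vnorm ?n (E K v - E K w) \<le> (\<Sum>i<?n. 32 * M / \<delta>'^2 * \<delta> * ?d + vnorm ?n (bb i - a i) * ?d)"
      unfolding vnorm_def[of ?n "E K v - E K w"] by (intro sum_mono) simp
    also have "\<dots> = Q * \<delta> * ?d + (\<Sum>i<?n. vnorm ?n (bb i - a i)) * ?d"
      by (simp add: sum.distrib sum_distrib_right Q_def)
    also have "\<dots> \<le> \<eta> / 2 * ?d + \<eta> / 2 * ?d"
      using Q\<delta> sb by (intro add_mono mult_right_mono) auto
    finally show ?thesis unfolding half_add_half .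
  qed
  have goodG: "good G"
    unfolding good_def
  proof (intro conjI allI impI)
    show "vnorm ?n (E G v - E G w) \<le> \<eta> * vnorm ?n (v - w)" if "small v" "small w" for v w
      by (rule Elip[of G a, OF Gd a _ that]) (use \<eta> in auto)
    show "vnorm ?n (E G 0) \<le> \<sigma>" using \<sigma> by (simp add: E0 Gc)
  qed (use Gcv in auto)
  have goodm: "eventually (\<lambda>m. good (Gm m)) U"
  proof -
    have "((\<lambda>m. \<Sum>i<?n. vnorm ?n (b m i - a i)) \<longlongrightarrow> (\<Sum>i<?n. \<Sum>l<?n. cmod (a i l - a i l))) U"
      unfolding vnorm_def minus_apply
      by (intro tendsto_sum tendsto_norm tendsto_diff tendsto_const) (use blim in auto)
    then have "((\<lambda>m. \<Sum>i<?n. vnorm ?n (b m i - a i)) \<longlongrightarrow> 0) U" by simp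
    then have e1: "eventually (\<lambda>m. (\<Sum>i<?n. vnorm ?n (b m i - a i)) < \<eta> / 2) U"
      using order_tendstoD(2)[of _ 0 U "\<eta> / 2"] \<eta> by simp
    have "((\<lambda>m. vnorm ?n (Gm m c - c)) \<longlongrightarrow> (\<Sum>i<?n. cmod (G c i - c i))) U"
      unfolding vnorm_def minus_apply
      by (intro tendsto_sum tendsto_norm tendsto_diff tendsto_const) (use L ballc in auto)
    then have "((\<lambda>m. vnorm ?n (Gm m c - c)) \<longlongrightarrow> 0) U" by (simp add: Gc)
    then have e2: "eventually (\<lambda>m. vnorm ?n (Gm m c - c) < \<sigma>) U"
      using order_tendstoD(2)[of _ 0 U \<sigma>] \<sigma> by simp
    from ev evb e1 e2 show ?thesis
    proof eventually_elim
      case (elim m)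
      show ?case
        unfolding good_def
      proof (intro conjI allI impI)
        show "Gm m z \<in> cvec ?n" if "ball z" for z
          unfolding Gm_def by (rule chart_cvec[OF pre A(1)]) (use elim(1) that in blast)
        show "vnorm ?n (E (Gm m) v - E (Gm m) w) \<le> \<eta> * vnorm ?n (v - w)" if "small v" "small w" for v w
          by (rule Elip[of "Gm m" "b m", OF _ _ _ that]) (use elim in auto)
        show "vnorm ?n (E (Gm m) 0) \<le> \<sigma>" using elim(4) by (simp add: E0)
      qed
    qed
  qed
  have small_LB: "small (LB u)" if "u \<in> cvec r" "vnorm r u < \<tau>" for u
  proof -
    have "vnorm ?n (LB u) \<le> \<beta> * vnorm r u" by (rule \<beta>(2)[OF that(1)])
    also have "\<dots> \<le> \<beta> * \<tau>" using that \<beta>(1) by (intro mult_left_mono) auto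
    also have "\<dots> < \<delta>" using \<tau> \<delta> by simp
    finally show ?thesis using LB(2) by (simp add: small_def)
  qed
  have Ecv: "E K v \<in> cvec ?n" if "good K" "small v" for K v
    using that ball_small[OF that(2)] c Pc unfolding E_def good_def by simp
  define H where "H K u = LA (E K (LB u))" for K u
  have Hlip: "vnorm r (H K u - H K u') \<le> vnorm r (u - u') / 2"
    if K: "good K" and u: "u \<in> cvec r" "vnorm r u < \<tau>" and u': "u' \<in> cvec r" "vnorm r u' < \<tau>" for K u u'
  proof -
    note s = small_LB[OF u] small_LB[OF u']
    have "vnorm r (H K u - H K u') = vnorm r (LA (E K (LB u) - E K (LB u')))"
      unfolding H_def lin_diff[OF LA(1)] ..
    also have "\<dots> \<le> \<alpha> * vnorm ?n (E K (LB u) - E K (LB u'))"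
      by (rule \<alpha>(2)) (use Ecv[OF K] s in simp)
    also have "\<dots> \<le> \<alpha> * (\<eta> * vnorm ?n (LB u - LB u'))"
      using K s \<alpha>(1) unfolding good_def by (intro mult_left_mono) auto
    also have "\<dots> \<le> \<alpha> * (\<eta> * (\<beta> * vnorm r (u - u')))"
      unfolding lin_diff[OF LB(1), symmetric]
      using \<beta>(2)[of "u - u'"] u u' \<alpha>(1) \<eta>(1) by (intro mult_left_mono) auto
    also have "\<dots> = (\<alpha> * \<eta> * \<beta>) * vnorm r (u - u')" by simp
    also have "\<dots> \<le> 1 / 2 * vnorm r (u - u')" using \<eta>(3) by (intro mult_right_mono) auto
    finally show ?thesis by simp
  qed
  have sm0: "small 0" using \<delta> by (simp add: small_def)
  have H0: "vnorm r (H K 0) \<le> \<tau> / 8" if K: "good K" for K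
  proof -
    have "vnorm r (H K 0) \<le> \<alpha> * vnorm ?n (E K 0)"
      unfolding H_def lin_zero[OF LB(1)] by (rule \<alpha>(2)[OF Ecv[OF K sm0]])
    also have "\<dots> \<le> \<alpha> * \<sigma>" using K \<alpha>(1) unfolding good_def by (intro mult_left_mono) auto
    finally show ?thesis using \<sigma>(3) by simp
  qed
  \<comment> \<open>In the coordinate \<open>LA\<close>, the map K on the slice c + LB u reads u + H
    K u. The norm bound adds up to \<open>\<delta>\<close> / 4 + \<open>\<delta>\<close> / 8 +
    \<open>\<delta>\<close> / 4.\<close>
  have sol: "LA (K (c + LB u) - c) = u + H K u" "vnorm ?n (K (c + LB u) - c) < \<delta>"
    if K: "good K" and u: "u \<in> cvec r" "vnorm r u \<le> \<tau> / 2" for K u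
  proof -
    have u\<tau>: "vnorm r u < \<tau>" using u \<tau> by linarith
    note s = small_LB[OF u(1) u\<tau>]
    have P: "P (LB u) = LB u" unfolding BA[symmetric] AB[OF u(1)] ..
    have eq: "K (c + LB u) - c = LB u + E K (LB u)" unfolding E_def P by simp
    show "LA (K (c + LB u) - c) = u + H K u"
      unfolding eq linD(1)[OF LA(1)] AB[OF u(1)] H_def ..
    have "vnorm ?n (LB u) \<le> \<beta> * vnorm r u" by (rule \<beta>(2)[OF u(1)])
    also have "\<dots> \<le> \<beta> * (\<tau> / 2)" using u \<beta>(1) by (intro mult_left_mono) auto
    also have "\<dots> = \<delta> / 4" using \<tau>(2) by simp
    finally have 1: "vnorm ?n (LB u) \<le> \<delta> / 4" .
    have "vnorm ?n (E K (LB u) - E K 0) \<le> \<eta> * vnorm ?n (LB u - 0)"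
      using K s sm0 unfolding good_def by blast
    also have "\<dots> \<le> 1/2 * (\<delta> / 4)" using 1 \<eta> by (intro mult_mono) auto
    finally have 2: "vnorm ?n (E K (LB u) - E K 0) \<le> \<delta> / 8" by simp
    have 3: "vnorm ?n (E K 0) \<le> \<delta> / 4" using K \<sigma>(2) unfolding good_def by linarith
    have "vnorm ?n (E K (LB u)) \<le> vnorm ?n (E K (LB u) - E K 0) + vnorm ?n (E K 0)" by (rule vnorm_le_add)
    moreover have "vnorm ?n (LB u + E K (LB u)) \<le> vnorm ?n (LB u) + vnorm ?n (E K (LB u))" by (rule vnorm_triangle)
    ultimately show "vnorm ?n (K (c + LB u) - c) < \<delta>" unfolding eq using 1 2 3 \<delta>(1) by linarith
  qed
  define aa where "aa x = LA (\<phi> x - c)" for x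
  \<comment> \<open>A fixed point satisfies v = P v + E G v for v its coordinate vector relative to
    c, and equal values of \<open>aa\<close> mean equal P v. So the difference of two such vectors
    is at most half its own norm.\<close>
  have inj: "x = y" if x: "x \<in> A" "\<rho> x = x" "vnorm ?n (\<phi> x - c) < \<delta>"
      and y: "y \<in> A" "\<rho> y = y" "vnorm ?n (\<phi> y - c) < \<delta>" and eq: "aa x = aa y" for x y
  proof -
    have fixed: "\<phi> z - c = P (\<phi> z - c) + E G (\<phi> z - c)" if z: "z \<in> A" "\<rho> z = z" for z
    proof -
      have "G (\<phi> z) = \<phi> z" unfolding G_def chart_inv[OF pre A(1) z(1)] z(2) ..
      then show ?thesis unfolding E_def by simp
    qed
    have sm: "small (\<phi> x - c)" "small (\<phi> y - c)"
      using x y c chart_cvec[OF pre A(1)] by (simp_all add: small_def)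
    have "P (\<phi> x - c) = P (\<phi> y - c)" using eq unfolding aa_def BA[symmetric] by simp
    then have "(\<phi> x - c) - (\<phi> y - c) = E G (\<phi> x - c) - E G (\<phi> y - c)"
      using fixed[OF x(1,2)] fixed[OF y(1,2)] by (metis add_diff_cancel_left)
    then have "vnorm ?n ((\<phi> x - c) - (\<phi> y - c)) \<le> \<eta> * vnorm ?n ((\<phi> x - c) - (\<phi> y - c))"
      using goodG sm unfolding good_def by metis
    also have "\<dots> \<le> 1/2 * vnorm ?n ((\<phi> x - c) - (\<phi> y - c))" using \<eta> by (intro mult_right_mono) auto
    finally have "vnorm ?n ((\<phi> x - c) - (\<phi> y - c)) \<le> 0" by simp
    then have "\<phi> x = \<phi> y" using vnorm_eq_0D[of "\<phi> x" ?n "\<phi> y"] chart_cvec[OF pre A(1)] x y by simp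
    then show ?thesis using chart_inj[OF pre A(1)] x y by (auto dest: inj_onD)
  qed
  have mem: "eventually (\<lambda>m. p \<in> g m ` S) U"
    using goodm ev
  proof eventually_elim
    case (elim m)
    \<comment> \<open>Solving with right-hand side 0 gives a point whose image y under
      \<open>g m\<close> has coordinate 0. Both y and p are fixed by \<open>\<rho>\<close> and have
      the same coordinate, so y = p.\<close>
    obtain F where F: "F 0 \<in> cvec r \<and> vnorm r (F 0) \<le> \<tau> / 2 \<and> F 0 + H (Gm m) (F 0) = 0"
    proof (rule perturbed_identity[of \<tau> r "H (Gm m)", OF \<tau>(1) _ Hlip[OF elim(1)] H0[OF elim(1)]])
      show "H (Gm m) u \<in> cvec r" for u unfolding H_def by (rule LA(2))
      fix F :: "(nat \<Rightarrow> complex) \<Rightarrow> nat \<Rightarrow> complex"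
      assume "\<And>w. w \<in> cvec r \<Longrightarrow> vnorm r w < \<tau> / 8 \<Longrightarrow>
        F w \<in> cvec r \<and> vnorm r (F w) \<le> \<tau> / 2 \<and> F w + H (Gm m) (F w) = w"
      from this[of 0] show thesis using that \<tau>(1) by simp
    qed
    define z where "z = c + LB (F 0)"
    have "vnorm r (F 0) < \<tau>" using F \<tau> by linarith
    then have bz: "ball z" unfolding z_def using F small_LB ball_small by blast
    define y where "y = g m (?i z)"
    have yA: "y \<in> A" unfolding y_def using elim(2) bz by blast
    have "\<phi> y = Gm m z" unfolding y_def Gm_def ..
    then have "aa y = 0" "vnorm ?n (\<phi> y - c) < \<delta>"
      using sol[OF elim(1), of "F 0"] F unfolding aa_def z_def by auto
    moreover have "aa p = 0" unfolding aa_def c_def by (simp add: lin_zero[OF LA(1)])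
    moreover have "\<rho> y = y" unfolding y_def by (rule \<rho>g[OF inA(4)[OF bz]])
    ultimately have "y = p"
      using inj[OF yA _ _ A(2) p(2)] \<delta>(1) unfolding c_def by simp
    then show ?case unfolding y_def using inA(4)[OF bz] by blast
  qed
  obtain F where F: "\<And>w. w \<in> cvec r \<Longrightarrow> vnorm r w < \<tau> / 8 \<Longrightarrow>
        F w \<in> cvec r \<and> vnorm r (F w) \<le> \<tau> / 2 \<and> F w + H G (F w) = w"
    and Fd: "\<And>w j. w \<in> cvec r \<Longrightarrow> vnorm r w < \<tau> / 8 \<Longrightarrow> j < r \<Longrightarrow> cdiff r (\<lambda>w. F w j) w"
  proof (rule perturbed_identity[of \<tau> r "H G", OF \<tau>(1) _ Hlip[OF goodG] H0[OF goodG]])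
    show "H G u \<in> cvec r" for u unfolding H_def by (rule LA(2))
    fix F :: "(nat \<Rightarrow> complex) \<Rightarrow> nat \<Rightarrow> complex"
    assume 1: "\<And>w. w \<in> cvec r \<Longrightarrow> vnorm r w < \<tau> / 8 \<Longrightarrow>
        F w \<in> cvec r \<and> vnorm r (F w) \<le> \<tau> / 2 \<and> F w + H G (F w) = w"
      and 2: "(\<And>u j. u \<in> cvec r \<Longrightarrow> vnorm r u < \<tau> \<Longrightarrow> j < r \<Longrightarrow> cdiff r (\<lambda>u. H G u j) u) \<Longrightarrow>
      (\<And>w j. w \<in> cvec r \<Longrightarrow> vnorm r w < \<tau> / 8 \<Longrightarrow> j < r \<Longrightarrow> cdiff r (\<lambda>w. F w j) w)"
    have dH: "cdiff r (\<lambda>u. H G u j) u" if u: "u \<in> cvec r" "vnorm r u < \<tau>" for u j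
      unfolding H_def
    proof (rule cdiff_chain[where m = ?n and h = "\<lambda>v. LA v j" and G = "\<lambda>u. E G (LB u)" and r = "\<tau> - vnorm r u"])
      show "cdiff ?n (\<lambda>v. LA v j) (E G (LB u))"
        by (rule cdiffI[OF has_cderiv_lin[OF LA(1) Ecv[OF goodG small_LB[OF u]]]])
      show "\<tau> - vnorm r u > 0" using u by simp
      show "E G (LB w) \<in> cvec ?n" if "w \<in> cvec r" "vnorm r (w - u) < \<tau> - vnorm r u" for w
        by (rule Ecv[OF goodG small_LB[OF that(1)]]) (use vnorm_le_add[of r w u] that(2) in linarith)
      fix i assume i: "i < ?n"
      have lb: "cdiff r (\<lambda>u. LB u k) u" for k by (rule cdiffI[OF has_cderiv_lin[OF LB(1) u(1)]])
      have "cdiff r (\<lambda>u. G (c + LB u) i) u"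
      proof (rule cdiff_chain[where m = ?n and h = "\<lambda>z. G z i" and G = "\<lambda>u. c + LB u" and r = 1])
        show "cdiff ?n (\<lambda>z. G z i) (c + LB u)" using Gd[OF ball_small[OF small_LB[OF u]] i] by blast
        show "cdiff r (\<lambda>z. (c + LB z) k) u" for k unfolding plus_fun_apply by (intro cdiff_intros lb)
      qed (use c LB in auto)
      moreover have "cdiff r (\<lambda>u. P (LB u) i) u"
        using i unfolding P_def cdot_def by (simp, intro cdiff_sum cdiff_intros lb)
      ultimately show "cdiff r (\<lambda>u. E G (LB u) i) u"
        unfolding E_def minus_apply by (intro cdiff_intros)
    qed
    show thesis by (rule that[OF 1 2[OF dH]])
  qed
  \<comment> \<open>F inverts u + H G u, so applying \<open>\<rho>\<close> to the slice point over F
    w yields the fixed point with coordinate w.\<close>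
  define s where "s w = \<rho> (?i (c + LB (F w)))" for w
  \<comment> \<open>The bound on \<open>aa\<close> is built into D so that every fixed point in D
    has its coordinate in the domain of s; the radius handed on is therefore \<open>\<tau>\<close> /
    8.\<close>
  define D where "D = {y \<in> A. vnorm ?n (\<phi> y - c) < \<delta> \<and> vnorm r (aa y) < \<tau> / 8}"
  have da: "mdiff X (cspace_mfd r) aa x" if x: "x \<in> A" for x
  proof (rule mdiff_to_cspaceI[OF pre A(1) x])
    show "aa y \<in> cvec r" for y unfolding aa_def by (rule LA(2))
    fix j assume "j < r"
    have xc: "\<phi> x \<in> cvec ?n" by (rule chart_cvec[OF pre A(1) x])
    obtain e where e: "e > 0" "\<And>z. z \<in> cvec ?n \<Longrightarrow> vnorm ?n (z - \<phi> x) < e \<Longrightarrow> \<phi> (?i z) = z"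
      using chart_nbhd[OF pre A(1) x chart_open[OF pre A(1)] x] by metis
    have "cdiff ?n (\<lambda>z. LA z j - LA c j) (\<phi> x)"
      by (intro cdiff_intros cdiffI[OF has_cderiv_lin[OF LA(1) xc]])
    then show "cdiff ?n (\<lambda>z. aa (?i z) j) (\<phi> x)"
      by (rule cdiff_cong[OF _ xc e(1)]) (simp add: aa_def e(2) lin_diff[OF LA(1)] vapply)
  qed
  have sprop: "small (LB (F w))" "ball (c + LB (F w))" "\<phi> (s w) = G (c + LB (F w))" "s w \<in> D"
      "\<rho> (s w) = s w" "aa (s w) = w" if w: "w \<in> cvec r" "vnorm r w < \<tau> / 8" for w
  proof -
    note Fw = F[OF w]
    have "vnorm r (F w) < \<tau>" using Fw \<tau> by linarith
    then show sm: "small (LB (F w))" using small_LB Fw by blast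
    then show bl: "ball (c + LB (F w))" by (rule ball_small)
    show \<phi>s: "\<phi> (s w) = G (c + LB (F w))" unfolding s_def G_def ..
    show aas: "aa (s w) = w" unfolding aa_def \<phi>s using sol(1)[OF goodG, of "F w"] Fw by simp
    have "s w \<in> A" unfolding s_def by (rule inA(3)[OF bl])
    moreover have "vnorm ?n (\<phi> (s w) - c) < \<delta>" unfolding \<phi>s using sol(2)[OF goodG, of "F w"] Fw by simp
    ultimately show "s w \<in> D" unfolding D_def using aas w by simp
    show "\<rho> (s w) = s w" unfolding s_def by (rule idem[OF inA(4)[OF bl]])
  qed
  have ds: "mdiff (cspace_mfd r) X s w" if w: "w \<in> cvec r" "vnorm r w < \<tau> / 8" for w
  proof (rule mdiff_from_cspaceI[OF pre w(1) A(1), where \<delta> = "\<tau> / 8 - vnorm r w"])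
    have near: "vnorm r w' < \<tau> / 8" if "vnorm r (w' - w) < \<tau> / 8 - vnorm r w" for w'
      using vnorm_le_add[of r w' w] that by linarith
    show pos: "\<tau> / 8 - vnorm r w > 0" using w by simp
    show "s w' \<in> A" if "w' \<in> cvec r" "vnorm r (w' - w) < \<tau> / 8 - vnorm r w" for w'
      using sprop(4)[OF that(1) near[OF that(2)]] unfolding D_def by blast
    fix j assume j: "j < ?n"
    have lb: "cdiff r (\<lambda>w. LB (F w) k) w" for k
    proof (rule cdiff_chain[where m = r and h = "\<lambda>u. LB u k" and G = F, OF _ _ pos])
      show "cdiff r (\<lambda>u. LB u k) (F w)" by (rule cdiffI[OF has_cderiv_lin[OF LB(1)]]) (use F[OF w] in blast)
      show "cdiff r (\<lambda>w. F w k) w" if "k < r" for k by (rule Fd[OF w that])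
      show "F w' \<in> cvec r" if "w' \<in> cvec r" "vnorm r (w' - w) < \<tau> / 8 - vnorm r w" for w'
        using F[OF that(1) near[OF that(2)]] by blast
    qed
    have "cdiff r (\<lambda>w. G (c + LB (F w)) j) w"
    proof (rule cdiff_chain[where m = ?n and h = "\<lambda>z. G z j" and G = "\<lambda>w. c + LB (F w)" and r = 1])
      show "cdiff ?n (\<lambda>z. G z j) (c + LB (F w))" using Gd[OF sprop(2)[OF w] j] by blast
      show "cdiff r (\<lambda>z. (c + LB (F z)) k) w" for k unfolding plus_fun_apply by (intro cdiff_intros lb)
    qed (use c LB in auto)
    then show "cdiff r (\<lambda>z. \<phi> (s z) j) w" unfolding s_def G_def .
  qed
  have "openin T D"
  proof (subst openin_subopen, intro ballI)
    fix x assume x: "x \<in> D"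
    then have xA: "x \<in> A" by (simp add: D_def)
    have "openin (complex_space r) {w \<in> cvec r. vnorm r (w - 0) < \<tau> / 8}" by (rule openin_ball_cvec)
    moreover have "aa x \<in> {w \<in> cvec r. vnorm r (w - 0) < \<tau> / 8}" using x LA(2) by (simp add: D_def aa_def)
    ultimately obtain W where W: "openin T W" "x \<in> W" "aa ` W \<subseteq> {w \<in> cvec r. vnorm r (w - 0) < \<tau> / 8}"
      using mdiff_tcont[OF da[OF xA]] unfolding tcont_def by auto
    let ?N = "{y \<in> A. vnorm ?n (\<phi> y - c) < \<delta>}"
    have "openin T ?N" by (rule chart_nbhd_cont[OF pre A(1)])
    then have "openin T (?N \<inter> W)" using W(1) by (rule openin_Int)
    moreover have "x \<in> ?N \<inter> W" using x W(2) by (simp add: D_def)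
    moreover have "?N \<inter> W \<subseteq> D" using W(3) unfolding D_def by auto
    ultimately show "\<exists>W. openin T W \<and> x \<in> W \<and> W \<subseteq> D" by blast
  qed
  moreover have "p \<in> D"
    using A(2) \<delta>(1) \<tau>(1) unfolding D_def aa_def c_def by (simp add: lin_zero[OF LA(1)])
  moreover have "s (aa x) = x" if x: "x \<in> D" "\<rho> x = x" for x
  proof -
    have w: "aa x \<in> cvec r" "vnorm r (aa x) < \<tau> / 8" using x LA(2) by (simp_all add: D_def aa_def)
    show ?thesis
      by (rule inj) (use sprop(4-6)[OF w] x in \<open>auto simp: D_def\<close>)
  qed
  ultimately show ?thesis
    using \<tau>(1) da ds sprop(4-6) mem
    by (intro exI[of _ r] exI[of _ aa] exI[of _ s] exI[of _ D] exI[of _ "\<tau> / 8"]) (auto simp: D_def)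
qed

end

section \<open>The fixed point set of a holomorphic retraction as a complex manifold\<close>

subsection \<open>The manifold structure on the fixed points of a holomorphic retraction\<close>

lemma continuous_map_subtopology_tcont:
  assumes U: "openin S U" and f: "\<And>x. x \<in> U \<Longrightarrow> f x \<in> topspace T \<and> tcont S T f x"
  shows "continuous_map (subtopology S U) T f"
  unfolding continuous_map_iff_tcont
proof (intro ballI conjI)
  fix x assume "x \<in> topspace (subtopology S U)"
  then have x: "x \<in> U" by simp
  show "f x \<in> topspace T" using f[OF x] by blast
  show "tcont (subtopology S U) T f x"
    unfolding tcont_def
  proof (intro allI impI)
    fix W assume "openin T W \<and> f x \<in> W"
    then obtain V where V: "openin S V" "x \<in> V" "f ` V \<subseteq> W" using f[OF x] unfolding tcont_def by blast
    then have "openin (subtopology S U) (U \<inter> V)" by (simp add: openin_subtopology_Int2)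
    then show "\<exists>V. openin (subtopology S U) V \<and> x \<in> V \<and> f ` V \<subseteq> W" using V x by blast
  qed
qed

lemma mdiff_cspace_charts:
  assumes N: "premfd N" and f: "mdiff (cspace_mfd n) N f p" and V: "(V, \<psi>) \<in> mfd_atlas N" "f p \<in> V"
    and j: "j < mfd_dim N"
  shows "cdiff n (\<lambda>z. \<psi> (f z) j) p"
proof -
  have p: "p \<in> cvec n" using mdiff_carrier(1)[OF f] by simp
  have "cdiff n (\<lambda>z. \<psi> (f (inv_into (cvec n) (\<lambda>z. z) z)) j) p"
    using mdiff_charts[OF premfd_cspace N f, of "cvec n" "\<lambda>z. z" V \<psi> j] V p j by simp
  from cdiff_cong[OF this p, of 1 "\<lambda>z. \<psi> (f z) j"] show ?thesis by (simp add: inv_into_id)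
qed

lemma mdiff_charts_cspace:
  assumes M: "premfd M" and f: "mdiff M (cspace_mfd n) f x" and U: "(U, \<phi>) \<in> mfd_atlas M" "x \<in> U" and j: "j < n"
  shows "cdiff (mfd_dim M) (\<lambda>z. f (inv_into U \<phi> z) j) (\<phi> x)"
  using mdiff_charts[OF M premfd_cspace f U, of "cvec n" "\<lambda>z. z" j] mdiff_carrier(2)[OF f] j by simp

context hyperbolic_manifold
begin

text \<open>The coordinate \<open>a\<close> is holomorphic on an open set D of X, beyond the fixed
  points, and s parametrises the fixed points in D. Hence transition maps a' o s are compositions of
  holomorphic maps of the ambient manifold.\<close>

definition retract_chart :: "('a \<Rightarrow> 'a) \<Rightarrow> nat \<Rightarrow> ('a \<Rightarrow> nat \<Rightarrow> complex) \<Rightarrow> ((nat \<Rightarrow> complex) \<Rightarrow> 'a) \<Rightarrow> 'a set \<Rightarrow> real \<Rightarrow> bool"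
  where "retract_chart \<rho> r a s D \<tau> \<longleftrightarrow> \<tau> > 0 \<and> openin T D \<and> (\<forall>x\<in>D. mdiff X (cspace_mfd r) a x) \<and>
    (\<forall>w\<in>cvec r. vnorm r w < \<tau> \<longrightarrow> mdiff (cspace_mfd r) X s w \<and> s w \<in> D \<and> \<rho> (s w) = s w \<and> a (s w) = w) \<and>
    (\<forall>x\<in>D. \<rho> x = x \<longrightarrow> vnorm r (a x) < \<tau> \<and> s (a x) = x)"

lemma retract_chartD:
  assumes "retract_chart \<rho> r a s D \<tau>"
  shows "\<tau> > 0" "openin T D" "\<And>x. x \<in> D \<Longrightarrow> x \<in> S" "\<And>x. x \<in> D \<Longrightarrow> mdiff X (cspace_mfd r) a x"
    "\<And>x. x \<in> D \<Longrightarrow> a x \<in> cvec r"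
    "\<And>w. w \<in> cvec r \<Longrightarrow> vnorm r w < \<tau> \<Longrightarrow> mdiff (cspace_mfd r) X s w"
    "\<And>w. w \<in> cvec r \<Longrightarrow> vnorm r w < \<tau> \<Longrightarrow> s w \<in> D"
    "\<And>w. w \<in> cvec r \<Longrightarrow> vnorm r w < \<tau> \<Longrightarrow> \<rho> (s w) = s w"
    "\<And>w. w \<in> cvec r \<Longrightarrow> vnorm r w < \<tau> \<Longrightarrow> a (s w) = w"
    "\<And>x. x \<in> D \<Longrightarrow> \<rho> x = x \<Longrightarrow> vnorm r (a x) < \<tau>"
    "\<And>x. x \<in> D \<Longrightarrow> \<rho> x = x \<Longrightarrow> s (a x) = x"
proof -
  note * = assms[unfolded retract_chart_def]
  show "\<tau> > 0" "openin T D" using * by blast+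
  then show "x \<in> S" if "x \<in> D" for x using that openin_subset by blast
  show m: "mdiff X (cspace_mfd r) a x" if "x \<in> D" for x using * that by blast
  show "a x \<in> cvec r" if "x \<in> D" for x using mdiff_carrier(2)[OF m[OF that]] by simp
  show "mdiff (cspace_mfd r) X s w" "s w \<in> D" "\<rho> (s w) = s w" "a (s w) = w"
    if "w \<in> cvec r" "vnorm r w < \<tau>" for w
    using * that by blast+
  show "vnorm r (a x) < \<tau>" "s (a x) = x" if "x \<in> D" "\<rho> x = x" for x
    using * that by blast+
qed

lemma retract_chart_transition:
  assumes c: "retract_chart \<rho> r a s D \<tau>" and c': "retract_chart \<rho> r' a' s' D' \<tau>'"
    and w: "w \<in> cvec r" "vnorm r w < \<tau>" "s w \<in> D'"
  shows "mdiff (cspace_mfd r) (cspace_mfd r') (\<lambda>w. a' (s w)) w"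
    and "\<exists>\<delta>>0. \<forall>z\<in>cvec r. vnorm r (z - w) < \<delta> \<longrightarrow> a' (s z) \<in> cvec r' \<and> a (s' (a' (s z))) = z"
proof -
  note C = retract_chartD[OF c] and C' = retract_chartD[OF c']
  show "mdiff (cspace_mfd r) (cspace_mfd r') (\<lambda>w. a' (s w)) w"
    by (rule mdiff_comp[where f = s and g = a', OF premfd_cspace pre premfd_cspace C(6)[OF w(1,2)] C'(4)[OF w(3)]])
  have "tcont (complex_space r) T s w" using mdiff_tcont[OF C(6)[OF w(1,2)]] by simp
  then obtain V where V: "openin (complex_space r) V" "w \<in> V" "s ` V \<subseteq> D'"
    unfolding tcont_def using C'(2) w(3) by blast
  then obtain \<delta> where \<delta>: "\<delta> > 0" "\<And>z. z \<in> cvec r \<Longrightarrow> vnorm r (z - w) < \<delta> \<Longrightarrow> z \<in> V"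
    unfolding openin_complex_space by blast
  show "\<exists>\<delta>>0. \<forall>z\<in>cvec r. vnorm r (z - w) < \<delta> \<longrightarrow> a' (s z) \<in> cvec r' \<and> a (s' (a' (s z))) = z"
  proof (intro exI[of _ "min \<delta> (\<tau> - vnorm r w)"] conjI ballI impI)
    show "min \<delta> (\<tau> - vnorm r w) > 0" using \<delta> w by simp
    fix z assume z: "z \<in> cvec r" "vnorm r (z - w) < min \<delta> (\<tau> - vnorm r w)"
    have "vnorm r z < \<tau>" using vnorm_le_add[of r z w] z(2) by linarith
    note Cz = C(6-9)[OF z(1) this]
    have "s z \<in> D'" using \<delta>(2)[OF z(1)] z(2) V(3) by auto
    then show "a' (s z) \<in> cvec r'" "a (s' (a' (s z))) = z"
      using C'(5,11) Cz by simp_all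
  qed
qed

text \<open>On the overlap, a' o s and a o s' are holomorphic and inverse to each other, so
  \<open>dimension_invariance\<close> applies.\<close>

lemma retract_chart_dim:
  assumes c: "retract_chart \<rho> r a s D \<tau>" and c': "retract_chart \<rho> r' a' s' D' \<tau>'"
    and x: "x \<in> D" "x \<in> D'" "\<rho> x = x"
  shows "r = r'"
proof -
  note C = retract_chartD[OF c] and C' = retract_chartD[OF c']
  define w where "w = a x"
  define w' where "w' = a' x"
  have w: "w \<in> cvec r" "vnorm r w < \<tau>" "s w = x" unfolding w_def using C(5,10,11) x by auto
  have w': "w' \<in> cvec r'" "vnorm r' w' < \<tau>'" "s' w' = x" unfolding w'_def using C'(5,10,11) x by auto
  have sw: "s w \<in> D'" "s' w' \<in> D" using w w' x by auto
  note t = retract_chart_transition[OF c c' w(1,2) sw(1)]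
  note t' = retract_chart_transition[OF c' c w'(1,2) sw(2)]
  obtain d where d: "d > 0" "\<And>z. z \<in> cvec r \<Longrightarrow> vnorm r (z - w) < d \<Longrightarrow> a' (s z) \<in> cvec r' \<and> a (s' (a' (s z))) = z"
    using t(2) by blast
  obtain d' where d': "d' > 0" "\<And>z. z \<in> cvec r' \<Longrightarrow> vnorm r' (z - w') < d' \<Longrightarrow> a (s' z) \<in> cvec r \<and> a' (s (a (s' z))) = z"
    using t'(2) by blast
  have gw: "a' (s w) = w'" by (simp add: w(3) w'_def)
  show ?thesis
  proof (rule dimension_invariance[of w r "\<lambda>w. a' (s w)" r' "min d d'" "\<lambda>w. a (s' w)"])
    show "cdiff r (\<lambda>z. a' (s z) j) w" if "j < r'" for j by (rule mdiff_cspaceD[OF t(1) that])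
    show "cdiff r' (\<lambda>z. a (s' z) j) (a' (s w))" if "j < r" for j
      unfolding gw by (rule mdiff_cspaceD[OF t'(1) that])
  qed (use w(1) w'(1) d d' gw in auto)
qed

text \<open>The embedding i and the projection q satisfy i q = \<open>\<rho>\<close> and q i = id on
  L. Through these two maps everything about L is later read off from X. The carrier consists of
  reals because the universal property of a canonical semi-model ranges over
  \<open>real cmfd\<close>.\<close>

theorem retract_manifold:
  assumes \<rho>: "holo_map X X \<rho>" and idem: "\<And>x. x \<in> S \<Longrightarrow> \<rho> (\<rho> x) = \<rho> x"
    and charts: "\<And>p. p \<in> S \<Longrightarrow> \<rho> p = p \<Longrightarrow> \<exists>r a s D \<tau>. retract_chart \<rho> r a s D \<tau> \<and> p \<in> D"
  obtains L :: "real cmfd" and i q where "complex_manifold L" "holo_map L X i" "holo_map X L q"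
    "\<And>x. x \<in> S \<Longrightarrow> i (q x) = \<rho> x" "\<And>t. t \<in> carrier_of L \<Longrightarrow> q (i t) = t"
    "\<And>t. t \<in> carrier_of L \<Longrightarrow> \<rho> (i t) = i t"
proof -
  define Z where "Z = {x \<in> S. \<rho> x = x}"
  have ZS: "Z \<subseteq> S" by (auto simp: Z_def)
  have \<rho>S: "\<rho> x \<in> S" if "x \<in> S" for x by (rule holo_map_carrier[OF \<rho> that])
  have \<rho>Z: "\<rho> x \<in> Z" if "x \<in> S" for x using \<rho>S[OF that] idem[OF that] by (simp add: Z_def)
  \<comment> \<open>The five data of a chart are coded as one tuple so that they are chosen
    together.\<close>
  have "\<forall>p\<in>Z. \<exists>t. retract_chart \<rho> (fst t) (fst (snd t)) (fst (snd (snd t))) (fst (snd (snd (snd t))))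
      (snd (snd (snd (snd t)))) \<and> p \<in> fst (snd (snd (snd t)))"
  proof
    fix p assume "p \<in> Z"
    then obtain r a s D \<tau> where "retract_chart \<rho> r a s D \<tau>" "p \<in> D"
      using charts[of p] by (auto simp: Z_def)
    then show "\<exists>t. retract_chart \<rho> (fst t) (fst (snd t)) (fst (snd (snd t))) (fst (snd (snd (snd t))))
        (snd (snd (snd (snd t)))) \<and> p \<in> fst (snd (snd (snd t)))"
      by (intro exI[of _ "(r, a, s, D, \<tau>)"]) simp
  qed
  from bchoice[OF this] obtain t where
    t: "\<And>p. p \<in> Z \<Longrightarrow> retract_chart \<rho> (fst (t p)) (fst (snd (t p))) (fst (snd (snd (t p))))
      (fst (snd (snd (snd (t p))))) (snd (snd (snd (snd (t p))))) \<and> p \<in> fst (snd (snd (snd (t p))))"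
    by blast
  define R where "R p = fst (t p)" for p
  define a where "a p = fst (snd (t p))" for p
  define s where "s p = fst (snd (snd (t p)))" for p
  define D where "D p = fst (snd (snd (snd (t p))))" for p
  define \<tau> where "\<tau> p = snd (snd (snd (snd (t p))))" for p
  have ch: "retract_chart \<rho> (R p) (a p) (s p) (D p) (\<tau> p)" and pD: "p \<in> D p" if "p \<in> Z" for p
    using t[OF that] unfolding R_def a_def s_def D_def \<tau>_def by blast+
  note C = retract_chartD[OF ch]
  obtain x1 where x1: "x1 \<in> S" using cm unfolding complex_manifold_def by blast
  define r where "r = R (\<rho> x1)"
  \<comment> \<open>The chart dimension at \<open>\<rho> x\<close> is locally constant in x: for y
    near x the point \<open>\<rho> y\<close> lies in the chart domains of both
    \<open>\<rho> y\<close> and \<open>\<rho> x\<close>. As X is connected, L has one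
    dimension.\<close>
  have loc: "\<exists>V. openin T V \<and> x \<in> V \<and> (\<forall>y\<in>V. R (\<rho> y) = R (\<rho> x))" if x: "x \<in> S" for x
  proof -
    have c: "continuous_map T T \<rho>" using \<rho> by (simp add: holo_map_def)
    have "openin T {y \<in> S. \<rho> y \<in> D (\<rho> x)}"
      by (rule openin_continuous_map_preimage[OF c C(2)[OF \<rho>Z[OF x]]])
    moreover have "R (\<rho> y) = R (\<rho> x)" if y: "y \<in> S" "\<rho> y \<in> D (\<rho> x)" for y
      by (rule retract_chart_dim[OF ch[OF \<rho>Z[OF y(1)]] ch[OF \<rho>Z[OF x]] pD[OF \<rho>Z[OF y(1)]] y(2) idem[OF y(1)]])
    ultimately show ?thesis using x pD[OF \<rho>Z[OF x]] by blast
  qed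
  have R\<rho>: "R (\<rho> x) = r" if "x \<in> S" for x
  proof -
    let ?A = "{x \<in> S. R (\<rho> x) = r}"
    have "openin T ?A"
    proof (subst openin_subopen, intro ballI)
      fix x assume x: "x \<in> ?A"
      then have "x \<in> S" by simp
      from loc[OF this] obtain V where V: "openin T V" "x \<in> V" "\<forall>y\<in>V. R (\<rho> y) = R (\<rho> x)"
        by (elim exE conjE)
      have "y \<in> ?A" if "y \<in> V" for y
        using x that openin_subset[OF V(1)] bspec[OF V(3) that] by auto
      then have "V \<subseteq> ?A" by (rule subsetI)
      then show "\<exists>V. openin T V \<and> x \<in> V \<and> V \<subseteq> ?A"
        by (intro exI[of _ V] conjI V(1,2))
    qed
    moreover have "openin T (S - ?A)"
    proof (subst openin_subopen, intro ballI)
      fix x assume x: "x \<in> S - ?A"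
      then have "x \<in> S" by simp
      from loc[OF this] obtain V where V: "openin T V" "x \<in> V" "\<forall>y\<in>V. R (\<rho> y) = R (\<rho> x)"
        by (elim exE conjE)
      have "y \<in> S - ?A" if "y \<in> V" for y
        using x that openin_subset[OF V(1)] bspec[OF V(3) that] by auto
      then have "V \<subseteq> S - ?A" by (rule subsetI)
      then show "\<exists>V. openin T V \<and> x \<in> V \<and> V \<subseteq> S - ?A"
        by (intro exI[of _ V] conjI V(1,2))
    qed
    ultimately have "?A = {} \<or> ?A = S"
      using con unfolding connected_space_clopen_in closedin_def by auto
    then show ?thesis using x1 that r_def by blast
  qed
  have RZ: "R p = r" if "p \<in> Z" for p
    using R\<rho>[of p] that by (simp add: Z_def)
  \<comment> \<open>The injection e only relabels points; topology and charts of L are pulled back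
    along i, its inverse.\<close>
  obtain e :: "'a \<Rightarrow> real" where e: "inj_on e S" using complex_manifold_inj_real[OF cm] by blast
  define i where "i = inv_into S e"
  define q where "q x = e (\<rho> x)" for x
  define Ca where "Ca = e ` Z"
  have ie: "i (e x) = x" if "x \<in> S" for x unfolding i_def using e that by simp
  have iZ: "i t \<in> Z" "e (i t) = t" if t: "t \<in> Ca" for t
  proof -
    obtain x where x: "x \<in> Z" "t = e x" using t unfolding Ca_def by blast
    have "i t = x" unfolding x(2) by (rule ie) (use x ZS in blast)
    then show "i t \<in> Z" "e (i t) = t" using x by auto
  qed
  have eZ: "e x \<in> Ca" if "x \<in> Z" for x using that by (simp add: Ca_def)
  have iq: "i (q x) = \<rho> x" if "x \<in> S" for x unfolding q_def by (rule ie[OF \<rho>S[OF that]])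
  define Uc where "Uc p = e ` (D p \<inter> Z)" for p
  define fc where "fc p = (\<lambda>t. a p (i t))" for p
  define L where "L = \<lparr>mfd_dim = r, mfd_top = pullback_topology Ca i T, mfd_atlas = (\<lambda>p. (Uc p, fc p)) ` Z\<rparr>"
  have Lsimps: "mfd_dim L = r" "mfd_top L = pullback_topology Ca i T" "mfd_atlas L = (\<lambda>p. (Uc p, fc p)) ` Z"
    by (simp_all add: L_def)
  have op: "openin (mfd_top L) V \<longleftrightarrow> (\<exists>W. openin T W \<and> V = i -` W \<inter> Ca)" for V
    unfolding Lsimps openin_pullback_topology by blast
  have top: "carrier_of L = Ca"
    unfolding Lsimps topspace_pullback_topology using iZ ZS by auto
  have Uc: "Uc p = i -` (D p) \<inter> Ca" for p
    unfolding Uc_def using ie ZS iZ by (force simp: Ca_def)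
  have Uco: "openin (mfd_top L) (Uc p)" if "p \<in> Z" for p unfolding op Uc using C(2)[OF that] by blast
  define O' where "O' p = {w \<in> cvec r. vnorm r (w - 0) < \<tau> p}" for p
  have O'o: "openin (complex_space r) (O' p)" for p unfolding O'_def by (rule openin_ball_cvec)
  have fcO: "fc p t \<in> O' p" "s p (fc p t) = i t" if p: "p \<in> Z" and t: "t \<in> Uc p" for p t
  proof -
    have it: "i t \<in> D p" "\<rho> (i t) = i t" using t iZ unfolding Uc by (auto simp: Z_def)
    show "fc p t \<in> O' p" "s p (fc p t) = i t"
      unfolding fc_def O'_def using C(5,10,11)[OF p it(1)] it(2) RZ[OF p] by auto
  qed
  have sO: "s p w \<in> Z" "e (s p w) \<in> Uc p" "fc p (e (s p w)) = w" "i (e (s p w)) = s p w"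
    if p: "p \<in> Z" and w: "w \<in> O' p" for p w
  proof -
    have w': "w \<in> cvec (R p)" "vnorm (R p) w < \<tau> p" using w by (simp_all add: O'_def RZ[OF p])
    note s = C(7-9)[OF p w']
    show sZ: "s p w \<in> Z" using s C(3)[OF p s(1)] by (simp add: Z_def)
    then show "e (s p w) \<in> Uc p" unfolding Uc_def using s by blast
    show ies: "i (e (s p w)) = s p w" by (rule ie) (use sZ ZS in blast)
    show "fc p (e (s p w)) = w" unfolding fc_def ies by (rule s(3))
  qed
  have fcim: "fc p ` Uc p = O' p" if p: "p \<in> Z" for p
    using fcO[OF p] sO[OF p] by (force simp: image_iff)
  have fcinj: "inj_on (fc p) (Uc p)" if p: "p \<in> Z" for p
  proof (rule inj_onI)
    fix t t' assume t: "t \<in> Uc p" "t' \<in> Uc p" "fc p t = fc p t'"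
    then have "i t = i t'" using fcO(2)[OF p] by metis
    then show "t = t'" using iZ(2) t unfolding Uc by (metis IntD2)
  qed
  have inv: "inv_into (Uc p) (fc p) w = e (s p w)" if "p \<in> Z" "w \<in> O' p" for p w
    by (rule inv_into_f_eq[OF fcinj[OF that(1)] sO(2,3)[OF that]])
  have ti: "tcont (mfd_top L) T i t" if t: "t \<in> Ca" for t
    unfolding tcont_def
  proof (intro allI impI)
    fix W assume W: "openin T W \<and> i t \<in> W"
    then have "openin (mfd_top L) (i -` W \<inter> Ca)" unfolding op by blast
    moreover have "t \<in> i -` W \<inter> Ca" "i ` (i -` W \<inter> Ca) \<subseteq> W" using W t by auto
    ultimately show "\<exists>V. openin (mfd_top L) V \<and> t \<in> V \<and> i ` V \<subseteq> W" by blast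
  qed
  have tf: "tcont (mfd_top L) (complex_space r) (fc p) t" if p: "p \<in> Z" and t: "t \<in> Uc p" for p t
  proof -
    have it: "t \<in> Ca" "i t \<in> D p" using t unfolding Uc by auto
    have "tcont T (complex_space r) (a p) (i t)" using mdiff_tcont[OF C(4)[OF p it(2)]] by (simp add: RZ[OF p])
    from tcont_comp[OF ti[OF it(1)] this] show ?thesis unfolding fc_def .
  qed
  have smd: "mdiff (cspace_mfd r) X (s p) w" if p: "p \<in> Z" and w: "w \<in> O' p" for p w
    using C(6)[OF p, of w] w by (simp add: O'_def RZ[OF p])
  have tes: "tcont (complex_space r) (mfd_top L) (\<lambda>w. e (s p w)) w" if p: "p \<in> Z" and w: "w \<in> O' p" for p w
    unfolding tcont_def
  proof (intro allI impI)
    fix V assume V: "openin (mfd_top L) V \<and> e (s p w) \<in> V"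
    then obtain W where W: "openin T W" "V = i -` W \<inter> Ca" unfolding op by blast
    have "s p w \<in> W" using V sO(4)[OF p w] unfolding W(2) by simp
    then obtain N where N: "openin (complex_space r) N" "w \<in> N" "s p ` N \<subseteq> W"
      using mdiff_tcont[OF smd[OF p w]] W(1) unfolding tcont_def by auto
    have "openin (complex_space r) (N \<inter> O' p)" using N(1) O'o by (rule openin_Int)
    moreover have "(\<lambda>w. e (s p w)) ` (N \<inter> O' p) \<subseteq> V"
    proof (rule image_subsetI)
      fix v assume v: "v \<in> N \<inter> O' p"
      then have "s p v \<in> W" using N(3) by blast
      then show "e (s p v) \<in> V" unfolding W(2) using sO(1,4)[OF p] v eZ by simp
    qed
    ultimately show "\<exists>N. openin (complex_space r) N \<and> w \<in> N \<and> (\<lambda>w. e (s p w)) ` N \<subseteq> V"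
      using N(2) w by blast
  qed
  have home: "homeomorphic_map (subtopology (mfd_top L) (Uc p)) (subtopology (complex_space r) (O' p)) (fc p)"
    if p: "p \<in> Z" for p
    unfolding homeomorphic_map_maps
  proof (rule exI, unfold homeomorphic_maps_def, intro conjI)
    have sub: "Uc p \<subseteq> carrier_of L" "O' p \<subseteq> cvec r" unfolding top Uc by (auto simp: O'_def)
    have "continuous_map (subtopology (mfd_top L) (Uc p)) (complex_space r) (fc p)"
      by (rule continuous_map_subtopology_tcont[OF Uco[OF p]])
        (use fcO(1)[OF p] tf[OF p] in \<open>auto simp: O'_def\<close>)
    then show "continuous_map (subtopology (mfd_top L) (Uc p)) (subtopology (complex_space r) (O' p)) (fc p)"
      using fcO(1)[OF p] by (auto simp: continuous_map_in_subtopology)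
    have "continuous_map (subtopology (complex_space r) (O' p)) (mfd_top L) (\<lambda>w. e (s p w))"
      by (rule continuous_map_subtopology_tcont[OF O'o])
        (use sO[OF p] tes[OF p] sub in auto)
    then show "continuous_map (subtopology (complex_space r) (O' p)) (subtopology (mfd_top L) (Uc p)) (\<lambda>w. e (s p w))"
      using sO(2)[OF p] by (auto simp: continuous_map_in_subtopology)
    show "\<forall>x\<in>topspace (subtopology (mfd_top L) (Uc p)). e (s p (fc p x)) = x"
    proof
      fix x assume "x \<in> topspace (subtopology (mfd_top L) (Uc p))"
      then have x: "x \<in> Uc p" "x \<in> Ca" by (auto simp: Uc)
      show "e (s p (fc p x)) = x" unfolding fcO(2)[OF p x(1)] by (rule iZ(2)[OF x(2)])
    qed
    show "\<forall>y\<in>topspace (subtopology (complex_space r) (O' p)). fc p (e (s p y)) = y"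
      using sO(3)[OF p] by auto
  qed
  have trans: "holo_fun_on r (fc p ` (Uc p \<inter> Uc p')) (\<lambda>z. fc p' (inv_into (Uc p) (fc p) z) j)"
    if p: "p \<in> Z" and p': "p' \<in> Z" and j: "j < r" for p p' j
  proof -
    have "openin (subtopology (mfd_top L) (Uc p)) (Uc p \<inter> Uc p')"
      using Uco[OF p'] by (simp add: openin_subtopology_Int2)
    then have "openin (subtopology (complex_space r) (O' p)) (fc p ` (Uc p \<inter> Uc p'))"
      using homeomorphic_imp_open_map[OF home[OF p]] unfolding open_map_def by blast
    then have o: "openin (complex_space r) (fc p ` (Uc p \<inter> Uc p'))"
      using O'o openin_trans_full by blast
    show ?thesis
      unfolding holo_fun_on_iff[OF o]
    proof
      fix w assume w: "w \<in> fc p ` (Uc p \<inter> Uc p')"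
      then obtain t where t: "t \<in> Uc p" "t \<in> Uc p'" "w = fc p t" by blast
      have wO: "w \<in> O' p" using t fcO(1)[OF p] by simp
      have "s p w = i t" using fcO(2)[OF p t(1)] t(3) by simp
      then have sD: "s p w \<in> D p'" using t(2) unfolding Uc by simp
      have "mdiff (cspace_mfd r) (cspace_mfd r) (\<lambda>w. a p' (s p w)) w"
        using retract_chart_transition(1)[OF ch[OF p] ch[OF p'], of w] sD wO by (simp add: O'_def RZ[OF p] RZ[OF p'])
      from mdiff_cspaceD[OF this j] have cd: "cdiff r (\<lambda>w. a p' (s p w) j) w" .
      obtain \<delta> where \<delta>: "\<delta> > 0" "\<And>z. z \<in> cvec r \<Longrightarrow> vnorm r (z - w) < \<delta> \<Longrightarrow> z \<in> O' p"
        using O'o[of p] wO unfolding openin_complex_space by blast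
      have wc: "w \<in> cvec r" using wO by (simp add: O'_def)
      show "cdiff r (\<lambda>z. fc p' (inv_into (Uc p) (fc p) z) j) w"
      proof (rule cdiff_cong[OF cd wc \<delta>(1)])
        fix z assume "z \<in> cvec r" "vnorm r (z - w) < \<delta>"
        then have z: "z \<in> O' p" by (rule \<delta>(2))
        show "a p' (s p z) j = fc p' (inv_into (Uc p) (fc p) z) j"
          unfolding inv[OF p z] by (simp add: fc_def sO(4)[OF p z])
      qed
    qed
  qed
  have cov: "(\<Union>p\<in>Z. Uc p) = Ca"
  proof
    show "(\<Union>p\<in>Z. Uc p) \<subseteq> Ca" unfolding Uc by blast
    show "Ca \<subseteq> (\<Union>p\<in>Z. Uc p)"
    proof
      fix t assume t: "t \<in> Ca"
      then have "t \<in> Uc (i t)" using iZ(1)[OF t] pD unfolding Uc by blast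
      then show "t \<in> (\<Union>p\<in>Z. Uc p)" using iZ(1)[OF t] by blast
    qed
  qed
  have preL: "premfd L"
    unfolding premfd_def top unfolding Lsimps(1,3)
    using cov Uco fcim O'o home trans by auto
  have qC: "q x \<in> Ca" if "x \<in> S" for x unfolding q_def using eZ \<rho>Z[OF that] by blast
  have contq: "continuous_map T (mfd_top L) q"
    unfolding continuous_map_def
  proof (intro conjI allI impI)
    show "q \<in> S \<rightarrow> carrier_of L" using qC by (simp add: top)
    fix V assume "openin (mfd_top L) V"
    then obtain W where W: "openin T W" "V = i -` W \<inter> Ca" unfolding op by blast
    have "{x \<in> S. q x \<in> V} = {x \<in> S. \<rho> x \<in> W}" unfolding W(2) using iq qC by auto
    moreover have "openin T {x \<in> S. \<rho> x \<in> W}"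
      by (rule openin_continuous_map_preimage[OF _ W(1)]) (use \<rho> in \<open>simp add: holo_map_def\<close>)
    ultimately show "openin T {x \<in> S. q x \<in> V}" by simp
  qed
  have qi: "q (i t) = t" if t: "t \<in> Ca" for t
    unfolding q_def using iZ[OF t] by (simp add: Z_def)
  have cL: "complex_manifold L"
    unfolding complex_manifold_def
  proof (intro conjI)
    show "Hausdorff_space (mfd_top L)"
      unfolding Hausdorff_space_def top
    proof (intro allI impI)
      fix t t' assume t: "t \<in> Ca \<and> t' \<in> Ca \<and> t \<noteq> t'"
      then have "i t \<in> S" "i t' \<in> S" "i t \<noteq> i t'" using iZ ZS by (metis subsetD)+
      then obtain V W where VW: "openin T V" "openin T W" "i t \<in> V" "i t' \<in> W" "disjnt V W"
        using Haus unfolding Hausdorff_space_def by metis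
      have "openin (mfd_top L) (i -` V \<inter> Ca)" "openin (mfd_top L) (i -` W \<inter> Ca)" using VW op by blast+
      moreover have "disjnt (i -` V \<inter> Ca) (i -` W \<inter> Ca)" using VW(5) by (auto simp: disjnt_iff)
      moreover have "t \<in> i -` V \<inter> Ca" "t' \<in> i -` W \<inter> Ca" using VW t by auto
      ultimately show "\<exists>U V. openin (mfd_top L) U \<and> openin (mfd_top L) V \<and> t \<in> U \<and> t' \<in> V \<and> disjnt U V"
        by blast
    qed
    obtain \<B> where B: "countable \<B>" "\<And>B. B \<in> \<B> \<Longrightarrow> openin T B"
      "\<And>U x. openin T U \<Longrightarrow> x \<in> U \<Longrightarrow> \<exists>B\<in>\<B>. x \<in> B \<and> B \<subseteq> U"
      using cm unfolding complex_manifold_def by meson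
    show "\<exists>\<B>. countable \<B> \<and> (\<forall>B\<in>\<B>. openin (mfd_top L) B) \<and>
        (\<forall>U x. openin (mfd_top L) U \<and> x \<in> U \<longrightarrow> (\<exists>B\<in>\<B>. x \<in> B \<and> B \<subseteq> U))"
    proof (intro exI[of _ "(\<lambda>B. i -` B \<inter> Ca) ` \<B>"] conjI allI impI ballI)
      show "countable ((\<lambda>B. i -` B \<inter> Ca) ` \<B>)" using B(1) by simp
      show "openin (mfd_top L) B" if "B \<in> (\<lambda>B. i -` B \<inter> Ca) ` \<B>" for B using that B(2) op by auto
      fix V t assume V: "openin (mfd_top L) V \<and> t \<in> V"
      then obtain W where W: "openin T W" "V = i -` W \<inter> Ca" unfolding op by blast
      have "i t \<in> W" using V W by simp
      then obtain B where B': "B \<in> \<B>" "i t \<in> B" "B \<subseteq> W" using B(3)[OF W(1)] by blast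
      then show "\<exists>B\<in>(\<lambda>B. i -` B \<inter> Ca) ` \<B>. t \<in> B \<and> B \<subseteq> V"
        using V W by (intro bexI[of _ "i -` B \<inter> Ca"]) auto
    qed
    \<comment> \<open>L is the image of the connected X under q.\<close>
    show "connected_space (mfd_top L)"
    proof -
      have "q ` S = Ca"
      proof
        show "q ` S \<subseteq> Ca" using qC by blast
        show "Ca \<subseteq> q ` S" using qi iZ(1) ZS by (metis image_eqI subsetD subsetI)
      qed
      moreover have "connectedin T S" using con by (simp add: connectedin_topspace)
      ultimately have "connectedin (mfd_top L) (carrier_of L)"
        using connectedin_continuous_map_image[OF contq] unfolding top by metis
      then show ?thesis by (simp add: connectedin_topspace)
    qed
    show "carrier_of L \<noteq> {}" unfolding top using qC x1 by blast
  qed (use preL in \<open>unfold premfd_def, blast+\<close>)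
  have hi: "holo_map L X i"
    unfolding holo_map_iff_mdiff[OF preL pre] top
  proof
    fix t assume t: "t \<in> Ca"
    define p where "p = i t"
    have p: "p \<in> Z" "t \<in> Uc p" "p \<in> S" using iZ(1)[OF t] pD t ZS unfolding p_def Uc by auto
    define w where "w = fc p t"
    have w: "w \<in> O' p" "s p w = i t" using fcO[OF p(1,2)] by (simp_all add: w_def)
    obtain V \<psi> where V: "(V, \<psi>) \<in> mfd_atlas X" "p \<in> V" using chart_exists[OF pre p(3)] by blast
    have "cdiff r (\<lambda>z. \<psi> (i (inv_into (Uc p) (fc p) z)) j) w" if j: "j < mfd_dim X" for j
    proof -
      have cd: "cdiff r (\<lambda>z. \<psi> (s p z) j) w"
        by (rule mdiff_cspace_charts[OF pre smd[OF p(1) w(1)] V(1) _ j]) (use w V in \<open>simp add: p_def\<close>)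
      obtain \<delta> where \<delta>: "\<delta> > 0" "\<And>z. z \<in> cvec r \<Longrightarrow> vnorm r (z - w) < \<delta> \<Longrightarrow> z \<in> O' p"
        using O'o[of p] w(1) unfolding openin_complex_space by blast
      have wc: "w \<in> cvec r" using w(1) by (simp add: O'_def)
      show ?thesis
        by (rule cdiff_cong[OF cd wc \<delta>(1)]) (simp add: inv[OF p(1) \<delta>(2)] sO(4)[OF p(1) \<delta>(2)])
    qed
    moreover have "(Uc p, fc p) \<in> mfd_atlas L" unfolding Lsimps using p by blast
    ultimately show "mdiff L X i t"
      unfolding mdiff_def top using t ti[OF t] p V unfolding p_def[symmetric] w_def Lsimps(1) by blast
  qed
  have hq: "holo_map X L q"
    unfolding holo_map_iff_mdiff[OF pre preL]
  proof
    fix x assume x: "x \<in> S"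
    define p where "p = \<rho> x"
    have p: "p \<in> Z" "p \<in> D p" using \<rho>Z[OF x] pD unfolding p_def by auto
    have qU: "q x \<in> Uc p" unfolding q_def Uc_def p_def[symmetric] using p by blast
    obtain A \<phi> where A: "(A, \<phi>) \<in> mfd_atlas X" "x \<in> A" using chart_exists[OF pre x] by blast
    have "mdiff X X \<rho> x" using \<rho> x holo_map_iff_mdiff[OF pre pre] by blast
    moreover have "mdiff X (cspace_mfd r) (a p) (\<rho> x)"
      using C(4)[OF p] unfolding RZ[OF p(1)] p_def[symmetric] .
    ultimately have md: "mdiff X (cspace_mfd r) (\<lambda>x. a p (\<rho> x)) x"
      by (rule mdiff_comp[where f = \<rho> and g = "a p", OF pre pre premfd_cspace])
    have "cdiff (mfd_dim X) (\<lambda>z. fc p (q (inv_into A \<phi> z)) j) (\<phi> x)" if j: "j < r" for j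
    proof -
      have cd: "cdiff (mfd_dim X) (\<lambda>z. a p (\<rho> (inv_into A \<phi> z)) j) (\<phi> x)"
        by (rule mdiff_charts_cspace[OF pre md A j])
      obtain \<delta> where \<delta>: "\<delta> > 0" "\<And>z. z \<in> cvec (mfd_dim X) \<Longrightarrow> vnorm (mfd_dim X) (z - \<phi> x) < \<delta> \<Longrightarrow> inv_into A \<phi> z \<in> A"
        using chart_nbhd[OF pre A chart_open[OF pre A(1)] A(2)] by metis
      show ?thesis
      proof (rule cdiff_cong[OF cd chart_cvec[OF pre A] \<delta>(1)])
        fix z assume "z \<in> cvec (mfd_dim X)" "vnorm (mfd_dim X) (z - \<phi> x) < \<delta>"
        then have "inv_into A \<phi> z \<in> S" using \<delta>(2) chart_subset[OF pre A(1)] by blast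
        then show "a p (\<rho> (inv_into A \<phi> z)) j = fc p (q (inv_into A \<phi> z)) j"
          unfolding fc_def by (simp add: iq)
      qed
    qed
    moreover have "(Uc p, fc p) \<in> mfd_atlas L" unfolding Lsimps using p by blast
    moreover have "tcont T (mfd_top L) q x" using contq x unfolding continuous_map_iff_tcont by blast
    ultimately show "mdiff X L q x"
      unfolding mdiff_def top using x qC[OF x] A qU unfolding Lsimps(1) by blast
  qed
  show thesis
  proof (rule that[OF cL hi hq iq])
    show "q (i t) = t" "\<rho> (i t) = i t" if "t \<in> carrier_of L" for t
      using that qi iZ unfolding top Z_def by auto
  qed
qed

end

section \<open>Iterates with multi-indices\<close>

section \<open>Commuting tuples\<close>

lemma funpow_closed: "(\<And>x. x \<in> A \<Longrightarrow> f x \<in> A) \<Longrightarrow> x \<in> A \<Longrightarrow> (f ^^ n) x \<in> A"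
  by (induction n) simp_all

lemma funpow_commute_on:
  assumes "\<And>x. x \<in> A \<Longrightarrow> f x \<in> A" "\<And>x. x \<in> A \<Longrightarrow> G (f x) = f (G x)" "x \<in> A"
  shows "G ((f ^^ n) x) = (f ^^ n) (G x)"
  by (induction n) (simp_all add: assms funpow_closed)

lemma multi_iter_closed:
  assumes "\<And>i x. i \<in> {1..k} \<Longrightarrow> x \<in> A \<Longrightarrow> F i x \<in> A" "x \<in> A"
  shows "multi_iter k F N x \<in> A"
  using assms
proof (induction k arbitrary: x)
  case (Suc k)
  have "(F (Suc k) ^^ N (Suc k)) x \<in> A" by (rule funpow_closed) (use Suc.prems in auto)
  then show ?case using Suc.IH Suc.prems(1) by simp
qed simp

lemma multi_iter_commute:
  assumes "\<And>i x. i \<in> {1..k} \<Longrightarrow> x \<in> A \<Longrightarrow> F i x \<in> A" "\<And>i x. i \<in> {1..k} \<Longrightarrow> x \<in> A \<Longrightarrow> G (F i x) = F i (G x)"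
    and "x \<in> A"
  shows "G (multi_iter k F N x) = multi_iter k F N (G x)"
  using assms
proof (induction k arbitrary: x)
  case (Suc k)
  have A: "(F (Suc k) ^^ N (Suc k)) x \<in> A" by (rule funpow_closed) (use Suc.prems in auto)
  have "G ((F (Suc k) ^^ N (Suc k)) x) = (F (Suc k) ^^ N (Suc k)) (G x)"
    by (rule funpow_commute_on[where A = A]) (use Suc.prems in auto)
  moreover have "G (multi_iter k F N ((F (Suc k) ^^ N (Suc k)) x)) = multi_iter k F N (G ((F (Suc k) ^^ N (Suc k)) x))"
    by (rule Suc.IH[OF _ _ A]) (use Suc.prems in auto)
  ultimately show ?case by simp
qed simp

text \<open>Serves to split f as F_j times the product of the other maps, and to write f^n as the
  iterate with constant multi-index n.\<close>

lemma multi_iter_add: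
  assumes F: "\<And>i x. i \<in> {1..k} \<Longrightarrow> x \<in> A \<Longrightarrow> F i x \<in> A" and c: "commuting_on A k F" and x: "x \<in> A"
  shows "multi_iter k F (\<lambda>i. N i + M i) x = multi_iter k F N (multi_iter k F M x)"
  using assms
proof (induction k arbitrary: x)
  case (Suc k)
  let ?f = "F (Suc k)"
  have c': "commuting_on A k F" using Suc.prems(2) by (auto simp: commuting_on_def)
  have fA: "(?f ^^ n) y \<in> A" if "y \<in> A" for n y by (rule funpow_closed) (use Suc.prems(1) that in auto)
  have comm: "(?f ^^ n) (multi_iter k F M y) = multi_iter k F M ((?f ^^ n) y)" if y: "y \<in> A" for n y
  proof (rule multi_iter_commute[where A = A, OF _ _ y])
    fix i x assume i: "i \<in> {1..k}" "x \<in> A"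
    then show "F i x \<in> A" using Suc.prems(1) by simp
    have "F i ((?f ^^ n) x) = (?f ^^ n) (F i x)"
      by (rule funpow_commute_on[where A = A]) (use i Suc.prems in \<open>auto simp: commuting_on_def\<close>)
    then show "(?f ^^ n) (F i x) = F i ((?f ^^ n) x)" ..
  qed
  have "multi_iter (Suc k) F (\<lambda>i. N i + M i) x =
      multi_iter k F N (multi_iter k F M ((?f ^^ N (Suc k)) ((?f ^^ M (Suc k)) x)))"
    using Suc.IH[OF _ c' fA[OF Suc.prems(3)], of "N (Suc k) + M (Suc k)"] Suc.prems(1)
    by (simp add: funpow_add)
  also have "\<dots> = multi_iter k F N ((?f ^^ N (Suc k)) (multi_iter k F M ((?f ^^ M (Suc k)) x)))"
    using comm[OF fA[OF Suc.prems(3)]] by simp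
  finally show ?case by simp
qed simp

lemma multi_iter_zero: "(\<And>i. i \<in> {1..k} \<Longrightarrow> N i = 0) \<Longrightarrow> multi_iter k F N = id"
  by (induction k) simp_all

lemma multi_iter_single:
  "j \<in> {1..k} \<Longrightarrow> multi_iter k F (\<lambda>i. if i = j then 1 else 0) = F j"
proof (induction k)
  case (Suc k)
  show ?case
  proof (cases "j = Suc k")
    case True
    then have "multi_iter k F (\<lambda>i. if i = j then 1 else 0) = id" by (intro multi_iter_zero) auto
    with True show ?thesis by simp
  next
    case False
    then show ?thesis using Suc by simp
  qed
qed simp

lemma multi_iter_const:
  assumes F: "\<And>i x. i \<in> {1..k} \<Longrightarrow> x \<in> A \<Longrightarrow> F i x \<in> A" and c: "commuting_on A k F" and x: "x \<in> A"
  shows "multi_iter k F (\<lambda>_. n) x = (multi_iter k F (\<lambda>_. 1) ^^ n) x"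
proof (induction n)
  case 0
  then show ?case by (simp add: multi_iter_zero)
next
  case (Suc n)
  have "multi_iter k F (\<lambda>_. Suc n) x = multi_iter k F (\<lambda>_. 1 + n) x" by simp
  also have "\<dots> = multi_iter k F (\<lambda>_. 1) (multi_iter k F (\<lambda>_. n) x)" by (rule multi_iter_add[OF F c x])
  finally show ?case using Suc by simp
qed

section \<open>Construction of the model L\<close>

section \<open>A hyperbolic semi-model\<close>

context hyperbolic_manifold
begin

lemma holo_multi_iter:
  "(\<And>i. i \<in> {1..k} \<Longrightarrow> holo_map X X (F i)) \<Longrightarrow> holo_map X X (multi_iter k F N)"
proof (induction k)
  case 0
  then show ?case using holo_map_id[OF pre] by (simp add: id_def)
next
  case (Suc k)
  have "holo_map X X (multi_iter k F N)" "holo_map X X (F (Suc k) ^^ N (Suc k))"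
    using Suc by (auto intro!: holo_funpow)
  then show ?case using holo_map_comp[OF pre pre pre, of "F (Suc k) ^^ N (Suc k)" "multi_iter k F N"]
    by (simp add: o_def)
qed

theorem hyperbolic_semi_model:
  assumes co: "cocompact X" and F: "\<And>j. j \<in> {1..k} \<Longrightarrow> holo_map X X (F j)" and comm: "commuting_on S k F"
  defines "f \<equiv> multi_iter k F (\<lambda>_. 1)"
  obtains L :: "real cmfd" and lm \<Phi> and U :: "nat filter" where
    "semi_model k X F L lm \<Phi>" "kobayashi_hyperbolic L" "U \<noteq> bot"
    "\<And>x y. x \<in> S \<Longrightarrow> y \<in> S \<Longrightarrow> ((\<lambda>m. d ((f ^^ m) x) ((f ^^ m) y)) \<longlongrightarrow> kobayashi L (lm x) (lm y)) U"
proof -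
  have FS: "F j x \<in> S" if "j \<in> {1..k}" "x \<in> S" for j x by (rule holo_map_carrier[OF F[OF that(1)] that(2)])
  have f: "holo_map X X f" unfolding f_def by (rule holo_multi_iter[OF F])
  obtain U :: "nat filter" and h h' \<alpha> where U: "ultra U" "U \<le> sequentially"
    and h: "\<And>m. holo_map X X (h m)" and h': "\<And>m. holo_map X X (h' m)"
    and hh: "\<And>m x. x \<in> S \<Longrightarrow> h' m (h m x) = x"
    and "\<And>m x. x \<in> S \<Longrightarrow> h m (h' m x) = x"
    and \<alpha>: "\<And>n. holo_map X X (\<alpha> n)" and \<alpha>L: "\<And>n x. x \<in> S \<Longrightarrow> dlim U (\<lambda>m. h m ((f ^^ (m - n)) x)) (\<alpha> n x)"
    and suc: "\<And>n x. x \<in> S \<Longrightarrow> \<alpha> (Suc n) (f x) = \<alpha> n x"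
    and ext: "\<And>G s. holo_map X X G \<Longrightarrow> (\<And>x. x \<in> S \<Longrightarrow> G (f x) = f (G x)) \<Longrightarrow>
       \<exists>E. holo_map X X E \<and> (\<forall>x\<in>S. dlim U (\<lambda>m. \<alpha> (m + s) (G (h' m x))) (E x)) \<and>
           (\<forall>n. \<forall>x\<in>S. E (\<alpha> n x) = \<alpha> (n + s) (G x))"
  proof (rule abstract_model[OF co f])
    fix U h h' \<alpha>
    assume a: "ultra U" "U \<le> sequentially" "\<And>m. holo_map X X (h m)" "\<And>m. holo_map X X (h' m)"
      "\<And>m x. x \<in> S \<Longrightarrow> h' m (h m x) = x" "\<And>m x. x \<in> S \<Longrightarrow> h m (h' m x) = x"
      "\<And>n. holo_map X X (\<alpha> n)" "\<And>n x. x \<in> S \<Longrightarrow> dlim U (\<lambda>m. h m ((f ^^ (m - n)) x)) (\<alpha> n x)"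
      "\<And>n x. x \<in> S \<Longrightarrow> \<alpha> (Suc n) (f x) = \<alpha> n x"
      "\<And>G s. holo_map X X G \<Longrightarrow> (\<And>x. x \<in> S \<Longrightarrow> G (f x) = f (G x)) \<Longrightarrow>
       \<exists>E. holo_map X X E \<and> (\<forall>x\<in>S. dlim U (\<lambda>m. \<alpha> (m + s) (G (h' m x))) (E x)) \<and>
           (\<forall>n. \<forall>x\<in>S. E (\<alpha> n x) = \<alpha> (n + s) (G x))"
    show thesis by (rule that[OF a])
  qed
  have \<alpha>S: "\<alpha> n x \<in> S" if "x \<in> S" for n x by (rule holo_map_carrier[OF \<alpha> that])
  have h'S: "h' m x \<in> S" if "x \<in> S" for m x by (rule holo_map_carrier[OF h' that])
  \<comment> \<open>The extension property for the identity with s = 0: \<open>\<rho>\<close> is the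
    limit of \<open>\<alpha> m\<close> composed with \<open>h' m\<close> and fixes every value of
    every \<open>\<alpha> n\<close>.\<close>
  obtain \<rho> where \<rho>: "holo_map X X \<rho>" and \<rho>L: "\<And>x. x \<in> S \<Longrightarrow> dlim U (\<lambda>m. \<alpha> m (h' m x)) (\<rho> x)"
    and \<rho>\<alpha>: "\<And>n x. x \<in> S \<Longrightarrow> \<rho> (\<alpha> n x) = \<alpha> n x"
    using ext[OF holo_map_id[OF pre], of 0] by auto
  have idem: "\<rho> (\<rho> x) = \<rho> x" if x: "x \<in> S" for x
  proof (rule dlim_unique[OF ultra_not_bot[OF U(1)] _ \<rho>L[OF x]])
    have "dlim U (\<lambda>m. \<rho> (\<alpha> m (h' m x))) (\<rho> (\<rho> x))" by (rule dlim_map[OF \<rho>L[OF x] \<rho>])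
    then show "dlim U (\<lambda>m. \<alpha> m (h' m x)) (\<rho> (\<rho> x))" by (simp add: \<rho>\<alpha>[OF h'S[OF x]])
  qed
  have loc: "\<exists>r a s D \<tau>. \<tau> > 0 \<and> openin T D \<and> p \<in> D \<and> (\<forall>x\<in>D. mdiff X (cspace_mfd r) a x) \<and>
    (\<forall>w\<in>cvec r. vnorm r w < \<tau> \<longrightarrow> mdiff (cspace_mfd r) X s w \<and> s w \<in> D \<and> \<rho> (s w) = s w \<and> a (s w) = w) \<and>
    (\<forall>x\<in>D. \<rho> x = x \<longrightarrow> vnorm r (a x) < \<tau> \<and> s (a x) = x) \<and> eventually (\<lambda>m. p \<in> (\<lambda>x. \<alpha> m (h' m x)) ` S) U"
    if p: "p \<in> S" "\<rho> p = p" for p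
    by (rule local_retract[where g = "\<lambda>m x. \<alpha> m (h' m x)" and \<rho> = \<rho> and p = p and U = U, OF U(1) _ \<rho>L \<rho> idem _ p])
      (use holo_map_comp[OF pre pre pre h' \<alpha>] \<rho>\<alpha> h'S in auto)
  \<comment> \<open>The last clause of \<open>local_retract\<close>: almost all maps
    \<open>\<alpha> m\<close> o \<open>h' m\<close> attain p exactly, and one of them suffices. This
    turns the union of the images of the \<open>\<alpha> n\<close> into all of L.\<close>
  have onto: "\<exists>n. \<exists>x\<in>S. p = \<alpha> n x" if p: "p \<in> S" "\<rho> p = p" for p
  proof -
    have "eventually (\<lambda>m. p \<in> (\<lambda>x. \<alpha> m (h' m x)) ` S) U" using loc[OF p] by (elim exE conjE)
    then obtain m where "p \<in> (\<lambda>x. \<alpha> m (h' m x)) ` S"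
      using eventually_happens'[OF ultra_not_bot[OF U(1)]] by blast
    then show ?thesis using h'S by blast
  qed
  have charts: "\<exists>r a s D \<tau>. retract_chart \<rho> r a s D \<tau> \<and> p \<in> D" if p: "p \<in> S" "\<rho> p = p" for p
    using loc[OF p] unfolding retract_chart_def by (elim exE conjE) (intro exI conjI, assumption+)
  obtain L :: "real cmfd" and i q where L: "complex_manifold L" and i: "holo_map L X i" and q: "holo_map X L q"
    and iq: "\<And>x. x \<in> S \<Longrightarrow> i (q x) = \<rho> x" and qi: "\<And>t. t \<in> carrier_of L \<Longrightarrow> q (i t) = t"
    and \<rho>i: "\<And>t. t \<in> carrier_of L \<Longrightarrow> \<rho> (i t) = i t"
    by (rule retract_manifold[OF \<rho> idem charts]) (assumption | rule that)+
  have preL: "premfd L" by (rule premfd_complex_manifold[OF L])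
  have iS: "i t \<in> S" if "t \<in> carrier_of L" for t by (rule holo_map_carrier[OF i that])
  have qL: "q x \<in> carrier_of L" if "x \<in> S" for x by (rule holo_map_carrier[OF q that])
  \<comment> \<open>Neither i nor q increases distances and q i is the identity, so i is an
    isometry. Hyperbolicity of L follows from that of X.\<close>
  have kL: "kobayashi L t t' = d (i t) (i t')" if t: "t \<in> carrier_of L" "t' \<in> carrier_of L" for t t'
  proof (rule antisym)
    show "d (i t) (i t') \<le> kobayashi L t t'" by (rule kobayashi_contract[OF L pre i t])
    show "kobayashi L t t' \<le> d (i t) (i t')"
      using kobayashi_contract[OF cm preL q iS[OF t(1)] iS[OF t(2)]] by (simp add: qi t)
  qed
  have hypL: "kobayashi_hyperbolic L"
    unfolding kobayashi_hyperbolic_def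
  proof
    show k0: "0 \<le> kobayashi L s t" for s t
    proof (cases "s \<in> carrier_of L \<and> t \<in> carrier_of L")
      case True
      then show ?thesis by (simp add: kL)
    next
      case False
      then show ?thesis by (auto simp: kobayashi_def)
    qed
    show "kobayashi L s t = kobayashi L t s" for s t
    proof (cases "s \<in> carrier_of L \<and> t \<in> carrier_of L")
      case True
      then show ?thesis by (simp add: kL d_commute)
    next
      case False
      then show ?thesis by (auto simp: kobayashi_def)
    qed
    show "kobayashi L s t = 0 \<longleftrightarrow> s = t" if "s \<in> carrier_of L" "t \<in> carrier_of L" for s t
      using that d_zero[OF iS iS, of s t] by (simp add: kL) (metis qi)
    show "kobayashi L s u \<le> kobayashi L s t + kobayashi L t u"
      if "s \<in> carrier_of L" "t \<in> carrier_of L" "u \<in> carrier_of L" for s t u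
      using that d_triangle[OF iS iS iS, of s t u] by (simp add: kL)
  qed
  define \<beta> where "\<beta> n x = q (\<alpha> n x)" for n x
  have \<beta>L: "\<beta> n x \<in> carrier_of L" if "x \<in> S" for n x unfolding \<beta>_def by (rule qL[OF \<alpha>S[OF that]])
  have \<beta>suc: "\<beta> (Suc n) (f x) = \<beta> n x" if "x \<in> S" for n x unfolding \<beta>_def suc[OF that] ..
  have i\<beta>: "i (\<beta> n x) = \<alpha> n x" if "x \<in> S" for n x unfolding \<beta>_def by (simp add: iq \<alpha>S \<rho>\<alpha> that)
  have \<beta>onto: "\<exists>n. \<exists>x\<in>S. t = \<beta> n x" if t: "t \<in> carrier_of L" for t
  proof -
    obtain n x where "x \<in> S" "i t = \<alpha> n x" using onto[OF iS[OF t] \<rho>i[OF t]] by blast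
    then have "t = \<beta> n x" unfolding \<beta>_def using qi[OF t] by simp
    then show ?thesis using \<open>x \<in> S\<close> by blast
  qed
  \<comment> \<open>The induced map on L is q E i, with E the extension of G. The shift s is kept
    since inverses need s = 1.\<close>
  have lift: "\<exists>\<Psi>. holo_map L L \<Psi> \<and> (\<forall>n. \<forall>x\<in>S. \<Psi> (\<beta> n x) = \<beta> (n + s) (G x))"
    if G: "holo_map X X G" "\<And>x. x \<in> S \<Longrightarrow> G (f x) = f (G x)" for G s
  proof -
    obtain E where E: "holo_map X X E" "\<And>n x. x \<in> S \<Longrightarrow> E (\<alpha> n x) = \<alpha> (n + s) (G x)"
      using ext[OF G, of s] by blast
    have "holo_map L L (\<lambda>t. q (E (i t)))"
      by (rule holo_map_comp[OF preL pre preL holo_map_comp[OF preL pre pre i E(1)] q])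
    moreover have "q (E (i (\<beta> n x))) = \<beta> (n + s) (G x)" if "x \<in> S" for n x
      by (simp add: i\<beta> E(2) that \<beta>_def[symmetric])
    ultimately show ?thesis by blast
  qed
  have Ff: "F j (f x) = f (F j x)" if "j \<in> {1..k}" "x \<in> S" for j x
    unfolding f_def by (rule multi_iter_commute[where A = S])
      (use FS comm that in \<open>auto simp: commuting_on_def\<close>)
  have "\<forall>j\<in>{1..k}. \<exists>\<Psi>. holo_map L L \<Psi> \<and> (\<forall>n. \<forall>x\<in>S. \<Psi> (\<beta> n x) = \<beta> n (F j x))"
    using lift[OF F Ff, of _ 0] by simp
  from bchoice[OF this] obtain \<Phi> where \<Phi>: "\<And>j. j \<in> {1..k} \<Longrightarrow> holo_map L L (\<Phi> j)"
    and \<Phi>\<beta>: "\<And>j n x. j \<in> {1..k} \<Longrightarrow> x \<in> S \<Longrightarrow> \<Phi> j (\<beta> n x) = \<beta> n (F j x)" by blast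
  have aut: "automorphism L (\<Phi> j)" if j: "j \<in> {1..k}" for j
  proof -
    \<comment> \<open>G is the product of all F_i except F_j, so F_j G = G F_j = f. The map induced
      by G with shift 1 undoes that of F_j: it sends \<open>\<beta> n (F j x)\<close> to
      \<open>\<beta> (Suc n) (f x)\<close>, which is \<open>\<beta> n x\<close>.\<close>
    define G where "G = multi_iter k F (\<lambda>i. if i = j then 0 else 1)"
    have G: "holo_map X X G" unfolding G_def by (rule holo_multi_iter[OF F])
    have GS: "G x \<in> S" if "x \<in> S" for x by (rule holo_map_carrier[OF G that])
    have FG: "F j (G x) = f x" if x: "x \<in> S" for x
    proof -
      have "multi_iter k F (\<lambda>i. (if i = j then 1 else 0) + (if i = j then 0 else 1)) x =
          multi_iter k F (\<lambda>i. if i = j then 1 else 0) (G x)"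
        unfolding G_def by (rule multi_iter_add[OF FS comm x])
      moreover have "(\<lambda>i. (if i = j then 1 else 0) + (if i = j then 0 else 1)) = (\<lambda>_. 1 :: nat)" by auto
      ultimately show ?thesis unfolding multi_iter_single[OF j] f_def by simp
    qed
    have GF: "G (F j x) = f x" if x: "x \<in> S" for x
    proof -
      have "F j (G x) = G (F j x)"
        unfolding G_def by (rule multi_iter_commute[where A = S]) (use FS comm x j in \<open>auto simp: commuting_on_def\<close>)
      then show ?thesis using FG[OF x] by simp
    qed
    have "G (f x) = f (G x)" if "x \<in> S" for x
      unfolding f_def by (rule multi_iter_commute[where A = S, OF FS _ that])
        (use FS comm in \<open>auto simp: commuting_on_def G_def intro!: multi_iter_commute[where A = S, symmetric]\<close>)
    from lift[OF G this, of 1] obtain \<Psi> where \<Psi>: "holo_map L L \<Psi>"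
      "\<And>n x. x \<in> S \<Longrightarrow> \<Psi> (\<beta> n x) = \<beta> (Suc n) (G x)" by auto
    have "\<Psi> (\<Phi> j t) = t \<and> \<Phi> j (\<Psi> t) = t" if t: "t \<in> carrier_of L" for t
    proof -
      obtain n x where x: "x \<in> S" "t = \<beta> n x" using \<beta>onto[OF t] by blast
      show ?thesis
        unfolding x(2) \<Phi>\<beta>[OF j x(1)] \<Psi>(2)[OF x(1)] \<Psi>(2)[OF FS[OF j x(1)]] \<Phi>\<beta>[OF j GS[OF x(1)]]
          FG[OF x(1)] GF[OF x(1)] by (simp add: \<beta>suc[OF x(1)])
    qed
    then show ?thesis unfolding automorphism_def using \<Phi>[OF j] \<Psi>(1) by blast
  qed
  have commL: "commuting_on (carrier_of L) k \<Phi>"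
    unfolding commuting_on_def
  proof (intro ballI)
    fix j j' t assume j: "j \<in> {1..k}" "j' \<in> {1..k}" and t: "t \<in> carrier_of L"
    obtain n x where x: "x \<in> S" "t = \<beta> n x" using \<beta>onto[OF t] by blast
    have "F j (F j' x) = F j' (F j x)" using comm j x by (auto simp: commuting_on_def)
    then show "\<Phi> j (\<Phi> j' t) = \<Phi> j' (\<Phi> j t)"
      unfolding x(2) \<Phi>\<beta>[OF j(1) x(1)] \<Phi>\<beta>[OF j(2) x(1)] \<Phi>\<beta>[OF j(1) FS[OF j(2) x(1)]]
        \<Phi>\<beta>[OF j(2) FS[OF j(1) x(1)]] by simp
  qed
  \<comment> \<open>Bijectivity on the carrier makes \<open>inv_into\<close> in the definition of
    \<open>semi_model\<close> the true inverse.\<close>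
  have bij: "bij_betw (multi_iter k' \<Phi> N) (carrier_of L) (carrier_of L)" if "k' \<le> k" for k' N
    using that
  proof (induction k')
    case 0
    then show ?case by (simp add: bij_betw_def)
  next
    case (Suc k')
    have "bij_betw (\<Phi> (Suc k')) (carrier_of L) (carrier_of L)"
    proof -
      obtain g where g: "holo_map L L g" "\<forall>x\<in>carrier_of L. g (\<Phi> (Suc k') x) = x \<and> \<Phi> (Suc k') (g x) = x"
        using aut[of "Suc k'"] Suc.prems unfolding automorphism_def by auto
      have "\<Phi> (Suc k') x \<in> carrier_of L" if "x \<in> carrier_of L" for x
        by (rule holo_map_carrier[OF \<Phi> that]) (use Suc.prems in simp)
      then show ?thesis
        by (intro bij_betw_byWitness[where f' = g]) (use g holo_map_carrier[OF g(1)] in auto)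
    qed
    then have "bij_betw (\<Phi> (Suc k') ^^ N (Suc k')) (carrier_of L) (carrier_of L)" by (rule bij_betw_funpow)
    moreover have "bij_betw (multi_iter k' \<Phi> N) (carrier_of L) (carrier_of L)" using Suc by simp
    ultimately show ?case unfolding multi_iter.simps by (rule bij_betw_trans)
  qed
  have iter\<beta>: "multi_iter k' \<Phi> N (\<beta> n x) = \<beta> n (multi_iter k' F N x)" if "k' \<le> k" "x \<in> S" for k' N n x
    using that
  proof (induction k' arbitrary: x)
    case (Suc k')
    have j: "Suc k' \<in> {1..k}" using Suc.prems by simp
    have FmS: "(F (Suc k') ^^ m) x \<in> S" for m by (rule funpow_closed) (use FS[OF j] Suc.prems in auto)
    have "(\<Phi> (Suc k') ^^ m) (\<beta> n x) = \<beta> n ((F (Suc k') ^^ m) x)" for m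
      by (induction m) (simp_all add: \<Phi>\<beta>[OF j FmS])
    then show ?case using Suc.IH[OF _ FmS] Suc.prems by simp
  qed simp
  define lm where "lm = \<beta> 0"
  have lmL: "lm x \<in> carrier_of L" if "x \<in> S" for x unfolding lm_def by (rule \<beta>L[OF that])
  have \<beta>f: "\<beta> n ((f ^^ n) x) = \<beta> 0 x" if "x \<in> S" for n x
  proof (induction n)
    case (Suc n)
    show ?case using \<beta>suc[OF funpow_carrier[OF f that, of n], of n] Suc by simp
  qed simp
  have "(\<Union>N. inv_into (carrier_of L) (multi_iter k \<Phi> N) ` lm ` S) = carrier_of L"
  proof
    have "inv_into (carrier_of L) (multi_iter k \<Phi> N) (lm x) \<in> carrier_of L" if "x \<in> S" for N x
      using bij[of k N] lmL[OF that] by (intro inv_into_into) (auto simp: bij_betw_def)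
    then show "(\<Union>N. inv_into (carrier_of L) (multi_iter k \<Phi> N) ` lm ` S) \<subseteq> carrier_of L" by auto
    show "carrier_of L \<subseteq> (\<Union>N. inv_into (carrier_of L) (multi_iter k \<Phi> N) ` lm ` S)"
    proof
      fix t assume t: "t \<in> carrier_of L"
      obtain n x where x: "x \<in> S" "t = \<beta> n x" using \<beta>onto[OF t] by blast
      \<comment> \<open>For t = \<open>\<beta> n x\<close> the multi-index (n, ..., n) moves t to
        \<open>\<beta> n\<close> at f^n x, which is \<open>\<beta> 0 x\<close>, a point of the image
        of \<open>lm\<close>.\<close>
      have "multi_iter k \<Phi> (\<lambda>_. n) t = \<beta> n ((f ^^ n) x)"
        using iter\<beta>[OF order_refl x(1), of "\<lambda>_. n" n] multi_iter_const[of k S F x n, OF FS comm x(1)]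
        by (simp add: x(2) f_def)
      then have "multi_iter k \<Phi> (\<lambda>_. n) t = lm x" unfolding lm_def \<beta>f[OF x(1)] .
      then have "inv_into (carrier_of L) (multi_iter k \<Phi> (\<lambda>_. n)) (lm x) = t"
        using inv_into_f_f[of "multi_iter k \<Phi> (\<lambda>_. n)" "carrier_of L" t] bij[of k "\<lambda>_. n"] t
        by (auto simp: bij_betw_def)
      then show "t \<in> (\<Union>N. inv_into (carrier_of L) (multi_iter k \<Phi> N) ` lm ` S)"
        using x(1) by (metis UNIV_I UN_I image_eqI)
    qed
  qed
  moreover have "holo_map X L lm"
    unfolding lm_def \<beta>_def by (rule holo_map_comp[OF pre pre preL \<alpha> q])
  moreover have "lm (F j x) = \<Phi> j (lm x)" if "j \<in> {1..k}" "x \<in> S" for j x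
    unfolding lm_def by (rule \<Phi>\<beta>[OF that, symmetric])
  ultimately have sm: "semi_model k X F L lm \<Phi>"
    unfolding semi_model_def using L aut commL by blast
  have "((\<lambda>m. d ((f ^^ m) x) ((f ^^ m) y)) \<longlongrightarrow> kobayashi L (lm x) (lm y)) U" if x: "x \<in> S" and y: "y \<in> S" for x y
  proof -
    have "kobayashi L (lm x) (lm y) = d (\<alpha> 0 x) (\<alpha> 0 y)"
      using kL[OF lmL[OF x] lmL[OF y]] unfolding lm_def i\<beta>[OF x] i\<beta>[OF y] .
    moreover have "((\<lambda>m. d (h m ((f ^^ (m - 0)) x)) (h m ((f ^^ (m - 0)) y))) \<longlongrightarrow> d (\<alpha> 0 x) (\<alpha> 0 y)) U"
      by (rule dlim_d[OF \<alpha>L[OF x] \<alpha>L[OF y]])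
    \<comment> \<open>The renormalising maps are automorphisms, hence isometries, and drop out of
      the limit of distances.\<close>
    moreover have "d (h m u) (h m v) = d u v" if uv: "u \<in> S" "v \<in> S" for m u v
    proof (rule antisym)
      show "d (h m u) (h m v) \<le> d u v" by (rule d_contract[OF h uv])
      show "d u v \<le> d (h m u) (h m v)"
        using d_contract[of "h' m" "h m u" "h m v", OF h' holo_map_carrier[OF h uv(1)] holo_map_carrier[OF h uv(2)]]
        unfolding hh[OF uv(1)] hh[OF uv(2)] .
    qed
    ultimately show ?thesis using funpow_carrier[OF f] x y by simp
  qed
  with sm hypL ultra_not_bot[OF U(1)] show thesis by (rule that)
qed

end

section \<open>Subadditivity and the comparison of rates\<close>

section \<open>Divergence rates\<close>

text \<open>Fekete's lemma: the limit is the infimum of a n / n. Pick m with a m / m close to it and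
  divide n by m with remainder. The second conclusion, a bound for every single n, is what the lower
  estimate of the rate of \<open>T j\<close> needs.\<close>

lemma fekete:
  fixes a :: "nat \<Rightarrow> real"
  assumes a0: "\<And>n. 0 \<le> a n" and sub: "\<And>m n. a (m + n) \<le> a m + a n"
  obtains c where "(\<lambda>n. a n / real n) \<longlonglongrightarrow> c" "\<And>n. n \<ge> 1 \<Longrightarrow> c \<le> a n / real n"
proof -
  let ?A = "(\<lambda>n. a n / real n) ` {1..}"
  define c where "c = Inf ?A"
  have bdd: "bdd_below ?A" by (rule bdd_belowI[of _ 0]) (use a0 in auto)
  have lower: "c \<le> a n / real n" if "n \<ge> 1" for n
    unfolding c_def by (rule cInf_lower[OF _ bdd]) (use that in auto)
  have mult: "a (q * m + r) \<le> real q * a m + a r" for q m r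
  proof (induction q)
    case (Suc q)
    have "a (Suc q * m + r) = a (m + (q * m + r))" by (simp add: algebra_simps)
    also have "\<dots> \<le> a m + a (q * m + r)" by (rule sub)
    finally show ?case using Suc by (simp add: algebra_simps)
  qed simp
  have "(\<lambda>n. a n / real n) \<longlonglongrightarrow> c"
    unfolding LIMSEQ_iff
  proof (intro allI impI)
    fix \<epsilon> :: real assume e: "\<epsilon> > 0"
    have "Inf ?A < c + \<epsilon> / 2" using e by (simp add: c_def)
    then obtain m where m: "m \<ge> 1" "a m / real m < c + \<epsilon> / 2"
      using cInf_lessD[of ?A "c + \<epsilon> / 2"] by auto
    define B where "B = (\<Sum>r<m. a r)"
    have B: "a r \<le> B" if "r < m" for r unfolding B_def by (rule member_le_sum) (use that a0 in auto)
    obtain n0 :: nat where n0: "real n0 > 2 * B / \<epsilon>" using reals_Archimedean2 by blast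
    show "\<exists>no. \<forall>n\<ge>no. norm (a n / real n - c) < \<epsilon>"
    proof (intro exI[of _ "max 1 n0"] allI impI)
      fix n assume n: "n \<ge> max 1 n0"
      have "a n \<le> real (n div m) * a m + a (n mod m)" using mult[of "n div m" m "n mod m"] by simp
      also have "\<dots> \<le> real n / real m * a m + B"
      proof (intro add_mono mult_right_mono B)
        have "real (n div m) * real m \<le> real n" by (metis of_nat_le_iff of_nat_mult div_times_less_eq_dividend)
        then show "real (n div m) \<le> real n / real m" using m by (simp add: field_simps)
      qed (use m a0 in auto)
      finally have "a n / real n \<le> (real n / real m * a m + B) / real n" by (intro divide_right_mono) auto
      also have "\<dots> = a m / real m + B / real n" using n by (simp add: field_simps)
      also have "B / real n < \<epsilon> / 2" 
      proof -
        have "2 * B / \<epsilon> < real n" using n0 n by linarith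
        then show ?thesis using e n by (simp add: field_simps)
      qed
      finally have "a n / real n < c + \<epsilon>" using m(2) by linarith
      moreover have "c \<le> a n / real n" using lower n by simp
      ultimately show "norm (a n / real n - c) < \<epsilon>" by simp
    qed
  qed
  with lower that show thesis by blast
qed

context hyperbolic_manifold
begin

text \<open>Iterates are contractions, so the displacements at two base points differ by at most
  twice the distance of these points, which vanishes after division by m. The second clause
  therefore holds at every base point with the same rate.\<close>

lemma divergence_rate:
  assumes f: "holo_map X X f" and x: "x \<in> S"
  shows "(\<lambda>m. d ((f ^^ m) x) x / real m) \<longlonglongrightarrow> divergence_rate X f"
    and "\<And>m. m \<ge> 1 \<Longrightarrow> divergence_rate X f \<le> d ((f ^^ m) x) x / real m"
proof -
  have fS: "(f ^^ m) y \<in> S" if "y \<in> S" for m y by (rule funpow_carrier[OF f that])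
  have ex: "\<exists>c. (\<lambda>m. d ((f ^^ m) y) y / real m) \<longlonglongrightarrow> c \<and> (\<forall>m\<ge>1. c \<le> d ((f ^^ m) y) y / real m)" if y: "y \<in> S" for y
  proof -
    have "d ((f ^^ (m + n)) y) y \<le> d ((f ^^ m) y) y + d ((f ^^ n) y) y" for m n
    proof -
      have "d ((f ^^ (m + n)) y) y \<le> d ((f ^^ (m + n)) y) ((f ^^ m) y) + d ((f ^^ m) y) y"
        by (rule d_triangle) (use fS y in auto)
      also have "d ((f ^^ (m + n)) y) ((f ^^ m) y) \<le> d ((f ^^ n) y) y"
        using d_contract[OF holo_funpow[OF f] fS[OF y] y] by (simp add: funpow_add)
      finally show ?thesis by simp
    qed
    then show ?thesis using fekete[of "\<lambda>m. d ((f ^^ m) y) y"] d_nonneg by metis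
  qed
  obtain c where c: "(\<lambda>m. d ((f ^^ m) x) x / real m) \<longlonglongrightarrow> c" "\<And>m. m \<ge> 1 \<Longrightarrow> c \<le> d ((f ^^ m) x) x / real m"
    using ex[OF x] by blast
  have all: "(\<lambda>m. d ((f ^^ m) y) y / real m) \<longlonglongrightarrow> c" if y: "y \<in> S" for y
  proof -
    have lim0: "(\<lambda>m. 2 * d x y / real m) \<longlonglongrightarrow> 0" by (rule lim_const_over_n)
    have bound: "\<bar>d ((f ^^ m) y) y / real m - d ((f ^^ m) x) x / real m\<bar> \<le> 2 * d x y / real m" for m
    proof -
      have "d ((f ^^ m) x) ((f ^^ m) y) \<le> d x y" by (rule d_contract[OF holo_funpow[OF f] x y])
      then have "\<bar>d ((f ^^ m) y) y - d ((f ^^ m) x) x\<bar> \<le> 2 * d x y"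
        using d_triangle[OF fS[OF y] fS[OF x] y, of m m] d_triangle[OF fS[OF x] x y, of m]
          d_triangle[OF fS[OF x] fS[OF y] x, of m m] d_triangle[OF fS[OF y] y x, of m]
          d_commute[of x y] d_commute[of "(f ^^ m) x" "(f ^^ m) y"] by linarith
      then show ?thesis by (simp add: diff_divide_distrib[symmetric] divide_right_mono)
    qed
    have "(\<lambda>m. d ((f ^^ m) y) y / real m - d ((f ^^ m) x) x / real m) \<longlonglongrightarrow> 0"
      by (rule Lim_null_comparison[OF always_eventually lim0]) (use bound in simp)
    from tendsto_add[OF this c(1)] show ?thesis by simp
  qed
  have "divergence_rate X f = c"
    unfolding divergence_rate_def
  proof (rule the_equality)
    show "\<forall>x\<in>S. (\<lambda>m. d ((f ^^ m) x) x / real m) \<longlonglongrightarrow> c" using all by blast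
    show "c' = c" if "\<forall>x\<in>S. (\<lambda>m. d ((f ^^ m) x) x / real m) \<longlonglongrightarrow> c'" for c'
      using that x c(1) LIMSEQ_unique by blast
  qed
  with c show "(\<lambda>m. d ((f ^^ m) x) x / real m) \<longlonglongrightarrow> divergence_rate X f"
    and "\<And>m. m \<ge> 1 \<Longrightarrow> divergence_rate X f \<le> d ((f ^^ m) x) x / real m" by auto
qed

end

theorem proposition2p23:
  fixes X :: "'a cmfd" and F :: "nat \<Rightarrow> 'a \<Rightarrow> 'a" and k :: nat
    and Z :: "'b cmfd" and l :: "'a \<Rightarrow> 'b" and T :: "nat \<Rightarrow> 'b \<Rightarrow> 'b"
  assumes "complex_manifold X" and "kobayashi_hyperbolic X" and "cocompact X"
    and "k \<ge> 1"
    and "\<And>j. j \<in> {1..k} \<Longrightarrow> holo_map X X (F j)"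
    and "commuting_on (carrier_of X) k F"
    and "canonical_semi_model k X F Z l T"
  shows "\<forall>j\<in>{1..k}. divergence_rate Z (T j) = divergence_rate X (F j)"
proof
  fix j assume j: "j \<in> {1..k}"
  interpret X: hyperbolic_manifold X by standard (use assms in auto)
  have smZ: "semi_model k X F Z l T" and hypZ: "kobayashi_hyperbolic Z"
    using assms(7) unfolding canonical_semi_model_def by blast+
  have cZ: "complex_manifold Z" and l: "holo_map X Z l"
    using smZ unfolding semi_model_def by blast+
  have Tj: "holo_map Z Z (T j)" and lT: "\<And>x. x \<in> carrier_of X \<Longrightarrow> l (F j x) = T j (l x)"
    using smZ j unfolding semi_model_def automorphism_def by blast+
  interpret Z: hyperbolic_manifold Z by standard (use cZ hypZ in auto)
  define f where "f = multi_iter k F (\<lambda>_. 1)"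
  obtain L :: "real cmfd" and h \<Phi> and U :: "nat filter" where
    L: "semi_model k X F L h \<Phi>" "kobayashi_hyperbolic L" and U: "U \<noteq> bot"
    and lim: "\<And>x y. x \<in> carrier_of X \<Longrightarrow> y \<in> carrier_of X \<Longrightarrow>
      ((\<lambda>m. kobayashi X ((f ^^ m) x) ((f ^^ m) y)) \<longlongrightarrow> kobayashi L (h x) (h y)) U"
  proof (rule X.hyperbolic_semi_model[OF assms(3,5,6)])
    fix L :: "real cmfd" and h \<Phi> and U :: "nat filter"
    assume a: "semi_model k X F L h \<Phi>" "kobayashi_hyperbolic L" "U \<noteq> bot"
      "\<And>x y. x \<in> carrier_of X \<Longrightarrow> y \<in> carrier_of X \<Longrightarrow> ((\<lambda>m. kobayashi X ((multi_iter k F (\<lambda>_. 1) ^^ m) x)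
        ((multi_iter k F (\<lambda>_. 1) ^^ m) y)) \<longlongrightarrow> kobayashi L (h x) (h y)) U"
    show thesis by (rule that[OF a[folded f_def]])
  qed
  obtain \<eta> where \<eta>: "holo_map Z L \<eta>" and \<eta>l: "\<And>x. x \<in> carrier_of X \<Longrightarrow> \<eta> (l x) = h x"
    using assms(7) L unfolding canonical_semi_model_def by blast
  have preL: "premfd L" using L(1) premfd_complex_manifold unfolding semi_model_def by blast
  note Fj = assms(5)[OF j]
  have f: "holo_map X X f" unfolding f_def by (rule X.holo_multi_iter[OF assms(5)])
  obtain x where x: "x \<in> carrier_of X" using assms(1) unfolding complex_manifold_def by blast
  have lx: "l y \<in> carrier_of Z" if "y \<in> carrier_of X" for y by (rule holo_map_carrier[OF l that])
  have FjS: "(F j ^^ q) y \<in> carrier_of X" if "y \<in> carrier_of X" for q y by (rule X.funpow_carrier[OF Fj that])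
  have Tl: "(T j ^^ q) (l y) = l ((F j ^^ q) y)" if "y \<in> carrier_of X" for q y
    by (induction q) (simp_all add: lT FjS that)
  have limX: "(\<lambda>q. kobayashi X ((F j ^^ q) x) x / real q) \<longlonglongrightarrow> divergence_rate X (F j)"
    by (rule X.divergence_rate(1)[OF Fj x])
  have limZ: "(\<lambda>q. kobayashi Z (l ((F j ^^ q) x)) (l x) / real q) \<longlonglongrightarrow> divergence_rate Z (T j)"
    using Z.divergence_rate(1)[OF Tj lx[OF x]] by (simp add: Tl x)
  show "divergence_rate Z (T j) = divergence_rate X (F j)"
  proof (rule antisym)
    show "divergence_rate Z (T j) \<le> divergence_rate X (F j)"
    proof (rule LIMSEQ_le[OF limZ limX])
      show "\<exists>N. \<forall>q\<ge>N. kobayashi Z (l ((F j ^^ q) x)) (l x) / real q \<le> kobayashi X ((F j ^^ q) x) x / real q"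
        using kobayashi_contract[OF assms(1) Z.pre l FjS[OF x] x] by (intro exI[of _ 0]) (simp add: divide_right_mono)
    qed
    show "divergence_rate X (F j) \<le> divergence_rate Z (T j)"
    proof (rule LIMSEQ_le_const[OF limZ], intro exI allI impI)
      fix q :: nat assume q: "q \<ge> 1"
      let ?D = "kobayashi Z (l ((F j ^^ q) x)) (l x)"
      \<comment> \<open>The map \<open>\<eta>\<close> gives ?D as an upper bound for a distance in
        L, and that distance is a limit along U. Allowing an error e, a single m then realises it in
        X.\<close>
      have "real q * divergence_rate X (F j) \<le> ?D"
      proof (rule field_le_epsilon)
        fix e :: real assume e: "e > 0"
        have "kobayashi L (h ((F j ^^ q) x)) (h x) \<le> ?D"
          using kobayashi_contract[OF cZ preL \<eta> lx[OF FjS[OF x]] lx[OF x]] by (simp add: \<eta>l FjS x)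
        then have "kobayashi L (h ((F j ^^ q) x)) (h x) < ?D + e" using e by linarith
        from eventually_happens'[OF U order_tendstoD(2)[OF lim[OF FjS[OF x] x] this]]
        obtain m where m: "kobayashi X ((f ^^ m) ((F j ^^ q) x)) ((f ^^ m) x) < ?D + e" by blast
        have Ff: "f (F j y) = F j (f y)" if y: "y \<in> carrier_of X" for y
        proof -
          have "F j (multi_iter k F (\<lambda>_. 1) y) = multi_iter k F (\<lambda>_. 1) (F j y)"
            by (rule multi_iter_commute[where A = "carrier_of X"])
              (use y j assms(6) holo_map_carrier[OF assms(5)] in \<open>auto simp: commuting_on_def\<close>)
          then show ?thesis unfolding f_def by simp
        qed
        have fS: "(f ^^ m) y \<in> carrier_of X" if "y \<in> carrier_of X" for y by (rule X.funpow_carrier[OF f that])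
        \<comment> \<open>Commuting f^m past F_j^q turns the distance into a displacement of F_j^q
          at the base point f^m x.\<close>
        have "(f ^^ m) (F j y) = F j ((f ^^ m) y)" if "y \<in> carrier_of X" for y
          using X.funpow_commute[OF f Fj, of y m] Ff that by simp
        then have "(f ^^ m) ((F j ^^ q) x) = (F j ^^ q) ((f ^^ m) x)"
          by (intro funpow_commute_on[where A = "carrier_of X"]) (use holo_map_carrier[OF Fj] x in auto)
        then have "kobayashi X ((F j ^^ q) ((f ^^ m) x)) ((f ^^ m) x) < ?D + e" using m by simp
        \<comment> \<open>The rate bounds each displacement from below, whatever the base point; so
          it does not matter which m was found.\<close>
        moreover have "real q * divergence_rate X (F j) \<le> kobayashi X ((F j ^^ q) ((f ^^ m) x)) ((f ^^ m) x)"
          using X.divergence_rate(2)[OF Fj fS[OF x] q] q by (simp add: field_simps)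
        ultimately show "real q * divergence_rate X (F j) \<le> ?D + e" by linarith
      qed
      then show "divergence_rate X (F j) \<le> ?D / real q" using q by (simp add: field_simps)
    qed
  qed
qed

end
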